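(* Let $k\ge 3$ and $r$ be integers and let $F$ be a graph with $\chi(F)=r+1>k$. Let $G$ be an $n$-vertex $F$-free blue-red graph with $g(G)=\mathrm{ex}^{\mathrm{col}}(n,F)$, with $n$ sufficiently large. Then the following hold. (i) For every vertex $u$ of $G$, the number of blue $k$-cliques containing $u$ plus the number of red edges containing $u$ is at least $(1+o(1))\binom{r-1}{k-1}\left(\frac{n}{r}\right)^{k-1}$. (ii) Let $\varepsilon>0$ be sufficiently small. Then there exist a partition of $V(G)$ into $r$ parts $A_1,\dots,A_r$, a constant $K=K(F,\varepsilon)$, and a set $B\subseteq V(G)$ of at most $rK(\sigma(F)-1)$ vertices such that the following hold. For each $i$ we have $|A_i|=(1-o(1))n/r$; each red edge is between two elements of $B$; every vertex of $B$ is adjacent to at least $\varepsilon n$ vertices in each part and to at least $cn$ vertices in all but one of the parts, for some constant $c=c(F)>0$. Furthermore, for each $i$, every vertex of $A_i\setminus B$ is adjacent to at most $\varepsilon n$ vertices in $A_i$ and to all but at most $\varepsilon(2r^k+1)n$ vertices in $A_j$ for each $j\neq i$. (iii) Let $\mathcal{H}$ be an $n$-vertex $k$-uniform Berge-$F$-free hypergraph with $\mathrm{ex}_k(n,\text{Berge-}F)$ hyperedges. Then every vertex of $\mathcal{H}$ is contained in at least $(1+o(1))\binom{r-1}{k-1}\left(\frac{n}{r}\right)^{k-1}$ hyperedges.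
   Context: All graphs and hypergraphs are finite and simple; hyperedges of a hypergraph are distinct, and a hypergraph is $k$-uniform if each hyperedge has exactly $k$ vertices. A blue-red graph $G$ is a graph with each edge colored blue or red; $G_{blue}$ and $G_{red}$ are the subgraphs consisting of the blue edges and of the red edges, respectively. A blue $k$-clique is a copy of $K_k$ in $G_{blue}$. A blue-red graph is $F$-free if it does not contain $F$ as a (not necessarily induced) subgraph, regardless of colors. $\mathcal{N}(H,G)$ is the number of (not necessarily induced) copies of $H$ in $G$. For the given $k\ge 3$, $g(G)=\mathcal{N}(K_k,G_{blue})+|E(G_{red})|$, and $\mathrm{ex}^{\mathrm{col}}(n,F)=\max\{g(G): G \text{ is an } n\text{-vertex } F\text{-free blue-red graph}\}$. Given a hypergraph $\mathcal{H}$ and a graph $G$ (with the vertices of $G$ being vertices of $\mathcal{H}$), $\mathcal{H}$ is a Berge-$G$ if there is a bijection between the hyperedges of $\mathcal{H}$ and the edges of $G$ such that each hyperedge contains its image. A hypergraph is Berge-$F$-free if no subhypergraph of it is a Berge-$F$. $\mathrm{ex}_k(n,\text{Berge-}F)$ is the largest number of hyperedges in an $n$-vertex $k$-uniform Berge-$F$-free hypergraph. $\chi$ denotes the chromatic number and $\sigma(F)$ is the smallest possible order of a color class in a proper $\chi(F)$-coloring of $F$. Asymptotic notation: $F$, $k$ (and $\varepsilon$ in (ii)) are fixed and $n\to\infty$; $o(1)$ denotes a quantity tending to $0$ as $n\to\infty$, uniformly over the choice of $G$, $\mathcal{H}$ and the vertex in question. The constants $K$ and $c$ do not depend on $n$ or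 $G$. *)

theory Defs
  imports Complex_Main "HOL-Library.Disjoint_Sets"
begin

record 'a hypergraph =
  verts :: "'a set"
  edges :: "'a set set"

definition is_hypergraph :: "('a, 'z) hypergraph_scheme \<Rightarrow> bool" where
  "is_hypergraph H \<longleftrightarrow> finite (verts H) \<and> edges H \<subseteq> Pow (verts H)"

definition uniform :: "nat \<Rightarrow> ('a, 'z) hypergraph_scheme \<Rightarrow> bool" where
  "uniform k H \<longleftrightarrow> is_hypergraph H \<and> (\<forall>e\<in>edges H. card e = k)"

abbreviation is_graph :: "('a, 'z) hypergraph_scheme \<Rightarrow> bool" where
  "is_graph G \<equiv> uniform 2 G"

definition subhypergraph :: "'a hypergraph \<Rightarrow> ('a, 'z) hypergraph_scheme \<Rightarrow> bool" where
  "subhypergraph S H \<longleftrightarrow> is_hypergraph S \<and> verts S \<subseteq> verts H \<and> edges S \<subseteq> edges H"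

definition isomorphic :: "('a, 'y) hypergraph_scheme \<Rightarrow> ('b, 'z) hypergraph_scheme \<Rightarrow> bool" where
  "isomorphic G H \<longleftrightarrow>
     (\<exists>f. bij_betw f (verts G) (verts H) \<and> edges H = (\<lambda>e. f ` e) ` edges G)"

definition copies :: "'a hypergraph \<Rightarrow> ('b, 'z) hypergraph_scheme \<Rightarrow> 'b hypergraph set" where
  "copies H G = {S. subhypergraph S G \<and> isomorphic H S}"

definition num_copies :: "'a hypergraph \<Rightarrow> ('b, 'z) hypergraph_scheme \<Rightarrow> nat" where
  "num_copies H G = card (copies H G)"

definition free_of :: "'a hypergraph \<Rightarrow> ('b, 'z) hypergraph_scheme \<Rightarrow> bool" where
  "free_of F G \<longleftrightarrow> copies F G = {}"

definition complete_graph :: "nat \<Rightarrow> nat hypergraph" where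
  "complete_graph k = \<lparr>verts = {..<k}, edges = {e. e \<subseteq> {..<k} \<and> card e = 2}\<rparr>"

definition nbrs :: "('a, 'z) hypergraph_scheme \<Rightarrow> 'a \<Rightarrow> 'a set" where
  "nbrs G v = {w. {v, w} \<in> edges G}"

definition proper_coloring :: "('a, 'z) hypergraph_scheme \<Rightarrow> nat \<Rightarrow> ('a \<Rightarrow> nat) \<Rightarrow> bool" where
  "proper_coloring G m c \<longleftrightarrow>
     c ` verts G \<subseteq> {..<m} \<and> (\<forall>u v. {u, v} \<in> edges G \<longrightarrow> c u \<noteq> c v)"

definition chromatic_number :: "('a, 'z) hypergraph_scheme \<Rightarrow> nat" where
  "chromatic_number G = (LEAST m. \<exists>c. proper_coloring G m c)"

definition sigma :: "('a, 'z) hypergraph_scheme \<Rightarrow> nat" where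
  "sigma G = (LEAST s. \<exists>c i. proper_coloring G (chromatic_number G) c \<and>
                 i < chromatic_number G \<and> s = card {v \<in> verts G. c v = i})"

datatype edge_color = Blue | Red

text \<open>The color assigned to sets that are not edges is irrelevant.\<close>

record 'a blue_red_graph = "'a hypergraph" +
  color :: "'a set \<Rightarrow> edge_color"

definition blue_part :: "'a blue_red_graph \<Rightarrow> 'a hypergraph" where
  "blue_part G = \<lparr>verts = verts G, edges = {e \<in> edges G. color G e = Blue}\<rparr>"

definition red_part :: "'a blue_red_graph \<Rightarrow> 'a hypergraph" where
  "red_part G = \<lparr>verts = verts G, edges = {e \<in> edges G. color G e = Red}\<rparr>"

definition blue_cliques :: "nat \<Rightarrow> 'a blue_red_graph \<Rightarrow> 'a hypergraph set" where
  "blue_cliques k G = copies (complete_graph k) (blue_part G)"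

definition g :: "nat \<Rightarrow> 'a blue_red_graph \<Rightarrow> nat" where
  "g k G = num_copies (complete_graph k) (blue_part G) + card (edges (red_part G))"

text \<open>Finite graphs and hypergraphs are taken, up to isomorphism, with natural numbers as
  vertices. The vertex set may be any set of \<open>n\<close> naturals, so the extremal numbers are maxima
  over infinitely many graphs; the values are nevertheless bounded, see
  \<open>ex_col_values_finite\<close> and \<open>ex_berge_values_finite\<close>.\<close>

definition free_blue_red_graphs :: "nat \<Rightarrow> 'b hypergraph \<Rightarrow> nat blue_red_graph set" where
  "free_blue_red_graphs n F = {G. is_graph G \<and> card (verts G) = n \<and> free_of F G}"

definition ex_col :: "nat \<Rightarrow> nat \<Rightarrow> 'b hypergraph \<Rightarrow> nat" where
  "ex_col k n F = Max (g k ` free_blue_red_graphs n F)"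

definition is_berge :: "'a hypergraph \<Rightarrow> 'a hypergraph \<Rightarrow> bool" where
  "is_berge H G \<longleftrightarrow> verts G \<subseteq> verts H \<and>
     (\<exists>\<phi>. bij_betw \<phi> (edges H) (edges G) \<and> (\<forall>h\<in>edges H. \<phi> h \<subseteq> h))"

definition berge_free :: "'b hypergraph \<Rightarrow> 'a hypergraph \<Rightarrow> bool" where
  "berge_free F H \<longleftrightarrow>
     \<not> (\<exists>S F'. subhypergraph S H \<and> is_graph F' \<and> isomorphic F F' \<and> is_berge S F')"

definition berge_free_hypergraphs :: "nat \<Rightarrow> nat \<Rightarrow> 'b hypergraph \<Rightarrow> nat hypergraph set" where
  "berge_free_hypergraphs k n F = {H. uniform k H \<and> card (verts H) = n \<and> berge_free F H}"

definition ex_berge :: "nat \<Rightarrow> nat \<Rightarrow> 'b hypergraph \<Rightarrow> nat" where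
  "ex_berge k n F = Max ((\<lambda>H. card (edges H)) ` berge_free_hypergraphs k n F)"

lemma card_copies_le:
  assumes "is_hypergraph G"
  shows "card (copies H G) \<le> 2 ^ card (verts G) * 2 ^ (2 ^ card (verts G))"
proof -
  let ?P = "Pow (verts G) \<times> Pow (Pow (verts G))"
  have fin: "finite (verts G)" using assms by (simp add: is_hypergraph_def)
  have inj: "inj_on (\<lambda>S. (verts S, edges S)) (copies H G)"
    by (rule inj_onI) (simp add: hypergraph.equality)
  have sub: "(\<lambda>S. (verts S, edges S)) ` copies H G \<subseteq> ?P"
    using assms unfolding copies_def subhypergraph_def is_hypergraph_def by fastforce
  have "card (copies H G) \<le> card ?P"
    using card_inj_on_le[OF inj sub] fin by simp
  then show ?thesis using fin by (simp add: card_cartesian_product card_Pow)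
qed

lemma card_edges_le:
  assumes "is_hypergraph H"
  shows "card (edges H) \<le> 2 ^ card (verts H)"
  using assms card_mono[of "Pow (verts H)" "edges H"]
  by (simp add: is_hypergraph_def card_Pow)

lemma ex_col_values_finite: "finite (g k ` free_blue_red_graphs n F)"
proof -
  have "g k G \<le> 2 ^ n * 2 ^ (2 ^ n) + 2 ^ n" if "G \<in> free_blue_red_graphs n F" for G
  proof -
    have "is_hypergraph (blue_part G)" "is_hypergraph (red_part G)"
      "card (verts (blue_part G)) = n" "card (verts (red_part G)) = n"
      using that
      by (auto simp: free_blue_red_graphs_def uniform_def is_hypergraph_def blue_part_def red_part_def)
    then show ?thesis
      using card_copies_le[of "blue_part G" "complete_graph k"] card_edges_le[of "red_part G"]
      by (simp add: g_def num_copies_def)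
  qed
  then show ?thesis
    by (intro finite_subset[OF _ finite_atMost[of "2 ^ n * 2 ^ (2 ^ n) + 2 ^ n"]]) auto
qed

lemma ex_berge_values_finite: "finite ((\<lambda>H. card (edges H)) ` berge_free_hypergraphs k n F)"
proof -
  have "card (edges H) \<le> 2 ^ n" if "H \<in> berge_free_hypergraphs k n F" for H
    using that card_edges_le[of H] by (auto simp: berge_free_hypergraphs_def uniform_def)
  then show ?thesis
    by (intro finite_subset[OF _ finite_atMost[of "2 ^ n"]]) auto
qed

lemma free_blue_red_graphs_nonempty:
  assumes "edges F \<noteq> {}" shows "free_blue_red_graphs n F \<noteq> {}"
proof -
  have "\<lparr>verts = {..<n}, edges = {}, color = (\<lambda>_. Blue)\<rparr> \<in> free_blue_red_graphs n F"
    using assms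
    by (auto simp: free_blue_red_graphs_def uniform_def is_hypergraph_def free_of_def copies_def
          subhypergraph_def isomorphic_def)
  then show ?thesis by blast
qed

lemma berge_free_hypergraphs_nonempty:
  assumes "edges F \<noteq> {}" shows "berge_free_hypergraphs k n F \<noteq> {}"
proof -
  have "\<lparr>verts = {..<n}, edges = {}\<rparr> \<in> berge_free_hypergraphs k n F"
    using assms
    by (auto simp: berge_free_hypergraphs_def uniform_def is_hypergraph_def berge_free_def
          subhypergraph_def isomorphic_def is_berge_def bij_betw_def)
  then show ?thesis by blast
qed

end

theory Submission
  imports Defs "HOL-Analysis.Convex"
begin

text \<open>
  An \<open>F\<close>-free graph on \<open>n\<close> vertices has only \<open>o(n ^ (r+1))\<close> cliques of order \<open>r+1\<close>, since otherwise it
  would contain a large complete \<open>(r+1)\<close>-partite graph. If moreover it has asymptotically as many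
  \<open>k\<close>-cliques as the Turan graph, then the Moon--Moser inequalities for its clique densities are nearly
  tight, and averaging over \<open>r\<close>-cliques gives a partition into \<open>r\<close> parts of size about \<open>n/r\<close> with \<open>o(n\<^sup>2)\<close>
  edges inside the parts and almost all edges between them. No removal lemma is needed. This applies to
  an extremal blue-red graph, and to the graph of the pairs of vertices that lie in many hyperedges of an
  extremal hypergraph.

  One of the parts contains boundedly many vertices whose links agree on almost all transversals of the
  other parts. Replacing a vertex by a clone with their common link keeps the structure \<open>F\<close>-free
  (resp. Berge-\<open>F\<close>-free), so extremality bounds every degree from below. The degree bounds determine
  the neighbourhoods of single vertices, and a red edge with an end outside \<open>B\<close> would lie in more than
  one \<open>k\<close>-clique after recolouring it blue.
\<close>

section \<open>Cliques and common neighbours\<close>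

text \<open>The graph of all edges is \<open>F\<close>-free, but only the count of blue
  \<open>k\<close>-cliques is known to be large; as \<open>k >= 3\<close>, the red edges are too few
  to matter in that count. Two edge relations are therefore carried along: edges inside the parts
  are bounded for all edges, missing pairs between the parts for the blue ones. The partition is
  read off from \<open>r\<close>-cliques while extremality speaks of \<open>k\<close>-cliques; the
  gap is bridged by following the density sequence from \<open>k\<close> up to \<open>r + 1\<close>,
  where freeness makes it vanish, and back down to the edge density. Averages say nothing about a
  single vertex. For this the partition is taken to minimise the edges inside its parts: a vertex
  with many neighbours in its own part then has as many in every other part, which is what makes the
  exceptional set small. A set of \<open>sigma F\<close> such vertices can play the smallest colour
  class of \<open>F\<close>, hence the factor \<open>sigma F - 1\<close>; in particular the
  exceptional set must be shown empty when \<open>sigma F = 1\<close>. Every o(1) is a limit along a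
  filter of extremal objects, hence uniform over them, and becomes a null sequence in
  \<open>n\<close> only at the end.\<close>

locale fgraph =
  fixes V :: "'a set" and E :: "'a \<Rightarrow> 'a \<Rightarrow> bool"
  assumes finV: "finite V" and symE: "E x y \<Longrightarrow> E y x" and irrE: "\<not> E x x"

definition clq :: "'a set \<Rightarrow> ('a \<Rightarrow> 'a \<Rightarrow> bool) \<Rightarrow> nat \<Rightarrow> 'a set set" where
  "clq V E s = {K. K \<subseteq> V \<and> card K = s \<and> pairwise E K}"

definition ext :: "'a set \<Rightarrow> ('a \<Rightarrow> 'a \<Rightarrow> bool) \<Rightarrow> 'a set \<Rightarrow> 'a set" where
  "ext V E K = {v \<in> V. \<forall>x\<in>K. E v x}"

text \<open>For an \<open>r\<close>-clique \<open>K\<close> of a complete \<open>r\<close>-partite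
  graph these are all vertices, those of \<open>K\<close> included, since each of them is
  non-adjacent only to itself.\<close>

definition ext1 :: "'a set \<Rightarrow> ('a \<Rightarrow> 'a \<Rightarrow> bool) \<Rightarrow> 'a set \<Rightarrow> 'a set" where
  "ext1 V E K = {v \<in> V. card {x \<in> K. \<not> E v x} = 1}"

text \<open>Ordered pairs, so every edge inside a part appears twice; all counts of pairs are
  compared with n^2.\<close>

definition inside :: "'a set \<Rightarrow> ('a \<Rightarrow> 'a \<Rightarrow> bool) \<Rightarrow> ('a \<Rightarrow> 'b) \<Rightarrow> ('a \<times> 'a) set" where
  "inside V E p = {(x, y). x \<in> V \<and> y \<in> V \<and> E x y \<and> p x = p y}"

lemma finite_clq: "finite V \<Longrightarrow> finite (clq V E s)"
  by (rule finite_subset[of _ "Pow V"]) (auto simp: clq_def)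

lemma finite_clq_mem: "finite V \<Longrightarrow> K \<in> clq V E s \<Longrightarrow> finite K"
  by (auto simp: clq_def intro: finite_subset)

lemma clq_0: "finite V \<Longrightarrow> clq V E 0 = {{}}"
  by (auto simp: clq_def dest: finite_subset)

lemma finite_ext: "finite V \<Longrightarrow> finite (ext V E K)"
  by (simp add: ext_def)

lemma clq_mono:
  assumes "V \<subseteq> V'" "\<And>x y. E x y \<Longrightarrow> E' x y"
  shows "clq V E s \<subseteq> clq V' E' s"
  using assms by (auto simp: clq_def pairwise_def)

context fgraph
begin

text \<open>Removing a marked vertex from an (s+1)-clique and adding a common neighbour to an
  s-clique are inverse to each other. The counting identities for cliques below are instances of
  this one.\<close>

lemma sum_clq_Suc:
  fixes h :: "'a set \<Rightarrow> 'a \<Rightarrow> 'b :: comm_monoid_add"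
  shows "(\<Sum>K\<in>clq V E (Suc s). \<Sum>x\<in>K. h (K - {x}) x) = (\<Sum>K\<in>clq V E s. \<Sum>x\<in>ext V E K. h K x)"
proof -
  have "(\<Sum>K\<in>clq V E (Suc s). \<Sum>x\<in>K. h (K - {x}) x)
      = (\<Sum>(K, x)\<in>Sigma (clq V E (Suc s)) (\<lambda>K. K). h (K - {x}) x)"
    by (rule sum.Sigma) (auto simp: finite_clq finV intro: finite_clq_mem[OF finV])
  also have "\<dots> = (\<Sum>(K, x)\<in>Sigma (clq V E s) (ext V E). h K x)"
  proof (rule sum.reindex_bij_witness[where i = "\<lambda>(K, x). (insert x K, x)"
        and j = "\<lambda>(K, x). (K - {x}, x)"], goal_cases)
    case (2 a)
    then show ?case
      using symE by (auto simp: clq_def ext_def pairwise_def)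
  next
    case (3 b)
    obtain K x where b: "b = (K, x)" "x \<in> ext V E K" using 3 by auto
    have "x \<notin> K" using irrE[of x] b(2) by (auto simp: ext_def)
    then show ?case using b by simp
  next
    case (4 b)
    obtain K x where b: "b = (K, x)" "K \<in> clq V E s" "x \<in> ext V E K" using 4 by auto
    then have "x \<notin> K" "finite K" using irrE finite_clq_mem[OF finV] by (auto simp: ext_def)
    then show ?case using b symE by (auto simp: clq_def ext_def pairwise_insert)
  qed auto
  also have "\<dots> = (\<Sum>K\<in>clq V E s. \<Sum>x\<in>ext V E K. h K x)"
    by (rule sum.Sigma[symmetric]) (auto simp: finite_clq finV finite_ext)
  finally show ?thesis .
qed

lemma sum_clq_insert:
  fixes h :: "'a set \<Rightarrow> 'b :: comm_semiring_1"
  shows "(\<Sum>K\<in>clq V E s. \<Sum>x\<in>ext V E K. h (insert x K)) = of_nat (Suc s) * (\<Sum>K\<in>clq V E (Suc s). h K)"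
proof -
  have "(\<Sum>K\<in>clq V E s. \<Sum>x\<in>ext V E K. h (insert x K))
      = (\<Sum>K\<in>clq V E (Suc s). \<Sum>x\<in>K. h (insert x (K - {x})))"
    by (rule sum_clq_Suc[symmetric])
  also have "\<dots> = (\<Sum>K\<in>clq V E (Suc s). \<Sum>x\<in>K. h K)"
    by (intro sum.cong refl) (simp add: insert_absorb)
  also have "\<dots> = (\<Sum>K\<in>clq V E (Suc s). of_nat (Suc s) * h K)"
    by (intro sum.cong refl) (simp add: clq_def)
  finally show ?thesis by (simp only: sum_distrib_left)
qed

lemma sum_card_ext: "(\<Sum>K\<in>clq V E s. card (ext V E K)) = Suc s * card (clq V E (Suc s))"
  using sum_clq_insert[of "\<lambda>_. 1 :: nat" s] by simp

lemma sum_card_ext_remove: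
  "(\<Sum>K\<in>clq V E (Suc s). \<Sum>x\<in>K. card (ext V E (K - {x}))) = (\<Sum>K\<in>clq V E s. (card (ext V E K))\<^sup>2)"
  using sum_clq_Suc[of "\<lambda>K _. card (ext V E K)" s] by (simp add: power2_eq_square)

text \<open>A vertex that misses exactly one element of \<open>K\<close> is counted for that element
  only, a common neighbour of \<open>K\<close> is counted for every element, and any other vertex
  never.\<close>

lemma card_ext_remove:
  assumes "finite K" "card K = Suc s"
  shows "(\<Sum>x\<in>K. card (ext V E (K - {x}))) = card (ext1 V E K) + Suc s * card (ext V E K)"
proof -
  have "(\<Sum>x\<in>K. card (ext V E (K - {x}))) = (\<Sum>x\<in>K. \<Sum>v\<in>V. of_bool (\<forall>y\<in>K - {x}. E v y))"
    by (intro sum.cong refl) (simp add: ext_def finV sum.If_cases Int_def of_bool_def)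
  also have "\<dots> = (\<Sum>v\<in>V. \<Sum>x\<in>K. of_bool (\<forall>y\<in>K - {x}. E v y))"
    by (rule sum.swap)
  also have "\<dots> = (\<Sum>v\<in>V. of_bool (v \<in> ext1 V E K) + Suc s * of_bool (v \<in> ext V E K))"
  proof (rule sum.cong[OF refl])
    fix v assume v: "v \<in> V"
    let ?M = "{x \<in> K. \<not> E v x}"
    have fM: "finite ?M" using assms by simp
    \<comment> \<open>\<open>v\<close> is counted for \<open>x\<close> exactly when every element of
      \<open>K\<close> that it misses equals \<open>x\<close>.\<close>
    have "(\<Sum>x\<in>K. of_bool (\<forall>y\<in>K - {x}. E v y)) = card {x \<in> K. ?M \<subseteq> {x}}"
      using assms by (simp add: sum.If_cases Int_def of_bool_def) (rule arg_cong[where f = card], blast)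
    also have "\<dots> = of_bool (v \<in> ext1 V E K) + Suc s * of_bool (v \<in> ext V E K)"
    proof -
      consider "card ?M = 0" | "card ?M = 1" | "card ?M > 1" by linarith
      then show ?thesis
      proof cases
        case 1
        then have M: "?M = {}" using fM by simp
        then have "{x \<in> K. ?M \<subseteq> {x}} = K" unfolding M by simp
        moreover have "v \<in> ext V E K" using M v by (auto simp: ext_def)
        moreover have "v \<notin> ext1 V E K" using 1 by (simp add: ext1_def)
        ultimately show ?thesis using assms by simp
      next
        case 2
        then obtain z where z: "?M = {z}" by (auto simp: card_Suc_eq)
        then have "{x \<in> K. ?M \<subseteq> {x}} = {z}" by auto
        moreover have "v \<notin> ext V E K" using z by (auto simp: ext_def)
        moreover have "v \<in> ext1 V E K" using 2 v by (simp add: ext1_def)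
        ultimately show ?thesis by simp
      next
        case 3
        have "{x \<in> K. ?M \<subseteq> {x}} = {}"
        proof (rule ccontr)
          assume "{x \<in> K. ?M \<subseteq> {x}} \<noteq> {}"
          then obtain x where "?M \<subseteq> {x}" by auto
          then have "card ?M \<le> card {x}" by (intro card_mono) auto
          then show False using 3 by simp
        qed
        then have "card {x \<in> K. ?M \<subseteq> {x}} = 0" by (simp only: card.empty)
        moreover have "v \<notin> ext V E K"
        proof
          assume "v \<in> ext V E K"
          then have "?M = {}" by (auto simp: ext_def)
          then show False using 3 by (simp only:) simp
        qed
        moreover have "v \<notin> ext1 V E K" using 3 by (simp add: ext1_def)
        ultimately show ?thesis by simp
      qed
    qed
    finally show "(\<Sum>x\<in>K. of_bool (\<forall>y\<in>K - {x}. E v y)) = of_bool (v \<in> ext1 V E K) + Suc s * of_bool (v \<in> ext V E K)" .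
  qed
  also have "\<dots> = card (ext1 V E K) + Suc s * card (ext V E K)"
  proof -
    have "(\<Sum>v\<in>V. of_bool (v \<in> A)) = card A" if "A \<subseteq> V" for A
      using that finV by (simp add: of_bool_def sum.If_cases Int_absorb1)
    moreover have "ext V E K \<subseteq> V" "ext1 V E K \<subseteq> V" by (auto simp: ext_def ext1_def)
    ultimately show ?thesis by (simp add: sum.distrib flip: sum_distrib_left)
  qed
  finally show ?thesis .
qed

lemma sum_ext_sq:
  "(\<Sum>K\<in>clq V E s. (card (ext V E K))\<^sup>2)
    = (\<Sum>K\<in>clq V E (Suc s). card (ext1 V E K)) + Suc s * (Suc (Suc s) * card (clq V E (Suc (Suc s))))"
proof -
  have "(\<Sum>K\<in>clq V E s. (card (ext V E K))\<^sup>2)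
      = (\<Sum>K\<in>clq V E (Suc s). card (ext1 V E K) + Suc s * card (ext V E K))"
    unfolding sum_card_ext_remove[symmetric]
    by (intro sum.cong refl card_ext_remove) (auto simp: clq_def intro: finite_subset[OF _ finV])
  then show ?thesis
    by (simp add: sum.distrib sum_card_ext flip: sum_distrib_left)
qed

text \<open>Cauchy-Schwarz for the number of common neighbours over all s-cliques. The sum of
  \<open>card (ext1 V E K)\<close> is kept here: bounding it from above gives the Moon-Moser
  inequality, while its being near the maximum yields the partition.\<close>

lemma clq_ext1_lower:
  "(Suc s * card (clq V E (Suc s)))\<^sup>2 \<le> card (clq V E s) *
    ((\<Sum>K\<in>clq V E (Suc s). card (ext1 V E K)) + Suc s * (Suc (Suc s) * card (clq V E (Suc (Suc s)))))"
proof -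
  have "(\<Sum>K\<in>clq V E s. real (card (ext V E K)))\<^sup>2
      \<le> (\<Sum>K\<in>clq V E s. (real (card (ext V E K)))\<^sup>2) * real (card (clq V E s))"
    by (rule sum_squared_le_sum_of_squares)
  then have "real ((\<Sum>K\<in>clq V E s. card (ext V E K))\<^sup>2) \<le> real (card (clq V E s) * (\<Sum>K\<in>clq V E s. (card (ext V E K))\<^sup>2))"
    by (simp add: mult.commute)
  then have "(\<Sum>K\<in>clq V E s. card (ext V E K))\<^sup>2 \<le> card (clq V E s) * (\<Sum>K\<in>clq V E s. (card (ext V E K))\<^sup>2)"
    by (simp only: of_nat_le_iff)
  then show ?thesis unfolding sum_ext_sq sum_card_ext .
qed

lemma card_ext1_le: "card (ext1 V E K) + card (ext V E K) \<le> card V"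
proof -
  have "ext1 V E K \<inter> ext V E K = {}"
    by (auto simp: ext1_def ext_def card_eq_0_iff card_1_singleton_iff)
  then have "card (ext1 V E K) + card (ext V E K) = card (ext1 V E K \<union> ext V E K)"
    by (subst card_Un_disjoint) (auto simp: ext1_def ext_def finV)
  also have "\<dots> \<le> card V" by (rule card_mono[OF finV]) (auto simp: ext1_def ext_def)
  finally show ?thesis .
qed

lemma sum_card_ext1_le:
  "(\<Sum>K\<in>clq V E s. card (ext1 V E K)) + Suc s * card (clq V E (Suc s)) \<le> card V * card (clq V E s)"
proof -
  have "(\<Sum>K\<in>clq V E s. card (ext1 V E K) + card (ext V E K)) \<le> (\<Sum>K\<in>clq V E s. card V)"
    by (intro sum_mono card_ext1_le)
  then show ?thesis by (simp add: sum.distrib sum_card_ext mult.commute)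
qed

text \<open>For a typical \<open>r\<close>-clique \<open>K\<close> almost every vertex misses exactly one vertex of \<open>K\<close>, and the
  missed vertex names the part. An edge inside the part of \<open>x\<close> forms an \<open>(r+1)\<close>-clique with
  \<open>K - {x}\<close>.\<close>

lemma exists_partition_clq:
  assumes "card (clq V E r) > 0" "r > 0"
  shows "\<exists>p. (\<forall>v. p v < r) \<and>
    real (card (inside V E p)) * card (clq V E r)
     \<le> 2 * real (card V) * (real (card V) * card (clq V E r) - (\<Sum>K\<in>clq V E r. card (ext1 V E K)))
       + real (card V) * (r * (Suc r * card (clq V E (Suc r))))"
proof -
  define n where "n = card V"
  define f where "f K = {(y, z). y \<in> ext V E K \<and> z \<in> ext V E K \<and> E y z}" for K
  \<comment> \<open>\<open>w K\<close> bounds the ordered edges inside the parts read off from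
    \<open>K\<close>: pairs with an end outside \<open>ext1 V E K\<close>, and edges within the
    common neighbourhood of some \<open>K - {x}\<close>. Some clique has at most the average
    weight.\<close>
  define w where "w K = 2 * real n * (real n - card (ext1 V E K)) + (\<Sum>x\<in>K. real (card (f (K - {x}))))" for K
  let ?C = "clq V E r"
  obtain s where s: "r = Suc s" using assms(2) gr0_conv_Suc by blast
  have cardf: "card (f K) = (\<Sum>y\<in>ext V E K. card (ext V E (insert y K)))" for K
  proof -
    have "f K = Sigma (ext V E K) (\<lambda>y. ext V E (insert y K))"
      using symE by (auto simp: f_def ext_def)
    then show ?thesis by (simp add: card_SigmaI finite_ext finV)
  qed
  have "(\<Sum>K\<in>?C. \<Sum>x\<in>K. card (f (K - {x}))) = (\<Sum>K\<in>clq V E s. \<Sum>x\<in>ext V E K. card (f K))"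
    unfolding s by (rule sum_clq_Suc)
  also have "\<dots> \<le> (\<Sum>K\<in>clq V E s. n * card (f K))"
    by (intro sum_mono) (auto simp: n_def ext_def intro!: card_mono finV)
  also have "\<dots> = n * (\<Sum>K\<in>clq V E s. \<Sum>y\<in>ext V E K. card (ext V E (insert y K)))"
    by (simp add: cardf sum_distrib_left)
  also have "\<dots> = n * (r * (Suc r * card (clq V E (Suc r))))"
    unfolding s by (subst sum_clq_insert) (simp add: sum_card_ext)
  finally have "(\<Sum>K\<in>?C. \<Sum>x\<in>K. card (f (K - {x}))) \<le> n * (r * (Suc r * card (clq V E (Suc r))))" .
  then have inE: "(\<Sum>K\<in>?C. \<Sum>x\<in>K. real (card (f (K - {x})))) \<le> real n * (r * (Suc r * card (clq V E (Suc r))))"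
    by (simp only: of_nat_sum[symmetric] of_nat_mult[symmetric] of_nat_le_iff)
  define W where "W = 2 * real n * (real n * card ?C - (\<Sum>K\<in>?C. card (ext1 V E K)))
       + real n * (r * (Suc r * card (clq V E (Suc r))))"
  have sw: "(\<Sum>K\<in>?C. w K) \<le> W"
  proof -
    have "(\<Sum>K\<in>?C. w K) = 2 * real n * (\<Sum>K\<in>?C. real n - card (ext1 V E K)) + (\<Sum>K\<in>?C. \<Sum>x\<in>K. real (card (f (K - {x}))))"
      unfolding w_def sum.distrib by (simp only: sum_distrib_left)
    also have "(\<Sum>K\<in>?C. real n - card (ext1 V E K)) = real n * card ?C - (\<Sum>K\<in>?C. card (ext1 V E K))"
      by (simp add: sum_subtractf)
    finally show ?thesis using inE by (simp add: W_def)
  qed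
  have ex: "\<exists>K\<in>?C. w K * card ?C \<le> W"
  proof (rule ccontr)
    assume "\<not> ?thesis"
    then have "\<And>K. K \<in> ?C \<Longrightarrow> w K > W / card ?C"
      using assms(1) by (auto simp: not_le divide_less_eq)
    then have "(\<Sum>K\<in>?C. W / card ?C) < (\<Sum>K\<in>?C. w K)"
      using assms(1) by (intro sum_strict_mono) (auto simp: finite_clq finV card_gt_0_iff)
    then show False using sw assms(1) by simp
  qed
  then obtain K where K: "K \<in> ?C" "w K * card ?C \<le> W" by blast
  have finK: "finite K" by (rule finite_clq_mem[OF finV K(1)])
  have cK: "card K = r" using K(1) by (simp add: clq_def)
  obtain b where b: "bij_betw b K {..<r}"
    using finK cK ex_bij_betw_finite_nat by (metis atLeast0LessThan)
  define nb where "nb v = (THE x. x \<in> K \<and> \<not> E v x)" for v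
  \<comment> \<open>Vertices outside \<open>ext1 V E K\<close> are put into part 0; the edges at
    them are already paid for by the first summand of \<open>w K\<close>.\<close>
  define p where "p v = (if v \<in> ext1 V E K then b (nb v) else 0)" for v
  have nb: "nb v \<in> K" "\<not> E v (nb v)" "v \<in> ext V E (K - {nb v})" if v: "v \<in> ext1 V E K" for v
  proof -
    from v obtain x where x: "{x \<in> K. \<not> E v x} = {x}" by (auto simp: ext1_def card_1_singleton_iff)
    then have "x \<in> K \<and> \<not> E v x" by blast
    moreover have "y = x" if "y \<in> K \<and> \<not> E v y" for y using x that by blast
    ultimately have "nb v = x" unfolding nb_def by (rule the_equality)
    then show "nb v \<in> K" "\<not> E v (nb v)" "v \<in> ext V E (K - {nb v})"
      using x v by (auto simp: ext_def ext1_def)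
  qed
  have "p v < r" for v
    using b nb(1) assms(2) by (auto simp: p_def bij_betw_def)
  moreover have "real (card (inside V E p)) \<le> w K"
  proof -
    let ?R = "V - ext1 V E K"
    have sub: "inside V E p \<subseteq> (?R \<times> V \<union> V \<times> ?R) \<union> (\<Union>x\<in>K. f (K - {x}))"
    proof
      fix q assume q: "q \<in> inside V E p"
      obtain y z where yz: "q = (y, z)" "y \<in> V" "z \<in> V" "E y z" "p y = p z"
        using q by (auto simp: inside_def)
      show "q \<in> (?R \<times> V \<union> V \<times> ?R) \<union> (\<Union>x\<in>K. f (K - {x}))"
      proof (cases "y \<in> ext1 V E K \<and> z \<in> ext1 V E K")
        case True
        then have "b (nb y) = b (nb z)" using yz by (simp add: p_def)
        then have "nb y = nb z" using b nb(1) True by (auto simp: bij_betw_def inj_on_def)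
        then have "q \<in> f (K - {nb y})" using nb(3)[of y] nb(3)[of z] True yz by (simp add: f_def)
        then show ?thesis using nb(1) True by blast
      qed (use yz in auto)
    qed
    have ff: "finite (f K')" for K'
      by (rule finite_subset[of _ "V \<times> V"]) (auto simp: f_def ext_def finV)
    have "card (inside V E p) \<le> card ((?R \<times> V \<union> V \<times> ?R) \<union> (\<Union>x\<in>K. f (K - {x})))"
      by (intro card_mono sub finite_UnI finite_UN_I finite_cartesian_product finite_Diff finV finK ff)
    also have "\<dots> \<le> card (?R \<times> V \<union> V \<times> ?R) + card (\<Union>x\<in>K. f (K - {x}))" by (rule card_Un_le)
    also have "\<dots> \<le> (card (?R \<times> V) + card (V \<times> ?R)) + (\<Sum>x\<in>K. card (f (K - {x})))"
      by (intro add_mono card_Un_le card_UN_le finK)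
    also have "\<dots> = 2 * n * card ?R + (\<Sum>x\<in>K. card (f (K - {x})))"
      by (simp add: card_cartesian_product n_def)
    also have "card ?R = n - card (ext1 V E K)"
      by (subst card_Diff_subset) (auto simp: ext1_def n_def finV)
    finally have "real (card (inside V E p)) \<le> real (2 * n * (n - card (ext1 V E K)) + (\<Sum>x\<in>K. card (f (K - {x}))))"
      by (simp only: of_nat_le_iff)
    moreover have "card (ext1 V E K) \<le> n" unfolding n_def by (rule card_mono[OF finV]) (auto simp: ext1_def)
    ultimately show ?thesis by (simp add: w_def of_nat_diff)
  qed
  then have "real (card (inside V E p)) * card ?C \<le> W"
    using K(2) by (meson mult_right_mono of_nat_0_le_iff order_trans)
  ultimately show ?thesis unfolding W_def n_def by (intro exI[of _ p] conjI allI)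
qed

end

section \<open>Blow-ups of cliques\<close>

text \<open>Erdos's theorem on complete s-partite s-uniform subhypergraphs, stated for ordered
  tuples. By induction: a positive proportion of the tails \<open>xs\<close> extend by many first
  entries and so by many m-sets of first entries; averaging over the m-sets gives one set
  \<open>Y\<close> that serves a positive proportion of the tails, to which the induction hypothesis
  applies.\<close>

lemma erdos_lists:
  fixes \<zeta> :: real
  assumes "\<zeta> > 0"
  shows "\<exists>n0. \<forall>(V :: 'a set) R. finite V \<and> card V \<ge> n0 \<and> (\<forall>xs\<in>R. set xs \<subseteq> V \<and> length xs = s)
      \<and> real (card R) \<ge> \<zeta> * real (card V) ^ s \<longrightarrow>
    (\<exists>X. (\<forall>i<s. X i \<subseteq> V \<and> card (X i) = m) \<and>
      (\<forall>xs. length xs = s \<and> (\<forall>i<s. xs ! i \<in> X i) \<longrightarrow> xs \<in> R))"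
  using assms
proof (induction s arbitrary: \<zeta>)
  case 0
  show ?case
  proof (intro exI[of _ 0] allI impI)
    fix V :: "'a set" and R :: "'a list set"
    assume R: "finite V \<and> 0 \<le> card V \<and> (\<forall>xs\<in>R. set xs \<subseteq> V \<and> length xs = 0) \<and>
      \<zeta> * real (card V) ^ 0 \<le> real (card R)"
    then have "card R > 0" using 0 by (cases "card R = 0") auto
    then obtain xs where "xs \<in> R" by (metis card.empty ex_in_conv less_irrefl)
    then have "[] \<in> R" using R by auto
    then show "\<exists>X. (\<forall>i<0. X i \<subseteq> V \<and> card (X i) = m) \<and>
      (\<forall>xs. length xs = 0 \<and> (\<forall>i<0. xs ! i \<in> X i) \<longrightarrow> xs \<in> R)" by auto
  qed
next
  case (Suc s)
  \<comment> \<open>The factor \<zeta>/2 is the proportion of tails with at least \<zeta>n/2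
    extensions. Each of these has at least (\<zeta>n/(2m))^m extending m-sets, out of at most n^m in
    all.\<close>
  define \<zeta>' where "\<zeta>' = \<zeta> / 2 * (\<zeta> / (2 * real m)) ^ m"
  have pos: "\<zeta>' > 0" using Suc.prems by (cases "m = 0") (auto simp: \<zeta>'_def)
  obtain n0 where n0: "\<And>(V :: 'a set) R. finite V \<and> card V \<ge> n0 \<and> (\<forall>xs\<in>R. set xs \<subseteq> V \<and> length xs = s)
      \<and> real (card R) \<ge> \<zeta>' * real (card V) ^ s \<Longrightarrow>
    (\<exists>X. (\<forall>i<s. X i \<subseteq> V \<and> card (X i) = m) \<and>
      (\<forall>xs. length xs = s \<and> (\<forall>i<s. xs ! i \<in> X i) \<longrightarrow> xs \<in> R))"
    using Suc.IH[OF pos] by blast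
  show ?case
  proof (intro exI[of _ "max 1 (max n0 (nat \<lceil>2 * real m / \<zeta>\<rceil>))"] allI impI, elim conjE)
    fix V :: "'a set" and R :: "'a list set"
    assume fin: "finite V" and n: "max 1 (max n0 (nat \<lceil>2 * real m / \<zeta>\<rceil>)) \<le> card V"
      and R: "\<forall>xs\<in>R. set xs \<subseteq> V \<and> length xs = Suc s"
      and cR: "\<zeta> * real (card V) ^ Suc s \<le> real (card R)"
    define n where "n = card V"
    have npos: "n > 0" and nn0: "n \<ge> n0" using n by (auto simp: n_def)
    \<comment> \<open>This makes \<zeta>n/2 at least \<open>m\<close>, as the lower bound (a/m)^m
      for the binomial coefficient requires.\<close>
    have nm: "real m \<le> \<zeta> * n / 2"
    proof -
      have "2 * real m / \<zeta> \<le> n" using n by (simp add: n_def)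
      then show ?thesis using Suc.prems by (simp add: field_simps)
    qed
    define L where "L = {xs. set xs \<subseteq> V \<and> length xs = s}"
    define N where "N xs = {y \<in> V. y # xs \<in> R}" for xs
    have finL: "finite L" unfolding L_def by (rule finite_lists_length_eq[OF fin])
    have cL: "card L = n ^ s" unfolding L_def n_def by (rule card_lists_length_eq[OF fin])
    have finN: "finite (N xs)" for xs using fin by (simp add: N_def)
    have Nle: "card (N xs) \<le> n" for xs unfolding n_def by (rule card_mono[OF fin]) (auto simp: N_def)
    have "R = (\<lambda>(xs, y). y # xs) ` Sigma L N"
    proof
      show "R \<subseteq> (\<lambda>(xs, y). y # xs) ` Sigma L N"
      proof
        fix zs assume zs: "zs \<in> R"
        have zV: "set zs \<subseteq> V" "length zs = Suc s" using R zs by auto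
        then obtain y xs where "zs = y # xs" by (metis length_Suc_conv)
        then show "zs \<in> (\<lambda>(xs, y). y # xs) ` Sigma L N"
          using zs zV by (intro image_eqI[of _ _ "(xs, y)"]) (auto simp: L_def N_def)
      qed
    qed (auto simp: N_def)
    moreover have "inj_on (\<lambda>(xs, y). y # xs) (Sigma L N)" by (auto simp: inj_on_def)
    ultimately have "card R = (\<Sum>xs\<in>L. card (N xs))"
      using finL finN by (simp add: card_image card_SigmaI)
    then have cR': "real (card R) = (\<Sum>xs\<in>L. real (card (N xs)))" by simp
    define Big where "Big = {xs \<in> L. real (card (N xs)) \<ge> \<zeta> * n / 2}"
    have BigL: "Big \<subseteq> L" by (auto simp: Big_def)
    have "(\<Sum>xs\<in>L. real (card (N xs))) = (\<Sum>xs\<in>Big. real (card (N xs))) + (\<Sum>xs\<in>L - Big. real (card (N xs)))"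
      using sum.subset_diff[OF BigL finL, of "\<lambda>xs. real (card (N xs))"] by simp
    also have "\<dots> \<le> (\<Sum>xs\<in>Big. real n) + (\<Sum>xs\<in>L - Big. \<zeta> * n / 2)"
      by (intro add_mono sum_mono) (auto simp: Big_def Nle)
    also have "\<dots> \<le> real (card Big) * n + real (card L) * (\<zeta> * n / 2)"
      using card_mono[OF finL, of "L - Big"] Suc.prems by (auto intro!: mult_right_mono)
    finally have "\<zeta> * real n ^ Suc s \<le> real (card Big) * n + real n ^ s * (\<zeta> * n / 2)"
      using cR cR' cL by (simp add: n_def)
    then have "real n * (\<zeta> / 2 * real n ^ s) \<le> real n * card Big"
      by (simp add: algebra_simps)
    then have cBig: "\<zeta> / 2 * real n ^ s \<le> card Big" using npos by simp
    define P where "P = {Y. Y \<subseteq> V \<and> card Y = m}"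
    have finP: "finite P" using fin by (simp add: P_def)
    have cP: "real (card P) \<le> real n ^ m"
    proof -
      have "card P = n choose m" unfolding P_def n_def by (rule n_subsets[OF fin])
      also have "\<dots> \<le> n ^ m"
        by (cases "m \<le> n") (auto simp: binomial_le_pow binomial_eq_0)
      finally show ?thesis by (metis of_nat_le_iff of_nat_power)
    qed
    define Rs where "Rs Y = {xs \<in> L. Y \<subseteq> N xs}" for Y
    have "(\<Sum>Y\<in>P. card (Rs Y)) = (\<Sum>Y\<in>P. \<Sum>xs\<in>L. of_bool (Y \<subseteq> N xs))"
      using finL by (intro sum.cong refl) (simp add: Rs_def of_bool_def sum.If_cases Int_def)
    also have "\<dots> = (\<Sum>xs\<in>L. \<Sum>Y\<in>P. of_bool (Y \<subseteq> N xs))" by (rule sum.swap)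
    also have "\<dots> = (\<Sum>xs\<in>L. card (N xs) choose m)"
    proof (intro sum.cong refl)
      fix xs
      have "{Y \<in> P. Y \<subseteq> N xs} = {Y. Y \<subseteq> N xs \<and> card Y = m}" by (auto simp: P_def N_def)
      then show "(\<Sum>Y\<in>P. of_bool (Y \<subseteq> N xs)) = card (N xs) choose m"
        using finP n_subsets[OF finN, of xs m] by (simp add: of_bool_def sum.If_cases Int_def)
    qed
    finally have eqs: "(\<Sum>Y\<in>P. card (Rs Y)) = (\<Sum>xs\<in>L. card (N xs) choose m)" .
    have big: "(\<zeta> * n / (2 * real m)) ^ m \<le> real (card (N xs) choose m)" if "xs \<in> Big" for xs
    proof -
      have ge: "\<zeta> * n / 2 \<le> card (N xs)" using that by (simp add: Big_def)
      then have "m \<le> card (N xs)" using nm by linarith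
      then have "(real (card (N xs)) / real m) ^ m \<le> real (card (N xs) choose m)"
        by (rule binomial_ge_n_over_k_pow_k)
      moreover have "(\<zeta> * n / (2 * real m)) ^ m \<le> (real (card (N xs)) / real m) ^ m"
      proof (rule power_mono)
        have "\<zeta> * n / (2 * real m) = (\<zeta> * n / 2) / real m" by simp
        also have "\<dots> \<le> real (card (N xs)) / real m" by (rule divide_right_mono[OF ge]) simp
        finally show "\<zeta> * n / (2 * real m) \<le> real (card (N xs)) / real m" .
      qed (use Suc.prems in auto)
      ultimately show ?thesis by linarith
    qed
    have "\<zeta>' * real n ^ s * real n ^ m = \<zeta> / 2 * real n ^ s * (\<zeta> * n / (2 * real m)) ^ m"
      by (simp add: \<zeta>'_def power_mult_distrib power_divide)
    also have "\<dots> \<le> card Big * (\<zeta> * n / (2 * real m)) ^ m"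
      using Suc.prems by (intro mult_right_mono cBig) simp
    also have "\<dots> = (\<Sum>xs\<in>Big. (\<zeta> * n / (2 * real m)) ^ m)" by simp
    also have "\<dots> \<le> (\<Sum>xs\<in>Big. real (card (N xs) choose m))" by (intro sum_mono big)
    also have "\<dots> \<le> (\<Sum>xs\<in>L. real (card (N xs) choose m))" by (rule sum_mono2[OF finL BigL]) simp
    also have "\<dots> = (\<Sum>Y\<in>P. real (card (Rs Y)))"
      by (simp only: of_nat_sum[symmetric] eqs)
    finally have lower: "\<zeta>' * real n ^ s * real n ^ m \<le> (\<Sum>Y\<in>P. real (card (Rs Y)))" .
    have "\<exists>Y\<in>P. \<zeta>' * real n ^ s \<le> card (Rs Y)"
    proof (rule ccontr)
      assume "\<not> ?thesis"
      then have less: "\<And>Y. Y \<in> P \<Longrightarrow> card (Rs Y) < \<zeta>' * real n ^ s" by (auto simp: not_le)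
      have "0 < \<zeta>' * real n ^ s * real n ^ m" using pos npos by simp
      then have "P \<noteq> {}" using lower by auto
      then have "(\<Sum>Y\<in>P. real (card (Rs Y))) < (\<Sum>Y\<in>P. \<zeta>' * real n ^ s)"
        using less finP by (intro sum_strict_mono) auto
      also have "\<dots> = real (card P) * (\<zeta>' * real n ^ s)" by simp
      also have "\<dots> \<le> real n ^ m * (\<zeta>' * real n ^ s)"
        using pos by (intro mult_right_mono cP) simp
      finally show False using lower by (simp add: mult_ac)
    qed
    then obtain Y where Y: "Y \<in> P" "\<zeta>' * real n ^ s \<le> card (Rs Y)" by blast
    have "\<exists>X. (\<forall>i<s. X i \<subseteq> V \<and> card (X i) = m) \<and>
      (\<forall>xs. length xs = s \<and> (\<forall>i<s. xs ! i \<in> X i) \<longrightarrow> xs \<in> Rs Y)"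
      by (rule n0) (use fin nn0 Y in \<open>auto simp: n_def Rs_def L_def\<close>)
    then obtain X where X: "\<forall>i<s. X i \<subseteq> V \<and> card (X i) = m"
      "\<And>xs. length xs = s \<Longrightarrow> (\<forall>i<s. xs ! i \<in> X i) \<Longrightarrow> xs \<in> Rs Y" by blast
    show "\<exists>X. (\<forall>i<Suc s. X i \<subseteq> V \<and> card (X i) = m) \<and>
      (\<forall>xs. length xs = Suc s \<and> (\<forall>i<Suc s. xs ! i \<in> X i) \<longrightarrow> xs \<in> R)"
    proof (intro exI[of _ "case_nat Y X"] conjI allI impI)
      fix i assume "i < Suc s"
      then show "case_nat Y X i \<subseteq> V" "card (case_nat Y X i) = m"
        using X(1) Y(1) by (auto simp: P_def split: nat.split)
    next
      fix xs assume xs: "length xs = Suc s \<and> (\<forall>i<Suc s. xs ! i \<in> case_nat Y X i)"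
      then obtain y ys where ys: "xs = y # ys" "length ys = s" by (auto simp: length_Suc_conv)
      have "y \<in> Y" using xs ys by (metis nat.case(1) nth_Cons_0 zero_less_Suc)
      moreover have "ys \<in> Rs Y"
        using xs ys by (intro X(2)) auto
      ultimately show "xs \<in> R" using ys by (auto simp: Rs_def N_def)
    qed
  qed
qed

text \<open>Cliques are listed in all orders and treated as tuples. As \<open>m > 0\<close>, every
  class has a representative, so two elements of different classes extend to a full tuple, which
  lists a clique without repetition; they are therefore distinct and adjacent. The cliques lie in
  \<open>Z\<close> but are measured against \<open>V\<close> because \<open>Z\<close> will be a
  common neighbourhood.\<close>

lemma erdos_clq:
  fixes \<zeta> :: real
  assumes "\<zeta> > 0" "m > 0"
  shows "\<exists>n0. \<forall>(V :: 'a set) Z E. finite V \<and> card V \<ge> n0 \<and> Z \<subseteq> V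
      \<and> real (card (clq Z E s)) \<ge> \<zeta> * real (card V) ^ s \<longrightarrow>
    (\<exists>X. (\<forall>i<s. X i \<subseteq> Z \<and> card (X i) = m) \<and>
      (\<forall>i<s. \<forall>j<s. i \<noteq> j \<longrightarrow> (\<forall>x\<in>X i. \<forall>y\<in>X j. E x y)))"
proof -
  obtain n0 where n0: "\<And>(V :: 'a set) R. finite V \<and> card V \<ge> n0 \<and> (\<forall>xs\<in>R. set xs \<subseteq> V \<and> length xs = s)
      \<and> real (card R) \<ge> \<zeta> * real (card V) ^ s \<Longrightarrow>
    (\<exists>X. (\<forall>i<s. X i \<subseteq> V \<and> card (X i) = m) \<and>
      (\<forall>xs. length xs = s \<and> (\<forall>i<s. xs ! i \<in> X i) \<longrightarrow> xs \<in> R))"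
    using erdos_lists[OF assms(1), of s m] by blast
  show ?thesis
  proof (intro exI[of _ n0] allI impI, elim conjE)
    fix V Z :: "'a set" and E
    assume fin: "finite V" and n: "n0 \<le> card V" and Z: "Z \<subseteq> V"
      and c: "\<zeta> * real (card V) ^ s \<le> real (card (clq Z E s))"
    define R where "R = {xs. set xs \<in> clq Z E s \<and> length xs = s}"
    have finZ: "finite Z" using finite_subset[OF Z fin] .
    have "R \<subseteq> {xs. set xs \<subseteq> V \<and> length xs = s}" using Z by (auto simp: R_def clq_def)
    then have finR: "finite R" using finite_lists_length_eq[OF fin] finite_subset by blast
    have "clq Z E s \<subseteq> set ` R"
    proof
      fix K assume K: "K \<in> clq Z E s"
      then obtain xs where "set xs = K" "distinct xs"
        using finite_distinct_list[OF finite_clq_mem[OF finZ K]] by blast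
      then show "K \<in> set ` R" using K distinct_card[of xs] by (auto simp: R_def clq_def)
    qed
    then have "card (clq Z E s) \<le> card R" using finR by (meson surj_card_le)
    then have "\<zeta> * real (card V) ^ s \<le> real (card R)" using c by linarith
    moreover have "\<forall>xs\<in>R. set xs \<subseteq> V \<and> length xs = s" using Z by (auto simp: R_def clq_def)
    ultimately obtain X where X: "\<And>i. i < s \<Longrightarrow> X i \<subseteq> V \<and> card (X i) = m"
      "\<And>xs. length xs = s \<Longrightarrow> (\<forall>i<s. xs ! i \<in> X i) \<Longrightarrow> xs \<in> R"
      using n0[of V R] fin n by blast
    have "\<exists>x. x \<in> X i" if "i < s" for i using X(1)[OF that] assms(2) by (metis card.empty ex_in_conv less_irrefl)
    then obtain a where a: "\<And>i. i < s \<Longrightarrow> a i \<in> X i" by metis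
    have upd: "map (a(i := x, j := y)) [0..<s] \<in> R" if "i < s" "j < s" "i \<noteq> j" "x \<in> X i" "y \<in> X j" for i j x y
      by (rule X(2)) (use that a in auto)
    have R1: "xs ! i \<in> Z" if "xs \<in> R" "i < s" for xs i
      using that by (auto simp: R_def clq_def intro: nth_mem)
    show "\<exists>X. (\<forall>i<s. X i \<subseteq> Z \<and> card (X i) = m) \<and>
      (\<forall>i<s. \<forall>j<s. i \<noteq> j \<longrightarrow> (\<forall>x\<in>X i. \<forall>y\<in>X j. E x y))"
    proof (intro exI[of _ X] conjI allI impI ballI)
      fix i assume i: "i < s"
      show "card (X i) = m" using X(1)[OF i] by simp
      show "X i \<subseteq> Z"
      proof
        fix x assume x: "x \<in> X i"
        have "map (a(i := x)) [0..<s] \<in> R" by (rule X(2)) (use x a in auto)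
        from R1[OF this i] i show "x \<in> Z" by simp
      qed
    next
      fix i j x y assume ij: "i < s" "j < s" "i \<noteq> j" and xy: "x \<in> X i" "y \<in> X j"
      let ?xs = "map (a(i := x, j := y)) [0..<s]"
      have xs: "?xs \<in> R" using upd[OF ij xy] .
      have cs: "card (set ?xs) = length ?xs" using xs unfolding R_def clq_def by simp
      have pw: "pairwise E (set ?xs)" using xs unfolding R_def clq_def by blast
      have d: "distinct ?xs" using cs by (rule card_distinct)
      have nth: "?xs ! i = x" "?xs ! j = y" using ij by auto
      then have ne: "x \<noteq> y" using nth_eq_iff_index_eq[OF d, of i j] ij by simp
      have "x \<in> set ?xs" "y \<in> set ?xs" using nth_mem[of i ?xs] nth_mem[of j ?xs] nth ij by auto
      then show "E x y" using pw ne by (auto dest: pairwiseD)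
    qed
  qed
qed

definition emb :: "'f hypergraph \<Rightarrow> 'a set \<Rightarrow> ('a \<Rightarrow> 'a \<Rightarrow> bool) \<Rightarrow> bool" where
  "emb F V E \<longleftrightarrow> (\<exists>f. inj_on f (verts F) \<and> f ` verts F \<subseteq> V \<and> (\<forall>a b. {a, b} \<in> edges F \<longrightarrow> E (f a) (f b)))"

text \<open>Each colour class of \<open>F\<close> is injected into its own set \<open>X i\<close>.
  Irreflexivity of \<open>E\<close> makes the images of different classes disjoint.\<close>

lemma emb_blowup:
  assumes "is_hypergraph F" "proper_coloring F s c"
    and X: "\<And>i. i < s \<Longrightarrow> X i \<subseteq> V \<and> finite (X i) \<and> card {v \<in> verts F. c v = i} \<le> card (X i)"
    and E: "\<And>i j x y. i < s \<Longrightarrow> j < s \<Longrightarrow> i \<noteq> j \<Longrightarrow> x \<in> X i \<Longrightarrow> y \<in> X j \<Longrightarrow> E x y"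
    and irr: "\<And>x. \<not> E x x"
  shows "emb F V E"
proof -
  have fin: "finite (verts F)" using assms(1) by (simp add: is_hypergraph_def)
  have cs: "c v < s" if "v \<in> verts F" for v using assms(2) that by (auto simp: proper_coloring_def)
  have "\<exists>h. h ` {v \<in> verts F. c v = i} \<subseteq> X i \<and> inj_on h {v \<in> verts F. c v = i}" if "i < s" for i
    using X[OF that] fin card_le_inj[of "{v \<in> verts F. c v = i}" "X i"] by auto
  then have "\<forall>i. \<exists>h. i < s \<longrightarrow> h ` {v \<in> verts F. c v = i} \<subseteq> X i \<and> inj_on h {v \<in> verts F. c v = i}"
    by blast
  from choice[OF this] obtain h where h: "\<And>i. i < s \<Longrightarrow> h i ` {v \<in> verts F. c v = i} \<subseteq> X i \<and> inj_on (h i) {v \<in> verts F. c v = i}"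
    by blast
  define f where "f v = h (c v) v" for v
  have fX: "f v \<in> X (c v)" if "v \<in> verts F" for v using h[OF cs[OF that]] that by (auto simp: f_def)
  have "inj_on f (verts F)"
  proof (rule inj_onI)
    fix a b assume ab: "a \<in> verts F" "b \<in> verts F" "f a = f b"
    have "c a = c b"
    proof (rule ccontr)
      assume "c a \<noteq> c b"
      then have "E (f a) (f b)" by (intro E[OF cs cs _ fX fX]) (use ab in auto)
      then show False using ab irr by simp
    qed
    then show "a = b" using h[OF cs[OF ab(1)]] ab by (auto simp: f_def inj_on_def)
  qed
  moreover have "f ` verts F \<subseteq> V" using fX X cs by blast
  moreover have "E (f a) (f b)" if "{a, b} \<in> edges F" for a b
  proof -
    have ab: "a \<in> verts F" "b \<in> verts F" using assms(1) that by (auto simp: is_hypergraph_def)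
    have "c a \<noteq> c b" using assms(2) that by (auto simp: proper_coloring_def)
    then show ?thesis by (intro E[OF cs cs _ fX fX]) (use ab in auto)
  qed
  ultimately show ?thesis unfolding emb_def by blast
qed

section \<open>Clique densities\<close>

text \<open>The probability that \<open>s\<close> independent uniform vertices form a clique, with
  \<open>fact s\<close> counting the orders. For the balanced complete r-partite graph it is the
  product of 1 - i/r over i < s.\<close>

definition dens :: "'a set \<Rightarrow> ('a \<Rightarrow> 'a \<Rightarrow> bool) \<Rightarrow> nat \<Rightarrow> real" where
  "dens V E s = fact s * real (card (clq V E s)) / real (card V) ^ s"

context fgraph
begin

text \<open>This is \<open>clq_ext1_lower\<close> combined with the fact that \<open>ext1\<close>
  and \<open>ext\<close> are disjoint subsets of \<open>V\<close>. The form without division remains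
  valid when densities vanish.\<close>

lemma moon_moser:
  assumes "card V > 0"
  shows "real (Suc s) * (dens V E (Suc s))\<^sup>2 \<le> dens V E s * (dens V E (Suc s) + real s * dens V E (Suc (Suc s)))"
proof -
  define n where "n = real (card V)"
  define N where "N i = real (card (clq V E i))" for i
  define X where "X = real (\<Sum>K\<in>clq V E (Suc s). card (ext1 V E K))"
  have n: "n > 0" using assms by (simp add: n_def)
  have "real ((Suc s * card (clq V E (Suc s)))\<^sup>2) \<le> real (card (clq V E s) *
    ((\<Sum>K\<in>clq V E (Suc s). card (ext1 V E K)) + Suc s * (Suc (Suc s) * card (clq V E (Suc (Suc s))))))"
    by (simp only: of_nat_le_iff clq_ext1_lower)
  then have 1: "(real (Suc s) * N (Suc s))\<^sup>2 \<le> N s * (X + real (Suc s) * (real (Suc (Suc s)) * N (Suc (Suc s))))"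
    by (simp only: N_def X_def of_nat_power of_nat_mult of_nat_add)
  have "real ((\<Sum>K\<in>clq V E (Suc s). card (ext1 V E K)) + Suc (Suc s) * card (clq V E (Suc (Suc s))))
      \<le> real (card V * card (clq V E (Suc s)))"
    by (simp only: of_nat_le_iff sum_card_ext1_le)
  then have "X \<le> n * N (Suc s) - real (Suc (Suc s)) * N (Suc (Suc s))"
    by (simp only: N_def X_def of_nat_mult of_nat_add n_def)
  then have "N s * (X + real (Suc s) * (real (Suc (Suc s)) * N (Suc (Suc s))))
      \<le> N s * (n * N (Suc s) + real s * (real (Suc (Suc s)) * N (Suc (Suc s))))"
    by (intro mult_left_mono) (auto simp: N_def algebra_simps)
  with 1 have 2: "(real (Suc s) * N (Suc s))\<^sup>2 \<le> N s * (n * N (Suc s) + real s * (real (Suc (Suc s)) * N (Suc (Suc s))))"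
    by linarith
  have n2: "n ^ (2 * s + 2) = n ^ s * n ^ s * n * n"
  proof -
    have "2 * s + 2 = s + s + 1 + 1" by simp
    then show ?thesis by (simp only: power_add power_one_right)
  qed
  \<comment> \<open>The factor that turns clique counts into densities on both sides.\<close>
  define c where "c = real (Suc s) * (fact s)\<^sup>2 / n ^ (2 * s + 2)"
  have "c \<ge> 0" using n by (simp add: c_def)
  then have "c * (real (Suc s) * N (Suc s))\<^sup>2 \<le> c * (N s * (n * N (Suc s) + real s * (real (Suc (Suc s)) * N (Suc (Suc s)))))"
    using 2 by (intro mult_left_mono)
  moreover have "c * (real (Suc s) * N (Suc s))\<^sup>2 = real (Suc s) * (dens V E (Suc s))\<^sup>2"
    using n unfolding c_def n2 by (simp add: dens_def N_def flip: n_def) (simp add: field_simps power2_eq_square del: of_nat_Suc)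
  moreover have "c * (N s * (n * N (Suc s) + real s * (real (Suc (Suc s)) * N (Suc (Suc s)))))
      = dens V E s * (dens V E (Suc s) + real s * dens V E (Suc (Suc s)))"
  proof -
    have d: "dens V E i = fact i * N i / n ^ i" for i by (simp add: dens_def N_def n_def)
    from n2 show ?thesis
      unfolding d c_def fact_Suc power_Suc using n
      by (simp add: field_simps power2_eq_square del: of_nat_Suc)
  qed
  ultimately show ?thesis by simp
qed

lemma dens_0: "dens V E 0 = 1"
  by (simp add: dens_def clq_0 finV)

lemma ext_empty: "ext V E {} = V" by (simp add: ext_def)

lemma dens_1:
  assumes "card V > 0" shows "dens V E 1 = 1"
proof -
  have "Suc 0 * card (clq V E (Suc 0)) = card V"
    by (subst sum_card_ext[symmetric]) (simp add: clq_0 finV ext_empty)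
  then show ?thesis using assms by (simp add: dens_def)
qed

lemma dens_Suc_le:
  assumes "card V > 0" shows "dens V E (Suc s) \<le> dens V E s"
proof -
  have "Suc s * card (clq V E (Suc s)) \<le> (\<Sum>K\<in>clq V E s. card V)"
    unfolding sum_card_ext[symmetric] by (intro sum_mono card_mono finV) (auto simp: ext_def)
  then have "Suc s * card (clq V E (Suc s)) \<le> card V * card (clq V E s)" by (simp add: mult.commute)
  then have "real (Suc s) * real (card (clq V E (Suc s))) \<le> real (card V) * real (card (clq V E s))"
    by (metis of_nat_le_iff of_nat_mult)
  then have "fact s * (real (Suc s) * real (card (clq V E (Suc s)))) \<le> fact s * (real (card V) * real (card (clq V E s)))"
    by (intro mult_left_mono) auto
  then have "fact s * (real (Suc s) * real (card (clq V E (Suc s)))) / (real (card V) ^ s * real (card V))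
      \<le> fact s * (real (card V) * real (card (clq V E s))) / (real (card V) ^ s * real (card V))"
    by (rule divide_right_mono) simp
  moreover have "dens V E (Suc s) = fact s * (real (Suc s) * real (card (clq V E (Suc s)))) / (real (card V) ^ s * real (card V))"
    by (simp add: dens_def mult_ac)
  moreover have "dens V E s = fact s * (real (card V) * real (card (clq V E s))) / (real (card V) ^ s * real (card V))"
    using assms by (simp add: dens_def field_simps)
  ultimately show ?thesis by simp
qed

end

lemma dens_nonneg: "dens V E s \<ge> 0" by (simp add: dens_def)

text \<open>The sequence of clique densities, abstractly: with \<open>q s = T (s+1) / T s\<close>, the
  Moon--Moser inequality says that \<open>(1 - q s) / s\<close> is decreasing in \<open>s\<close>.\<close>

definition moon_moser_seq :: "(nat \<Rightarrow> real) \<Rightarrow> bool" where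
  "moon_moser_seq T \<longleftrightarrow> T 0 = 1 \<and> T 1 = 1 \<and> (\<forall>s. 0 \<le> T s \<and> T (Suc s) \<le> T s) \<and>
     (\<forall>s. real (Suc s) * (T (Suc s))\<^sup>2 \<le> T s * (T (Suc s) + real s * T (Suc (Suc s))))"

lemma (in fgraph) moon_moser_seq_dens: "card V > 0 \<Longrightarrow> moon_moser_seq (dens V E)"
  unfolding moon_moser_seq_def using dens_0 dens_1 dens_nonneg dens_Suc_le moon_moser by blast

text \<open>For the densities of the balanced complete r-partite graph the slope is 1/r at every
  \<open>s\<close> with 0 < s \<le> r.\<close>

definition slope :: "(nat \<Rightarrow> real) \<Rightarrow> nat \<Rightarrow> real" where
  "slope T s = (1 - T (Suc s) / T s) / real s"

lemma ratio_slope: "s > 0 \<Longrightarrow> T (Suc s) / T s = 1 - real s * slope T s"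
  by (simp add: slope_def)

lemma slope_Suc:
  assumes "moon_moser_seq T" "T (Suc s) > 0" "s > 0"
  shows "slope T (Suc s) \<le> slope T s"
proof -
  have "T (Suc s) \<le> T s" using assms(1) unfolding moon_moser_seq_def by blast
  then have Ts: "T s > 0" using assms(2) by linarith
  have "real (Suc s) * (T (Suc s))\<^sup>2 \<le> T s * (T (Suc s) + real s * T (Suc (Suc s)))"
    using assms by (simp add: moon_moser_seq_def)
  then have "real (Suc s) * (T (Suc s) / T s) \<le> 1 + real s * (T (Suc (Suc s)) / T (Suc s))"
    using Ts assms(2) by (simp add: field_simps power2_eq_square)
  then have "real s * (1 - T (Suc (Suc s)) / T (Suc s)) \<le> real (Suc s) * (1 - T (Suc s) / T s)"
    by (simp add: algebra_simps)
  then show ?thesis using assms(3) by (simp add: slope_def field_simps)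
qed

lemma moon_moser_seq_antimono:
  assumes "moon_moser_seq T" "i \<le> j" shows "T j \<le> T i"
  by (rule lift_Suc_antimono_le[of T, OF _ assms(2)]) (use assms(1) in \<open>simp add: moon_moser_seq_def\<close>)

lemma slope_antimono:
  assumes "moon_moser_seq T" "T j > 0" "i > 0" "i \<le> j"
  shows "slope T j \<le> slope T i"
  using assms(4,2)
proof (induction j rule: dec_induct)
  case (step m)
  have "T m > 0" using step.prems moon_moser_seq_antimono[OF assms(1), of m "Suc m"] by simp
  then show ?case using step slope_Suc[OF assms(1) step.prems] assms(3) by fastforce
qed simp

text \<open>The product starts at 2 because the factor \<open>T 2\<close>, the edge density, is
  estimated separately from the later ratios.\<close>

lemma prod_ratio:
  fixes T :: "nat \<Rightarrow> real"
  assumes "\<And>s. s < k \<Longrightarrow> T s > 0" "2 \<le> k"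
  shows "T k = T 2 * (\<Prod>s=2..<k. T (Suc s) / T s)"
  using assms(2,1)
proof (induction k rule: dec_induct)
  case (step m)
  have "T m > 0" using step.prems by simp
  have "T 2 * (\<Prod>s=2..<Suc m. T (Suc s) / T s) = T 2 * (\<Prod>s=2..<m. T (Suc s) / T s) * (T (Suc m) / T m)"
    using step by (simp add: prod.atLeastLessThan_Suc mult.assoc)
  also have "T 2 * (\<Prod>s=2..<m. T (Suc s) / T s) = T m" using step by simp
  also have "T m * (T (Suc m) / T m) = T (Suc m)" using \<open>T m > 0\<close> by simp
  finally show ?case ..
qed simp

text \<open>If the slope y at k - 1 is at least 1/r, then so are all earlier slopes. The ratios from
  s = 2 on are bounded by their Turan values, and the excess of y is used only in \<open>T 2\<close>
  \<le> 1 - y, which keeps the resulting bound on y linear.\<close>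

lemma slope_upper:
  assumes T: "moon_moser_seq T" and pos: "T k > 0" and k: "2 \<le> k" "k \<le> r"
    and C: "C = (\<Prod>s=2..<k. 1 - real s / real r)"
  shows "slope T (k - 1) \<le> max (1 / real r) (1 - T k / C)"
proof (cases "slope T (k - 1) \<ge> 1 / real r")
  case True
  let ?y = "slope T (k - 1)"
  have Tpos: "T s > 0" if "s \<le> k" for s
    using pos moon_moser_seq_antimono[OF T that] by linarith
  have sl: "?y \<le> slope T s" if "s > 0" "s < k" for s
    by (rule slope_antimono[OF T Tpos]) (use that in auto)
  have Cpos: "C > 0" unfolding C using k by (intro prod_pos) auto
  have T2: "T 2 = 1 - slope T 1"
    using T by (simp add: slope_def moon_moser_seq_def numeral_2_eq_2)
  have "T k = T 2 * (\<Prod>s=2..<k. T (Suc s) / T s)"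
    by (rule prod_ratio) (use Tpos k in auto)
  also have "\<dots> \<le> (1 - ?y) * C"
  proof (rule mult_mono)
    show "T 2 \<le> 1 - ?y" using T2 sl[of 1] k by simp
    show "(\<Prod>s=2..<k. T (Suc s) / T s) \<le> C"
      unfolding C
    proof (rule prod_mono, intro conjI)
      fix s assume s: "s \<in> {2..<k}"
      show "0 \<le> T (Suc s) / T s" using Tpos[of s] Tpos[of "Suc s"] s by simp
      have "T (Suc s) / T s = 1 - real s * slope T s" using s by (simp add: ratio_slope)
      also have "\<dots> \<le> 1 - real s * (1 / real r)"
        using sl[of s] s True by (intro diff_left_mono mult_left_mono) auto
      finally show "T (Suc s) / T s \<le> 1 - real s / real r" by simp
    qed
    show "0 \<le> 1 - ?y" using T2 sl[of 1] k Tpos[of 2] moon_moser_seq_antimono[OF T, of 2] by linarith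
    show "0 \<le> (\<Prod>s=2..<k. T (Suc s) / T s)"
      by (intro prod_nonneg divide_nonneg_nonneg) (use T in \<open>auto simp: moon_moser_seq_def\<close>)
  qed
  finally have "T k / C \<le> 1 - ?y" using Cpos by (simp add: field_simps)
  then show ?thesis by linarith
qed auto

text \<open>The product is the density of \<open>k\<close>-cliques in the balanced complete \<open>r\<close>-partite graph, for
  which all the inequalities are equalities.\<close>

lemma moon_moser_stability:
  fixes T :: "'x \<Rightarrow> nat \<Rightarrow> real"
  assumes T: "\<forall>\<^sub>F x in F. moon_moser_seq (T x)"
    and k: "2 \<le> k" "k \<le> r"
    and zero: "((\<lambda>x. T x (Suc r)) \<longlongrightarrow> 0) F"
    and e: "(e \<longlongrightarrow> 0) F"
    and lower: "\<forall>\<^sub>F x in F. T x k \<ge> (\<Prod>i<k. 1 - real i / real r) - e x"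
  obtains e1 e2 e3 :: "'x \<Rightarrow> real" and \<tau> :: real
  where "(e1 \<longlongrightarrow> 0) F" "(e2 \<longlongrightarrow> 0) F" "(e3 \<longlongrightarrow> 0) F" "\<tau> > 0"
    "\<forall>\<^sub>F x in F. T x 2 \<ge> 1 - 1 / real r - e1 x"
    "\<forall>\<^sub>F x in F. T x r \<ge> \<tau>"
    "\<forall>\<^sub>F x in F. T x (Suc r) / T x r \<le> e2 x"
    "\<forall>\<^sub>F x in F. T x r / T x (r - 1) \<ge> 1 / real r - e3 x"
proof -
  define C where "C = (\<Prod>s=2..<k. 1 - real s / real r)"
  have Cpos: "C > 0" unfolding C_def using k by (intro prod_pos) auto
  have r: "real r \<ge> 2" using k by simp
  define \<kappa> where "\<kappa> = (\<Prod>i<k. 1 - real i / real r)"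
  have \<kappa>: "\<kappa> = (1 - 1 / real r) * C"
  proof -
    have "{..<k} = {0, 1} \<union> {2..<k}" using k by auto
    then have "\<kappa> = (\<Prod>i\<in>{0, 1}. 1 - real i / real r) * C"
      unfolding \<kappa>_def C_def by (subst prod.union_disjoint[symmetric]) auto
    then show ?thesis by simp
  qed
  have \<kappa>pos: "\<kappa> > 0" using \<kappa> Cpos r by simp
  define d where "d x = \<bar>e x\<bar> / C" for x
  have d0: "(d \<longlongrightarrow> 0) F"
    unfolding d_def using tendsto_divide[OF tendsto_rabs[OF e] tendsto_const[of C]] Cpos by simp
  have dnn: "d x \<ge> 0" for x using Cpos by (simp add: d_def)
  \<comment> \<open>\<open>T x k\<close> is at least \<kappa>/2. On the way from \<open>k\<close> to
    \<open>r\<close> each ratio is at least 1/(2r), half of the smallest Turan ratio, once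
    \<open>d x\<close> is below 1/(2r^2).\<close>
  define \<tau> where "\<tau> = \<kappa> / 2 * (1 / (2 * real r)) ^ r"
  have \<tau>: "\<tau> > 0" using \<kappa>pos r by (simp add: \<tau>_def)
  have ev_e: "\<forall>\<^sub>F x in F. \<bar>e x\<bar> < \<kappa> / 2"
    using tendstoD[OF e, of "\<kappa> / 2"] \<kappa>pos by (simp add: dist_real_def)
  have ev_d: "\<forall>\<^sub>F x in F. d x < 1 / (2 * (real r)\<^sup>2)"
    using order_tendstoD(2)[OF d0, of "1 / (2 * (real r)\<^sup>2)"] r by simp
  define good where "good x \<longleftrightarrow> moon_moser_seq (T x) \<and> T x k \<ge> \<kappa> - e x \<and> \<bar>e x\<bar> < \<kappa> / 2
      \<and> d x < 1 / (2 * (real r)\<^sup>2)" for x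
  have good: "\<forall>\<^sub>F x in F. good x"
    using T lower ev_e ev_d unfolding good_def \<kappa>_def by eventually_elim simp
  have sl: "slope (T x) (k - 1) \<le> 1 / real r + d x" if "good x" for x
  proof -
    have Tk: "T x k \<ge> \<kappa> - e x" "T x k > 0" using that \<kappa>pos by (auto simp: good_def)
    have "slope (T x) (k - 1) \<le> max (1 / real r) (1 - T x k / C)"
      by (rule slope_upper) (use that k Tk C_def in \<open>auto simp: good_def\<close>)
    also have "\<dots> \<le> 1 / real r + d x"
    proof -
      have "T x k / C \<ge> (\<kappa> - e x) / C" using Tk Cpos by (intro divide_right_mono) auto
      moreover have "(\<kappa> - e x) / C = 1 - 1 / real r - e x / C" using Cpos by (simp add: \<kappa> diff_divide_distrib)
      moreover have "e x / C \<le> d x" using Cpos by (auto simp: d_def intro!: divide_right_mono)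
      ultimately have "1 - T x k / C \<le> 1 / real r + d x" by linarith
      then show ?thesis using dnn[of x] by simp
    qed
    finally show ?thesis .
  qed
  have slg: "slope (T x) s \<le> 1 / real r + d x" if "good x" "T x s > 0" "k - 1 \<le> s" for x s
    using slope_antimono[of "T x" s "k - 1"] sl[OF that(1)] that k by (auto simp: good_def)
  have ratio: "T x (Suc s) / T x s \<ge> 1 - real s / real r - real s * d x"
    if "good x" "T x s > 0" "k - 1 \<le> s" for x s
  proof -
    have "T x (Suc s) / T x s = 1 - real s * slope (T x) s" using k that by (intro ratio_slope) auto
    moreover have "real s * slope (T x) s \<le> real s * (1 / real r + d x)"
      by (intro mult_left_mono slg that) auto
    ultimately show ?thesis by (simp add: algebra_simps)
  qed
  have Tlow: "T x s \<ge> \<kappa> / 2 * (1 / (2 * real r)) ^ (s - k)" if g: "good x" and s: "k \<le> s" "s \<le> r" for x s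
    using s
  proof (induction s rule: dec_induct)
    case base
    then show ?case using g by (auto simp: good_def abs_if split: if_splits)
  next
    case (step m)
    have IH: "T x m \<ge> \<kappa> / 2 * (1 / (2 * real r)) ^ (m - k)" using step by simp
    have p: "\<kappa> / 2 * (1 / (2 * real r)) ^ (m - k) > 0" using \<kappa>pos r by simp
    then have Tm: "T x m > 0" using IH by linarith
    have mr: "real m \<le> real r - 1" using step by simp
    have "real m * d x \<le> real r * (1 / (2 * (real r)\<^sup>2))"
      using g mr dnn[of x] by (intro mult_mono) (auto simp: good_def)
    also have "\<dots> = 1 / (2 * real r)" using r by (simp add: power2_eq_square)
    finally have a: "real m * d x \<le> 1 / (2 * real r)" .
    have "real m / real r \<le> (real r - 1) / real r" using mr by (intro divide_right_mono) auto
    also have "\<dots> = 1 - 1 / real r" using r by (simp add: diff_divide_distrib)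
    finally have b: "real m / real r \<le> 1 - 1 / real r" .
    have "1 / real r = 1 / (2 * real r) + 1 / (2 * real r)" using r by (simp add: field_simps)
    then have "1 / (2 * real r) \<le> 1 - real m / real r - real m * d x" using a b by linarith
    also have "\<dots> \<le> T x (Suc m) / T x m" using g Tm step by (intro ratio) auto
    finally have "1 / (2 * real r) * T x m \<le> T x (Suc m)" using Tm by (simp add: field_simps)
    moreover have "1 / (2 * real r) * (\<kappa> / 2 * (1 / (2 * real r)) ^ (m - k)) \<le> 1 / (2 * real r) * T x m"
      using IH r by (intro mult_left_mono) auto
    moreover have "1 / (2 * real r) * (\<kappa> / 2 * (1 / (2 * real r)) ^ (m - k)) = \<kappa> / 2 * (1 / (2 * real r)) ^ (Suc m - k)"
      using step by (simp add: Suc_diff_le)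
    ultimately show ?case by linarith
  qed
  have Tr: "T x r \<ge> \<tau>" if "good x" for x
  proof -
    have "(1 / (2 * real r)) ^ r \<le> (1 / (2 * real r)) ^ (r - k)"
      using r by (intro power_decreasing) auto
    then have "\<tau> \<le> \<kappa> / 2 * (1 / (2 * real r)) ^ (r - k)"
      unfolding \<tau>_def using \<kappa>pos by (intro mult_left_mono) auto
    then show ?thesis using Tlow[OF that, of r] k by simp
  qed
  define e2 where "e2 x = \<bar>T x (Suc r)\<bar> / \<tau>" for x
  have e2: "(e2 \<longlongrightarrow> 0) F"
    unfolding e2_def using tendsto_divide[OF tendsto_rabs[OF zero] tendsto_const[of \<tau>]] \<tau> by simp
  have q: "T x (Suc r) / T x r \<le> e2 x" if "good x" for x
    unfolding e2_def using Tr[OF that] \<tau> by (intro frac_le) auto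
  \<comment> \<open>Now in the opposite direction: the slope at \<open>r\<close> is at least (1 -
    e2)/r, hence so are all earlier slopes, and the ratios exceed their Turan values by at most
    \<open>e2 x\<close>. Thus the product of the ratios is at most \<open>D x\<close>, which tends
    to \<open>C\<close>, and \<open>T x k\<close> can be large only if \<open>T x 2\<close>
    is.\<close>
  define D where "D x = (\<Prod>s=2..<k. 1 - real s / real r + e2 x)" for x
  have D: "(D \<longlongrightarrow> C) F"
  proof -
    have "((\<lambda>x. \<Prod>s=2..<k. 1 - real s / real r + e2 x) \<longlongrightarrow> (\<Prod>s=2..<k. 1 - real s / real r + 0)) F"
      by (intro tendsto_prod tendsto_add tendsto_const e2)
    moreover have "D = (\<lambda>x. \<Prod>s=2..<k. 1 - real s / real r + e2 x)" by (simp add: D_def fun_eq_iff)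
    ultimately show ?thesis by (simp add: C_def)
  qed
  have Dpos: "D x > 0" for x unfolding D_def
  proof (intro prod_pos)
    fix s assume "s \<in> {2..<k}"
    then have "real s / real r < 1" using k by simp
    moreover have "e2 x \<ge> 0" using \<tau> by (simp add: e2_def)
    ultimately show "0 < 1 - real s / real r + e2 x" by linarith
  qed
  define e1 where "e1 x = (1 - 1 / real r) - (\<kappa> - e x) / D x" for x
  have "(e1 \<longlongrightarrow> (1 - 1 / real r) - (\<kappa> - 0) / C) F"
    unfolding e1_def using Cpos by (intro tendsto_intros D e) auto
  then have e1: "(e1 \<longlongrightarrow> 0) F" using Cpos by (simp add: \<kappa>)
  have T2: "T x 2 \<ge> 1 - 1 / real r - e1 x" if g: "good x" for x
  proof -
    have mm: "moon_moser_seq (T x)" using g by (simp add: good_def)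
    have Tpos: "T x s > 0" if "s \<le> r" for s
      using Tr[OF g] \<tau> moon_moser_seq_antimono[OF mm that] by linarith
    have "T x k = T x 2 * (\<Prod>s=2..<k. T x (Suc s) / T x s)"
      by (rule prod_ratio) (use Tpos k in auto)
    also have "\<dots> \<le> T x 2 * D x"
      unfolding D_def
    proof (intro mult_left_mono prod_mono conjI)
      fix s assume s: "s \<in> {2..<k}"
      show "0 \<le> T x (Suc s) / T x s" using Tpos[of s] Tpos[of "Suc s"] s k by simp
      have "slope (T x) r \<le> slope (T x) s" by (rule slope_antimono[OF mm Tpos]) (use s k in auto)
      then have "real s * slope (T x) r \<le> real s * slope (T x) s" by (intro mult_left_mono) auto
      moreover have "real s * slope (T x) r = real s / real r - real s / real r * (T x (Suc r) / T x r)"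
        by (simp add: slope_def diff_divide_distrib right_diff_distrib)
      moreover have "real s / real r * (T x (Suc r) / T x r) \<le> 1 * e2 x"
        using q[OF g] s k Tpos[of r] mm by (intro mult_mono) (auto simp: moon_moser_seq_def)
      moreover have "T x (Suc s) / T x s = 1 - real s * slope (T x) s" using s by (intro ratio_slope) auto
      ultimately show "T x (Suc s) / T x s \<le> 1 - real s / real r + e2 x" by linarith
    qed (use mm in \<open>auto simp: moon_moser_seq_def\<close>)
    finally have "T x k / D x \<le> T x 2" using Dpos[of x] by (simp add: field_simps)
    moreover have "(\<kappa> - e x) / D x \<le> T x k / D x"
      using g Dpos[of x] by (intro divide_right_mono) (auto simp: good_def)
    ultimately show ?thesis by (simp add: e1_def)
  qed
  define e3 where "e3 x = real (r - 1) * d x" for x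
  have e3: "(e3 \<longlongrightarrow> 0) F" unfolding e3_def using tendsto_mult[OF tendsto_const d0] by simp
  have qr: "T x r / T x (r - 1) \<ge> 1 / real r - e3 x" if g: "good x" for x
  proof -
    have mm: "moon_moser_seq (T x)" using g by (simp add: good_def)
    have "T x (r - 1) > 0" using Tr[OF g] \<tau> moon_moser_seq_antimono[OF mm, of "r - 1" r] by linarith
    then have "T x (Suc (r - 1)) / T x (r - 1) \<ge> 1 - real (r - 1) / real r - real (r - 1) * d x"
      using g k by (intro ratio) auto
    moreover have "1 - real (r - 1) / real r = 1 / real r" using k r by (simp add: of_nat_diff field_simps)
    ultimately show ?thesis using k by (simp add: e3_def)
  qed
  show ?thesis
    by (rule that[OF e1 e2 e3 \<tau>]) (use good T2 Tr q qr in \<open>auto elim!: eventually_mono\<close>)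
qed

section \<open>Stability\<close>

definition cross_missing :: "'a set \<Rightarrow> ('a \<Rightarrow> 'a \<Rightarrow> bool) \<Rightarrow> ('a \<Rightarrow> 'b) \<Rightarrow> ('a \<times> 'a) set" where
  "cross_missing V E p = {(x, y). x \<in> V \<and> y \<in> V \<and> \<not> E x y \<and> p x \<noteq> p y}"

definition part :: "'a set \<Rightarrow> ('a \<Rightarrow> nat) \<Rightarrow> nat \<Rightarrow> 'a set" where
  "part V p i = {v \<in> V. p v = i}"

text \<open>A maximum cut condition. Any good partition would do for the estimates on average;
  minimality serves to control single vertices, see \<open>opt_partition_local\<close>.\<close>

definition opt_partition :: "'a set \<Rightarrow> ('a \<Rightarrow> 'a \<Rightarrow> bool) \<Rightarrow> nat \<Rightarrow> ('a \<Rightarrow> nat) \<Rightarrow> bool" where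
  "opt_partition V E r p \<longleftrightarrow> (\<forall>v. p v < r) \<and>
     (\<forall>q. (\<forall>v. q v < r) \<longrightarrow> card (inside V E p) \<le> card (inside V E q))"

text \<open>Each half is stated for the relation for which it is stronger: edges inside parts for
  the larger \<open>E'\<close>, missing pairs between parts for the smaller
  \<open>E\<close>.\<close>

definition nearly_turan ::
  "'a set \<Rightarrow> ('a \<Rightarrow> 'a \<Rightarrow> bool) \<Rightarrow> ('a \<Rightarrow> 'a \<Rightarrow> bool) \<Rightarrow> nat \<Rightarrow> real \<Rightarrow> ('a \<Rightarrow> nat) \<Rightarrow> bool" where
  "nearly_turan V E E' r \<theta> p \<longleftrightarrow>
     real (card (inside V E' p)) \<le> \<theta> * (real (card V))\<^sup>2 \<and>
     real (card (cross_missing V E p)) \<le> \<theta> * (real (card V))\<^sup>2 \<and>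
     (\<forall>i<r. \<bar>real (card (part V p i)) - real (card V) / real r\<bar> \<le> \<theta> * real (card V))"

lemma exists_opt_partition: "r > 0 \<Longrightarrow> \<exists>p. opt_partition V E r p"
  using ex_has_least_nat[of "\<lambda>p. \<forall>v. p v < r" "\<lambda>_. 0" "\<lambda>p. card (inside V E p)"]
  by (auto simp: opt_partition_def)

context fgraph
begin

lemma finite_inside: "finite (inside V E p)"
  by (rule finite_subset[of _ "V \<times> V"]) (auto simp: inside_def finV)

lemma finite_cross_missing: "finite (cross_missing V E p)"
  by (rule finite_subset[of _ "V \<times> V"]) (auto simp: cross_missing_def finV)

lemma finite_part: "finite (part V p i)"
  using finV by (simp add: part_def)

text \<open>Moving \<open>v\<close> to part \<open>i\<close> does not decrease the number of edges
  inside parts, and pairs that avoid \<open>v\<close> are not affected by the move.\<close>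

lemma opt_partition_local:
  assumes p: "opt_partition V E r p" and v: "v \<in> V" and i: "i < r"
  shows "card {w \<in> V. E v w \<and> p w = p v} \<le> card {w \<in> V. E v w \<and> p w = i}"
proof (cases "i = p v")
  case False
  define q where "q = p(v := i)"
  define R where "R = {(x, y). x \<in> V \<and> y \<in> V \<and> x \<noteq> v \<and> y \<noteq> v \<and> E x y \<and> p x = p y}"
  have finR: "finite R" by (rule finite_subset[of _ "V \<times> V"]) (auto simp: R_def finV)
  have decomp: "card (inside V E f) = card R + 2 * card {w \<in> V. E v w \<and> f w = f v}"
    if f: "\<And>x. x \<noteq> v \<Longrightarrow> f x = p x" for f
  proof -
    let ?S = "{w \<in> V. E v w \<and> f w = f v}"
    have eq: "inside V E f = R \<union> (Pair v ` ?S \<union> (\<lambda>w. (w, v)) ` ?S)" (is "?l = ?rhs")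
    proof
      show "?l \<subseteq> ?rhs"
      proof
        fix z assume z: "z \<in> ?l"
        obtain x y where xy: "z = (x, y)" "x \<in> V" "y \<in> V" "E x y" "f x = f y"
          using z by (auto simp: inside_def)
        consider "x = v" | "x \<noteq> v" "y = v" | "x \<noteq> v" "y \<noteq> v" by blast
        then show "z \<in> ?rhs"
        proof cases
          case 1
          then have "y \<in> ?S" using xy by simp
          then show ?thesis using 1 xy(1) by blast
        next
          case 2
          then have "x \<in> ?S" using xy symE[OF xy(4)] by simp
          then show ?thesis using 2 xy(1) by blast
        next
          case 3
          then show ?thesis using xy f[of x] f[of y] by (simp add: R_def)
        qed
      qed
      have "R \<subseteq> ?l" using f by (auto simp: R_def inside_def)
      moreover have "Pair v ` ?S \<subseteq> ?l" using v by (auto simp: inside_def)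
      moreover have "(\<lambda>w. (w, v)) ` ?S \<subseteq> ?l" using v by (auto simp: inside_def intro: symE)
      ultimately show "?rhs \<subseteq> ?l" by simp
    qed
    have "card (Pair v ` ?S \<union> (\<lambda>w. (w, v)) ` ?S) = card ?S + card ?S"
      using irrE finV by (subst card_Un_disjoint) (auto simp: card_image inj_on_def)
    moreover have "card (inside V E f) = card R + card (Pair v ` ?S \<union> (\<lambda>w. (w, v)) ` ?S)"
      unfolding eq using finR finV by (intro card_Un_disjoint) (auto simp: R_def)
    ultimately show ?thesis by simp
  qed
  have "card (inside V E p) \<le> card (inside V E q)"
    using p i by (auto simp: opt_partition_def q_def)
  then have "card {w \<in> V. E v w \<and> p w = p v} \<le> card {w \<in> V. E v w \<and> q w = q v}"
    using decomp[of p] decomp[of q] by (simp add: q_def)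
  also have "{w \<in> V. E v w \<and> q w = q v} = {w \<in> V. E v w \<and> p w = i}"
    using irrE by (auto simp: q_def)
  finally show ?thesis .
qed simp

lemma dens_ratio:
  assumes "card V > 0"
  shows "dens V E (Suc s) / dens V E s = real (Suc s) * card (clq V E (Suc s)) / (real (card V) * card (clq V E s))"
proof -
  define c where "c = fact s / real (card V) ^ s"
  have "c \<noteq> 0" using assms by (simp add: c_def)
  moreover have "dens V E (Suc s) = c * (real (Suc s) * card (clq V E (Suc s)) / real (card V))"
    by (simp add: dens_def c_def mult_ac)
  moreover have "dens V E s = c * card (clq V E s)" by (simp add: dens_def c_def)
  ultimately show ?thesis by simp
qed

text \<open>\<open>clq_ext1_lower\<close> at r - 1 bounds the average of
  \<open>card (ext1 V E K)\<close> from below. The bracket tends to 0 when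
  \<open>dens V E r / dens V E (r - 1)\<close> tends to 1/r and the next ratio to 0. Of the
  coefficient 3r, 2r comes from the estimate of \<open>ext1\<close> and r from the
  (r+1)-cliques.\<close>

lemma exists_partition_dens:
  assumes n: "card V > 0" and r: "r > 0" and d: "dens V E r > 0"
  shows "\<exists>p. (\<forall>v. p v < r) \<and> real (card (inside V E p)) \<le>
     (2 * (1 - real r * (dens V E r / dens V E (r - 1))) + 3 * real r * (dens V E (Suc r) / dens V E r)) * (real (card V))\<^sup>2"
proof -
  define m where "m = real (card V)"
  define N where "N i = real (card (clq V E i))" for i
  define X where "X = real (\<Sum>K\<in>clq V E r. card (ext1 V E K))"
  obtain s where s: "r = Suc s" using r gr0_conv_Suc by blast
  have m: "m > 0" using n by (simp add: m_def)
  have Nr: "N r > 0"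
  proof (rule ccontr)
    assume "\<not> N r > 0"
    then have "N r = 0" by (simp add: N_def)
    then show False using d by (simp add: dens_def N_def)
  qed
  have Ns: "N s > 0"
  proof (rule ccontr)
    assume "\<not> N s > 0"
    then have "dens V E s = 0" by (simp add: dens_def N_def)
    then show False using dens_Suc_le[OF n, of s] d s by simp
  qed
  have "card (clq V E r) > 0" using Nr by (simp add: N_def)
  from exists_partition_clq[OF this r] obtain p where p: "\<forall>v. p v < r"
    "real (card (inside V E p)) * N r \<le> 2 * m * (m * N r - X) + m * (r * (Suc r * N (Suc r)))"
    unfolding m_def N_def X_def of_nat_mult by blast
  have q1: "dens V E r / dens V E (r - 1) = real r * N r / (m * N s)"
    using dens_ratio[OF n, of s] s by (simp add: N_def m_def)
  have q2: "dens V E (Suc r) / dens V E r = real (Suc r) * N (Suc r) / (m * N r)"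
    using dens_ratio[OF n, of r] by (simp add: N_def m_def)
  have "real ((Suc s * card (clq V E (Suc s)))\<^sup>2) \<le> real (card (clq V E s) *
    ((\<Sum>K\<in>clq V E (Suc s). card (ext1 V E K)) + Suc s * (Suc (Suc s) * card (clq V E (Suc (Suc s))))))"
    by (simp only: of_nat_le_iff clq_ext1_lower)
  then have 1: "(real r * N r)\<^sup>2 \<le> N s * (X + real r * (real (Suc r) * N (Suc r)))"
    by (simp only: N_def X_def of_nat_power of_nat_mult of_nat_add s)
  have "(real r * N r)\<^sup>2 / (m * N s * N r) \<le> N s * (X + real r * (real (Suc r) * N (Suc r))) / (m * N s * N r)"
    using m Ns Nr by (intro divide_right_mono 1) auto
  moreover have "(real r * N r)\<^sup>2 / (m * N s * N r) = real r * (real r * N r / (m * N s))"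
    using m Ns Nr by (simp add: power2_eq_square)
  moreover have "N s * (X + real r * (real (Suc r) * N (Suc r))) / (m * N s * N r)
      = X / (m * N r) + real r * (real (Suc r) * N (Suc r) / (m * N r))"
    using m Ns Nr by (simp add: add_divide_distrib distrib_left del: of_nat_Suc)
  ultimately have 2: "real r * (dens V E r / dens V E (r - 1)) \<le> X / (m * N r) + real r * (dens V E (Suc r) / dens V E r)"
    unfolding q1 q2 by linarith
  have "real (card (inside V E p)) \<le> (2 * m * (m * N r - X) + m * (r * (Suc r * N (Suc r)))) / N r"
    using p(2) Nr by (simp add: field_simps)
  also have "\<dots> = (2 * (1 - X / (m * N r)) + real r * (dens V E (Suc r) / dens V E r)) * m\<^sup>2"
    unfolding q2 using m Nr by (simp add: field_simps power2_eq_square del: of_nat_Suc)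
  also have "\<dots> \<le> (2 * (1 - real r * (dens V E r / dens V E (r - 1))) + 3 * real r * (dens V E (Suc r) / dens V E r)) * m\<^sup>2"
  proof (rule mult_right_mono)
    show "2 * (1 - X / (m * N r)) + real r * (dens V E (Suc r) / dens V E r)
      \<le> 2 * (1 - real r * (dens V E r / dens V E (r - 1))) + 3 * real r * (dens V E (Suc r) / dens V E r)"
    proof -
      have "2 * (1 - b) + c \<le> 2 * (1 - a) + 3 * c" if "a \<le> b + c" for a b c :: real
        using that by (simp add: algebra_simps)
      from this[OF 2] show ?thesis by (simp only: mult.assoc)
    qed
  qed simp
  finally show ?thesis using p(1) unfolding m_def by blast
qed

lemma sum_part: "(\<forall>v. p v < r) \<Longrightarrow> (\<Sum>i<r. card (part V p i)) = card V"
proof -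
  assume p: "\<forall>v. p v < r"
  have "(\<Sum>i<r. card (part V p i)) = card (\<Union>i<r. part V p i)"
    by (rule card_UN_disjoint[symmetric]) (auto simp: part_def finV)
  also have "(\<Union>i<r. part V p i) = V" using p by (auto simp: part_def)
  finally show ?thesis .
qed

lemma card_edge_pairs: "real (card {(x, y). x \<in> V \<and> y \<in> V \<and> E x y}) = dens V E 2 * (real (card V))\<^sup>2"
proof (cases "card V = 0")
  case True
  then have "V = {}" using finV by simp
  then show ?thesis by simp
next
  case False
  have "{(x, y). x \<in> V \<and> y \<in> V \<and> E x y} = Sigma V (\<lambda>x. ext V E {x})"
    using symE by (auto simp: ext_def)
  then have "card {(x, y). x \<in> V \<and> y \<in> V \<and> E x y} = (\<Sum>x\<in>V. card (ext V E {x}))"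
    by (simp add: card_SigmaI finV finite_ext)
  also have "\<dots> = (\<Sum>K\<in>clq V E 1. card (ext V E K))"
    by (rule sum.reindex_bij_witness[where i = "\<lambda>K. the_elem K" and j = "\<lambda>x. {x}"])
      (auto simp: clq_def card_1_singleton_iff)
  also have "\<dots> = 2 * card (clq V E 2)" using sum_card_ext[of 1] by (simp add: numeral_2_eq_2)
  finally show ?thesis using False by (simp add: dens_def)
qed

text \<open>Edges, missing cross pairs and pairs within a part overlap only in edges inside parts,
  so their numbers sum to at most n^2 plus that overlap. The pairs within parts number n^2/r plus
  n^2 times the variance of the relative part sizes. One deficit \<omega> thus pays both for missing
  pairs and for imbalance.\<close>

lemma partition_structure:
  assumes n: "card V > 0" and r: "r > 0" and p: "\<forall>v. p v < r"
    and E': "\<And>x y. E x y \<Longrightarrow> E' x y"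
    and \<omega>: "\<omega> = 1 - 1 / real r - dens V E 2 + real (card (inside V E' p)) / (real (card V))\<^sup>2"
  shows "real (card (cross_missing V E p)) \<le> \<omega> * (real (card V))\<^sup>2"
    and "i < r \<Longrightarrow> (real (card (part V p i)) / real (card V) - 1 / real r)\<^sup>2 \<le> \<omega>"
proof -
  define m where "m = real (card V)"
  define a where "a i = real (card (part V p i)) / m" for i
  have m: "m > 0" using n by (simp add: m_def)
  let ?all = "V \<times> V" and ?same = "{(x, y). x \<in> V \<and> y \<in> V \<and> p x = p y}"
  let ?ed = "{(x, y). x \<in> V \<and> y \<in> V \<and> E x y}"
  have fin: "finite ?all" "finite ?same" "finite ?ed" "finite (inside V E' p)"
    by (auto intro: finite_subset[of _ "V \<times> V"] simp: finV inside_def)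
  have "?same = (\<Union>i<r. part V p i \<times> part V p i)" using p by (auto simp: part_def)
  also have "card \<dots> = (\<Sum>i<r. card (part V p i \<times> part V p i))"
    by (rule card_UN_disjoint) (auto simp: part_def finV)
  finally have "real (card ?same) = (\<Sum>i<r. (real (card (part V p i)))\<^sup>2)"
    by (simp add: card_cartesian_product power2_eq_square)
  also have "\<dots> = (\<Sum>i<r. (a i)\<^sup>2) * m\<^sup>2"
    using m by (simp add: a_def sum_distrib_right power_divide)
  finally have same: "real (card ?same) = (\<Sum>i<r. (a i)\<^sup>2) * m\<^sup>2" .
  have ed: "real (card ?ed) = dens V E 2 * m\<^sup>2" using card_edge_pairs by (simp add: m_def)
  define M where "M = cross_missing V E p"
  define I where "I = real (card (inside V E' p))"
  have disj: "M \<inter> ?same = {}" by (auto simp: M_def cross_missing_def)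
  have finM: "finite M" unfolding M_def by (rule finite_cross_missing)
  have sub: "?all \<subseteq> M \<union> ?same \<union> ?ed" by (auto simp: M_def cross_missing_def)
  have "card ?ed + card M + card ?same \<le> card ?all + card (inside V E' p)"
  proof -
    have e: "?ed \<inter> ?same \<subseteq> inside V E' p" using E' by (auto simp: inside_def)
    have "card ?ed + card (M \<union> ?same) = card (?ed \<union> (M \<union> ?same)) + card (?ed \<inter> (M \<union> ?same))"
      by (rule card_Un_Int) (use fin finM in auto)
    also have "\<dots> \<le> card ?all + card (inside V E' p)"
    proof (rule add_mono)
      show "card (?ed \<union> (M \<union> ?same)) \<le> card ?all"
        by (rule card_mono[OF fin(1)]) (auto simp: M_def cross_missing_def)
      show "card (?ed \<inter> (M \<union> ?same)) \<le> card (inside V E' p)"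
        by (rule card_mono[OF fin(4)]) (use e in \<open>auto simp: M_def cross_missing_def\<close>)
    qed
    finally show ?thesis using card_Un_disjoint[OF finM fin(2) disj] by simp
  qed
  then have "real (card ?ed + card M + card ?same) \<le> real (card ?all + card (inside V E' p))"
    by (simp only: of_nat_le_iff)
  then have key: "dens V E 2 * m\<^sup>2 + real (card M) + (\<Sum>i<r. (a i)\<^sup>2) * m\<^sup>2 \<le> m\<^sup>2 + I"
    using same ed by (simp add: I_def card_cartesian_product m_def power2_eq_square)
  have suma: "(\<Sum>i<r. a i) = 1"
  proof -
    have "(\<Sum>i<r. a i) = real (\<Sum>i<r. card (part V p i)) / m" by (simp add: a_def sum_divide_distrib)
    then show ?thesis using m sum_part[OF p] by (simp add: m_def)
  qed
  have "(\<Sum>i<r. (a i - 1 / real r)\<^sup>2) = (\<Sum>i<r. (a i)\<^sup>2 - 2 / real r * a i + (1 / real r)\<^sup>2)"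
    using r by (intro sum.cong refl) (simp add: power2_eq_square field_simps)
  also have "\<dots> = (\<Sum>i<r. (a i)\<^sup>2) - 2 / real r * (\<Sum>i<r. a i) + real r * (1 / real r)\<^sup>2"
    by (simp add: sum.distrib sum_subtractf sum_distrib_left)
  also have "\<dots> = (\<Sum>i<r. (a i)\<^sup>2) - 1 / real r"
    using r unfolding suma by (simp add: power2_eq_square field_simps)
  finally have sq: "(\<Sum>i<r. (a i - 1 / real r)\<^sup>2) = (\<Sum>i<r. (a i)\<^sup>2) - 1 / real r" .
  have \<omega>': "\<omega> = 1 - 1 / real r - dens V E 2 + I / m\<^sup>2" by (simp add: \<omega> I_def m_def)
  have m2: "m\<^sup>2 > 0" using m by simp
  have \<omega>m: "\<omega> * m\<^sup>2 = m\<^sup>2 - 1 / real r * m\<^sup>2 - dens V E 2 * m\<^sup>2 + I"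
    using m by (simp add: \<omega>' algebra_simps)
  have "(\<Sum>i<r. (a i - 1 / real r)\<^sup>2) * m\<^sup>2 + real (card M) \<le> \<omega> * m\<^sup>2"
    unfolding \<omega>m sq using key by (simp add: left_diff_distrib)
  moreover have nn: "(\<Sum>i<r. (a i - 1 / real r)\<^sup>2) \<ge> 0" by (intro sum_nonneg) simp
  ultimately show "real (card (cross_missing V E p)) \<le> \<omega> * (real (card V))\<^sup>2"
    using mult_nonneg_nonneg[OF nn zero_le_power2[of m]] unfolding M_def m_def by linarith
  assume i: "i < r"
  have "(\<Sum>i<r. (a i - 1 / real r)\<^sup>2) * m\<^sup>2 \<le> \<omega> * m\<^sup>2"
    using \<open>(\<Sum>i<r. (a i - 1 / real r)\<^sup>2) * m\<^sup>2 + real (card M) \<le> \<omega> * m\<^sup>2\<close> by linarith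
  then have "(\<Sum>i<r. (a i - 1 / real r)\<^sup>2) \<le> \<omega>" using m2 by simp
  moreover have "(a i - 1 / real r)\<^sup>2 \<le> (\<Sum>i<r. (a i - 1 / real r)\<^sup>2)"
    by (rule member_le_sum) (use i in auto)
  ultimately show "(real (card (part V p i)) / real (card V) - 1 / real r)\<^sup>2 \<le> \<omega>"
    by (simp add: a_def m_def)
qed

end

lemma dens_mono:
  assumes "finite V" "\<And>x y. E x y \<Longrightarrow> E' x y"
  shows "dens V E s \<le> dens V E' s"
proof -
  have "card (clq V E s) \<le> card (clq V E' s)"
    by (intro card_mono finite_clq clq_mono assms order_refl)
  then show ?thesis unfolding dens_def by (intro divide_right_mono mult_left_mono) auto
qed

text \<open>Supersaturation: a positive density of s-cliques forces a complete s-partite graph with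
  classes of any fixed size, and such a graph contains every s-colourable graph.\<close>

lemma free_dens_tendsto_0:
  fixes V :: "'x \<Rightarrow> 'a set" and E :: "'x \<Rightarrow> 'a \<Rightarrow> 'a \<Rightarrow> bool"
  assumes ev: "\<forall>\<^sub>F x in \<F>. fgraph (V x) (E x)"
    and n: "filterlim (\<lambda>x. card (V x)) at_top \<F>"
    and F: "is_hypergraph F" "proper_coloring F s c"
    and free: "\<forall>\<^sub>F x in \<F>. \<not> emb F (V x) (E x)"
  shows "((\<lambda>x. dens (V x) (E x) s) \<longlongrightarrow> 0) \<F>"
proof (rule tendstoI)
  fix \<zeta> :: real assume \<zeta>: "\<zeta> > 0"
  define m where "m = Suc (card (verts F))"
  have finF: "finite (verts F)" using F by (simp add: is_hypergraph_def)
  have \<zeta>': "\<zeta> / fact s > 0" and m: "m > 0" using \<zeta> by (auto simp: m_def)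
  from erdos_clq[OF this, where s = s and 'a = 'a] obtain n0 where n0:
    "\<forall>(V :: 'a set) Z E. finite V \<and> card V \<ge> n0 \<and> Z \<subseteq> V
      \<and> real (card (clq Z E s)) \<ge> \<zeta> / fact s * real (card V) ^ s \<longrightarrow>
    (\<exists>X. (\<forall>i<s. X i \<subseteq> Z \<and> card (X i) = m) \<and>
      (\<forall>i<s. \<forall>j<s. i \<noteq> j \<longrightarrow> (\<forall>x\<in>X i. \<forall>y\<in>X j. E x y)))"
    by (rule exE)
  have "\<forall>\<^sub>F x in \<F>. card (V x) \<ge> max 1 n0" using n unfolding filterlim_at_top by blast
  then show "\<forall>\<^sub>F x in \<F>. dist (dens (V x) (E x) s) 0 < \<zeta>"
    using ev free
  proof eventually_elim
    case (elim x)
    interpret fgraph "V x" "E x" by (rule elim)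
    have "dens (V x) (E x) s < \<zeta>"
    proof (rule ccontr)
      assume "\<not> ?thesis"
      then have "\<zeta> / fact s * real (card (V x)) ^ s \<le> real (card (clq (V x) (E x) s))"
        using elim(1) by (simp add: dens_def field_simps)
      with n0[rule_format, of "V x" "V x" "E x"] finV elim(1) obtain X where
        X: "\<forall>i<s. X i \<subseteq> V x \<and> card (X i) = m"
        "\<forall>i<s. \<forall>j<s. i \<noteq> j \<longrightarrow> (\<forall>y\<in>X i. \<forall>z\<in>X j. E x y z)"
        by auto
      have "emb F (V x) (E x)"
      proof (rule emb_blowup[OF F])
        fix i assume i: "i < s"
        have "card {v \<in> verts F. c v = i} \<le> card (verts F)" by (rule card_mono[OF finF]) auto
        then show "X i \<subseteq> V x \<and> finite (X i) \<and> card {v \<in> verts F. c v = i} \<le> card (X i)"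
          using X(1) i finite_subset[OF _ finV, of "X i"] by (auto simp: m_def)
      qed (use X(2) irrE in auto)
      then show False using elim by simp
    qed
    then show ?case using dens_nonneg[of "V x" "E x" s] by (simp add: dist_real_def)
  qed
qed

text \<open>In the application \<open>E\<close> is the relation of the blue edges and \<open>E'\<close> that of all edges.\<close>

lemma stability:
  fixes V :: "'x \<Rightarrow> 'a set" and E E' :: "'x \<Rightarrow> 'a \<Rightarrow> 'a \<Rightarrow> bool"
  assumes ev: "\<forall>\<^sub>F x in \<F>. fgraph (V x) (E x)" "\<forall>\<^sub>F x in \<F>. fgraph (V x) (E' x)"
    and sub: "\<And>x u v. E x u v \<Longrightarrow> E' x u v"
    and n: "filterlim (\<lambda>x. card (V x)) at_top \<F>"
    and k: "2 \<le> k" "k \<le> r"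
    and zero: "((\<lambda>x. dens (V x) (E' x) (Suc r)) \<longlongrightarrow> 0) \<F>"
    and e: "(e \<longlongrightarrow> 0) \<F>"
    and lower: "\<forall>\<^sub>F x in \<F>. dens (V x) (E x) k \<ge> (\<Prod>i<k. 1 - real i / real r) - e x"
  obtains \<theta> :: "'x \<Rightarrow> real" where "(\<theta> \<longlongrightarrow> 0) \<F>"
    "\<forall>\<^sub>F x in \<F>. \<forall>p. opt_partition (V x) (E' x) r p \<longrightarrow>
       nearly_turan (V x) (E x) (E' x) r (\<theta> x) p"
proof -
  have npos: "\<forall>\<^sub>F x in \<F>. card (V x) > 0"
  proof -
    have "\<forall>\<^sub>F x in \<F>. 1 \<le> card (V x)" using n unfolding filterlim_at_top by blast
    then show ?thesis by (rule eventually_mono) simp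
  qed
  have le: "dens (V x) (E x) s \<le> dens (V x) (E' x) s" if "fgraph (V x) (E x)" for x s
    using that sub by (intro dens_mono) (auto simp: fgraph_def)
  have mm: "\<forall>\<^sub>F x in \<F>. moon_moser_seq (dens (V x) (E x))"
    using npos ev(1) by eventually_elim (rule fgraph.moon_moser_seq_dens)
  have mm': "\<forall>\<^sub>F x in \<F>. moon_moser_seq (dens (V x) (E' x))"
    using npos ev(2) by eventually_elim (rule fgraph.moon_moser_seq_dens)
  have lower': "\<forall>\<^sub>F x in \<F>. dens (V x) (E' x) k \<ge> (\<Prod>i<k. 1 - real i / real r) - e x"
    using lower ev(1)
  proof eventually_elim
    case (elim x)
    then show ?case using le[OF elim(2), of k] by linarith
  qed
  have zero': "((\<lambda>x. dens (V x) (E x) (Suc r)) \<longlongrightarrow> 0) \<F>"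
  proof (rule tendsto_sandwich[OF _ _ tendsto_const zero])
    show "\<forall>\<^sub>F x in \<F>. 0 \<le> dens (V x) (E x) (Suc r)" by (simp add: dens_nonneg)
    show "\<forall>\<^sub>F x in \<F>. dens (V x) (E x) (Suc r) \<le> dens (V x) (E' x) (Suc r)"
      using ev(1) by eventually_elim (rule le)
  qed
  \<comment> \<open>The density analysis is applied twice: to the graph of \<open>E\<close> for a
    large edge density, and to that of \<open>E'\<close> for the ratios at \<open>r\<close>, which
    produce the partition.\<close>
  obtain e1 :: "'x \<Rightarrow> real" where e1: "(e1 \<longlongrightarrow> 0) \<F>"
    "\<forall>\<^sub>F x in \<F>. dens (V x) (E x) 2 \<ge> 1 - 1 / real r - e1 x"
    by (rule moon_moser_stability[OF mm k zero' e lower])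
  obtain e2 e3 :: "'x \<Rightarrow> real" and \<tau> :: real where e23: "(e2 \<longlongrightarrow> 0) \<F>" "(e3 \<longlongrightarrow> 0) \<F>" "\<tau> > 0"
    "\<forall>\<^sub>F x in \<F>. dens (V x) (E' x) r \<ge> \<tau>"
    "\<forall>\<^sub>F x in \<F>. dens (V x) (E' x) (Suc r) / dens (V x) (E' x) r \<le> e2 x"
    "\<forall>\<^sub>F x in \<F>. dens (V x) (E' x) r / dens (V x) (E' x) (r - 1) \<ge> 1 / real r - e3 x"
    by (rule moon_moser_stability[OF mm' k zero e lower'])
  define u where "u x = \<bar>e1 x\<bar> + 2 * real r * \<bar>e3 x\<bar> + 3 * real r * \<bar>e2 x\<bar>" for x
  \<comment> \<open>The square root appears because \<open>partition_structure\<close> bounds the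
    squares of the deviations of the part sizes.\<close>
  define \<theta> where "\<theta> x = u x + sqrt (u x)" for x
  have "(u \<longlongrightarrow> 0 + 2 * real r * 0 + 3 * real r * 0) \<F>"
    unfolding u_def by (intro tendsto_add tendsto_mult tendsto_const tendsto_rabs_zero e1 e23)
  then have u0: "(u \<longlongrightarrow> 0) \<F>" by simp
  have "(\<theta> \<longlongrightarrow> 0 + sqrt 0) \<F>"
    unfolding \<theta>_def by (intro tendsto_add tendsto_real_sqrt u0)
  then have \<theta>0: "(\<theta> \<longlongrightarrow> 0) \<F>" by simp
  show thesis
  proof (rule that[OF \<theta>0])
    show "\<forall>\<^sub>F x in \<F>. \<forall>p. opt_partition (V x) (E' x) r p \<longrightarrow>
       nearly_turan (V x) (E x) (E' x) r (\<theta> x) p"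
      using npos ev e1(2) e23(4-6)
    proof eventually_elim
      case (elim x)
      interpret B: fgraph "V x" "E x" by (rule elim)
      interpret G: fgraph "V x" "E' x" by (rule elim)
      let ?n = "real (card (V x))"
      have r: "r > 0" using k by simp
      have n2: "?n\<^sup>2 > 0" using elim(1) by simp
      show ?case
      proof (intro allI impI)
        fix p assume p: "opt_partition (V x) (E' x) r p"
        have pr: "\<forall>v. p v < r" using p by (simp add: opt_partition_def)
        have "dens (V x) (E' x) r > 0" using elim(5) e23(3) by linarith
        from G.exists_partition_dens[OF elim(1) r this] obtain q where q: "\<forall>v. q v < r"
          "real (card (inside (V x) (E' x) q)) \<le>
             (2 * (1 - real r * (dens (V x) (E' x) r / dens (V x) (E' x) (r - 1)))
               + 3 * real r * (dens (V x) (E' x) (Suc r) / dens (V x) (E' x) r)) * ?n\<^sup>2" by blast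
        have "card (inside (V x) (E' x) p) \<le> card (inside (V x) (E' x) q)"
          using p q by (simp add: opt_partition_def)
        then have "real (card (inside (V x) (E' x) p)) \<le> (2 * (1 - real r * (dens (V x) (E' x) r / dens (V x) (E' x) (r - 1)))
               + 3 * real r * (dens (V x) (E' x) (Suc r) / dens (V x) (E' x) r)) * ?n\<^sup>2"
          using q(2) by linarith
        also have "\<dots> \<le> (2 * real r * \<bar>e3 x\<bar> + 3 * real r * \<bar>e2 x\<bar>) * ?n\<^sup>2"
        proof (intro mult_right_mono add_mono)
          have "real r * (1 / real r - e3 x) \<le> real r * (dens (V x) (E' x) r / dens (V x) (E' x) (r - 1))"
            using elim(7) by (intro mult_left_mono) auto
          moreover have "real r * (1 / real r - e3 x) = 1 - real r * e3 x" using r by (simp add: right_diff_distrib)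
          moreover have "real r * e3 x \<le> real r * \<bar>e3 x\<bar>" by (intro mult_left_mono) auto
          ultimately have calc: "real r * (1 / real r - e3 x) \<le> real r * (dens (V x) (E' x) r / dens (V x) (E' x) (r - 1))"
            "real r * (1 / real r - e3 x) = 1 - real r * e3 x" "real r * e3 x \<le> real r * \<bar>e3 x\<bar>" .
          show "2 * (1 - real r * (dens (V x) (E' x) r / dens (V x) (E' x) (r - 1))) \<le> 2 * real r * \<bar>e3 x\<bar>"
          proof -
            have "2 * (1 - a) \<le> 2 * d" if "b \<le> a" "b = 1 - c" "c \<le> d" for a b c d :: real
              using that by (simp add: algebra_simps)
            from this[OF calc] show ?thesis by (simp only: mult.assoc)
          qed
          show "3 * real r * (dens (V x) (E' x) (Suc r) / dens (V x) (E' x) r) \<le> 3 * real r * \<bar>e2 x\<bar>"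
            using elim(6) by (intro mult_left_mono) auto
        qed auto
        finally have ins: "real (card (inside (V x) (E' x) p)) \<le> (2 * real r * \<bar>e3 x\<bar> + 3 * real r * \<bar>e2 x\<bar>) * ?n\<^sup>2" .
        define \<omega> where "\<omega> = 1 - 1 / real r - dens (V x) (E x) 2 + real (card (inside (V x) (E' x) p)) / ?n\<^sup>2"
        have "real (card (inside (V x) (E' x) p)) / ?n\<^sup>2 \<le> 2 * real r * \<bar>e3 x\<bar> + 3 * real r * \<bar>e2 x\<bar>"
          using ins n2 by (simp add: pos_divide_le_eq)
        then have \<omega>u: "\<omega> \<le> u x" using elim(4) by (simp add: \<omega>_def u_def)
        have unn: "u x \<ge> 0" by (simp add: u_def)
        have u\<theta>: "u x \<le> \<theta> x" "sqrt (u x) \<le> \<theta> x" using unn by (auto simp: \<theta>_def)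
        have ps1: "real (card (cross_missing (V x) (E x) p)) \<le> \<omega> * ?n\<^sup>2"
          by (rule B.partition_structure(1)[OF elim(1) r pr sub \<omega>_def])
        have ps2: "(real (card (part (V x) p i)) / ?n - 1 / real r)\<^sup>2 \<le> \<omega>" if "i < r" for i
          by (rule B.partition_structure(2)[OF elim(1) r pr sub \<omega>_def that])
        have 1: "real (card (inside (V x) (E' x) p)) \<le> \<theta> x * ?n\<^sup>2"
        proof -
          have "(2 * real r * \<bar>e3 x\<bar> + 3 * real r * \<bar>e2 x\<bar>) \<le> \<theta> x" using u\<theta>(1) by (simp add: u_def)
          then have "(2 * real r * \<bar>e3 x\<bar> + 3 * real r * \<bar>e2 x\<bar>) * ?n\<^sup>2 \<le> \<theta> x * ?n\<^sup>2" by (intro mult_right_mono) auto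
          then show ?thesis using ins by linarith
        qed
        have 2: "real (card (cross_missing (V x) (E x) p)) \<le> \<theta> x * ?n\<^sup>2"
        proof -
          have "\<omega> * ?n\<^sup>2 \<le> \<theta> x * ?n\<^sup>2" using \<omega>u u\<theta> by (intro mult_right_mono) auto
          then show ?thesis using ps1 by linarith
        qed
        have 3: "\<bar>real (card (part (V x) p i)) - ?n / real r\<bar> \<le> \<theta> x * ?n" if "i < r" for i
        proof -
          have "(real (card (part (V x) p i)) / ?n - 1 / real r)\<^sup>2 \<le> u x" using ps2[OF that] \<omega>u by linarith
          then have "\<bar>real (card (part (V x) p i)) / ?n - 1 / real r\<bar> \<le> \<theta> x"
            using real_sqrt_le_mono u\<theta>(2) by fastforce
          then have "\<bar>real (card (part (V x) p i)) / ?n - 1 / real r\<bar> * ?n \<le> \<theta> x * ?n"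
            by (intro mult_right_mono) auto
          moreover have "\<bar>real (card (part (V x) p i)) / ?n - 1 / real r\<bar> * ?n = \<bar>real (card (part (V x) p i)) - ?n / real r\<bar>"
          proof -
            have "\<bar>real (card (part (V x) p i)) / ?n - 1 / real r\<bar> * ?n = \<bar>(real (card (part (V x) p i)) / ?n - 1 / real r) * ?n\<bar>"
              by (simp add: abs_mult)
            also have "(real (card (part (V x) p i)) / ?n - 1 / real r) * ?n = real (card (part (V x) p i)) - ?n / real r"
              using elim(1) by (simp add: left_diff_distrib)
            finally show ?thesis .
          qed
          ultimately show ?thesis by simp
        qed
        show "nearly_turan (V x) (E x) (E' x) r (\<theta> x) p"
          unfolding nearly_turan_def using 1 2 3 by blast
      qed
    qed
  qed
qed

section \<open>Transversals and common links\<close>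

lemma binomial_Suc_mult: "Suc s * (m choose Suc s) = (m - s) * (m choose s)"
  by (metis binomial_absorb_comp binomial_absorption)

text \<open>Written as cliques of the complete multipartite graph whose classes are the parts in
  \<open>J\<close>, so that the counting identities for cliques apply to them.\<close>

definition transversals :: "'a set \<Rightarrow> ('a \<Rightarrow> nat) \<Rightarrow> nat set \<Rightarrow> nat \<Rightarrow> 'a set set" where
  "transversals V p J s = clq {v \<in> V. p v \<in> J} (\<lambda>x y. p x \<noteq> p y) s"

lemma fgraph_multipartite: "finite V \<Longrightarrow> fgraph V (\<lambda>x y. p x \<noteq> p y)"
  by unfold_locales auto

lemma finite_transversals: "finite V \<Longrightarrow> finite (transversals V p J s)"
  unfolding transversals_def by (intro finite_clq) simp

lemma transversals_iff:
  "K \<in> transversals V p J s \<longleftrightarrow> K \<subseteq> V \<and> card K = s \<and> inj_on p K \<and> p ` K \<subseteq> J"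
  by (auto simp: transversals_def clq_def pairwise_def inj_on_def)

lemma card_ext_transversals:
  assumes "finite V" "finite J" and K: "K \<in> transversals V p J s"
  shows "card (ext {v \<in> V. p v \<in> J} (\<lambda>x y. p x \<noteq> p y) K) = (\<Sum>j\<in>J - p ` K. card (part V p j))"
    and "card (J - p ` K) = card J - s"
proof -
  have "ext {v \<in> V. p v \<in> J} (\<lambda>x y. p x \<noteq> p y) K = (\<Union>j\<in>J - p ` K. part V p j)"
    by (auto simp: ext_def part_def)
  also have "card \<dots> = (\<Sum>j\<in>J - p ` K. card (part V p j))"
    by (rule card_UN_disjoint) (use assms in \<open>auto simp: part_def\<close>)
  finally show "card (ext {v \<in> V. p v \<in> J} (\<lambda>x y. p x \<noteq> p y) K) = (\<Sum>j\<in>J - p ` K. card (part V p j))" .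
  have "card (p ` K) = s" "p ` K \<subseteq> J" using K by (auto simp: transversals_iff card_image)
  then show "card (J - p ` K) = card J - s" using assms(2)
    by (simp add: card_Diff_subset finite_subset)
qed

lemma sum_transversals:
  assumes "finite V" "finite J"
  shows "Suc s * card (transversals V p J (Suc s)) = (\<Sum>K\<in>transversals V p J s. \<Sum>j\<in>J - p ` K. card (part V p j))"
proof -
  interpret fgraph "{v \<in> V. p v \<in> J}" "\<lambda>x y. p x \<noteq> p y"
    by (rule fgraph_multipartite) (use assms in simp)
  show ?thesis
    using sum_card_ext[of s] card_ext_transversals(1)[OF assms]
    by (simp add: transversals_def)
qed

text \<open>The number of transversals is the s-th elementary symmetric polynomial in the part
  sizes. In the induction every s-transversal leaves exactly \<open>card J - s\<close> parts
  free.\<close>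

lemma card_transversals_ge:
  assumes "finite V" "finite J" "\<alpha> \<ge> 0" "\<And>j. j \<in> J \<Longrightarrow> \<alpha> \<le> real (card (part V p j))"
  shows "real (card J choose s) * \<alpha> ^ s \<le> real (card (transversals V p J s))"
proof (induction s)
  case 0
  have "finite {v \<in> V. p v \<in> J}" using assms by simp
  then show ?case by (simp add: transversals_def clq_0)
next
  case (Suc s)
  have "real (Suc s) * (real (card J choose Suc s) * \<alpha> ^ Suc s) = real (Suc s * (card J choose Suc s)) * \<alpha> ^ Suc s"
    by (simp only: of_nat_mult mult.assoc)
  also have "\<dots> = real (card J - s) * \<alpha> * (real (card J choose s) * \<alpha> ^ s)"
    unfolding binomial_Suc_mult by simp
  also have "\<dots> \<le> real (card J - s) * \<alpha> * real (card (transversals V p J s))"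
    using Suc assms(3) by (intro mult_left_mono) auto
  also have "\<dots> = (\<Sum>K\<in>transversals V p J s. real (card J - s) * \<alpha>)" by simp
  also have "\<dots> \<le> (\<Sum>K\<in>transversals V p J s. \<Sum>j\<in>J - p ` K. real (card (part V p j)))"
  proof (rule sum_mono)
    fix K assume K: "K \<in> transversals V p J s"
    have "real (card J - s) * \<alpha> = (\<Sum>j\<in>J - p ` K. \<alpha>)"
      using card_ext_transversals(2)[OF assms(1,2) K] by simp
    also have "\<dots> \<le> (\<Sum>j\<in>J - p ` K. real (card (part V p j)))" by (intro sum_mono assms(4)) auto
    finally show "real (card J - s) * \<alpha> \<le> (\<Sum>j\<in>J - p ` K. real (card (part V p j)))" .
  qed
  also have "\<dots> = real (Suc s * card (transversals V p J (Suc s)))"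
    by (simp add: sum_transversals[OF assms(1,2)] del: mult_Suc)
  finally show ?case by (simp only: of_nat_mult mult_le_cancel_left_pos of_nat_0_less_iff zero_less_Suc)
qed

lemma card_transversals_le:
  assumes "finite V" "finite J" "\<beta> \<ge> 0" "\<And>j. j \<in> J \<Longrightarrow> real (card (part V p j)) \<le> \<beta>"
  shows "real (card (transversals V p J s)) \<le> real (card J choose s) * \<beta> ^ s"
proof (induction s)
  case 0
  have "finite {v \<in> V. p v \<in> J}" using assms by simp
  then show ?case by (simp add: transversals_def clq_0)
next
  case (Suc s)
  have "real (Suc s * card (transversals V p J (Suc s))) = (\<Sum>K\<in>transversals V p J s. \<Sum>j\<in>J - p ` K. real (card (part V p j)))"
    by (simp add: sum_transversals[OF assms(1,2)] del: mult_Suc)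
  also have "\<dots> \<le> (\<Sum>K\<in>transversals V p J s. real (card J - s) * \<beta>)"
  proof (rule sum_mono)
    fix K assume K: "K \<in> transversals V p J s"
    have "(\<Sum>j\<in>J - p ` K. real (card (part V p j))) \<le> (\<Sum>j\<in>J - p ` K. \<beta>)" by (intro sum_mono assms(4)) auto
    also have "\<dots> = real (card J - s) * \<beta>"
      using card_ext_transversals(2)[OF assms(1,2) K] by simp
    finally show "(\<Sum>j\<in>J - p ` K. real (card (part V p j))) \<le> real (card J - s) * \<beta>" .
  qed
  also have "\<dots> = real (card J - s) * \<beta> * real (card (transversals V p J s))" by simp
  also have "\<dots> \<le> real (card J - s) * \<beta> * (real (card J choose s) * \<beta> ^ s)"
    using Suc assms(3) by (intro mult_left_mono) auto
  also have "\<dots> = real (Suc s * (card J choose Suc s)) * \<beta> ^ Suc s"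
    unfolding binomial_Suc_mult by simp
  also have "\<dots> = real (Suc s) * (real (card J choose Suc s) * \<beta> ^ Suc s)"
    by (simp only: of_nat_mult mult.assoc)
  finally show ?case by (simp only: of_nat_mult mult_le_cancel_left_pos of_nat_0_less_iff zero_less_Suc)
qed

lemma binomial_le_power: "n choose s \<le> n ^ s"
  by (cases "s \<le> n") (auto simp: binomial_le_pow binomial_eq_0)

section \<open>Counting sets through given vertices or pairs, and common links\<close>

lemma card_sets_hitting:
  assumes "finite V" "D \<subseteq> V"
  shows "card {K. K \<subseteq> V \<and> card K = s \<and> K \<inter> D \<noteq> {}} \<le> card D * card V ^ (s - 1)"
proof (cases s)
  case 0
  have "K = {}" if "K \<subseteq> V" "card K = 0" for K
    using that finite_subset[OF that(1) assms(1)] by simp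
  then have "{K. K \<subseteq> V \<and> card K = s \<and> K \<inter> D \<noteq> {}} = {}" using 0 by blast
  then show ?thesis by (simp only: card.empty)
next
  case (Suc t)
  let ?P = "{L. L \<subseteq> V \<and> card L = t}"
  have finD: "finite D" using assms finite_subset by blast
  have "{K. K \<subseteq> V \<and> card K = s \<and> K \<inter> D \<noteq> {}} \<subseteq> (\<Union>x\<in>D. insert x ` ?P)"
  proof
    fix K assume K: "K \<in> {K. K \<subseteq> V \<and> card K = s \<and> K \<inter> D \<noteq> {}}"
    then obtain x where x: "x \<in> K" "x \<in> D" by auto
    have "K - {x} \<in> ?P" using K x Suc by auto
    moreover have "K = insert x (K - {x})" using x by auto
    ultimately show "K \<in> (\<Union>x\<in>D. insert x ` ?P)" using x(2) by blast
  qed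
  then have "card {K. K \<subseteq> V \<and> card K = s \<and> K \<inter> D \<noteq> {}} \<le> card (\<Union>x\<in>D. insert x ` ?P)"
    by (intro card_mono) (use assms finD in auto)
  also have "\<dots> \<le> (\<Sum>x\<in>D. card (insert x ` ?P))" by (rule card_UN_le[OF finD])
  also have "\<dots> \<le> (\<Sum>x\<in>D. card V ^ t)"
  proof (rule sum_mono)
    fix x
    have "card (insert x ` ?P) \<le> card ?P" by (rule card_image_le) (use assms in auto)
    also have "\<dots> \<le> card V ^ t" using n_subsets[OF assms(1)] binomial_le_power by simp
    finally show "card (insert x ` ?P) \<le> card V ^ t" .
  qed
  finally show ?thesis using Suc by simp
qed

lemma card_sets_bad_pair:
  assumes "finite V" "R \<subseteq> V \<times> V" "real (card R) \<le> \<theta> * (real (card V))\<^sup>2" "card V > 0"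
  shows "real (card {K. K \<subseteq> V \<and> card K = s \<and> (\<exists>x\<in>K. \<exists>y\<in>K. x \<noteq> y \<and> (x, y) \<in> R)}) \<le> \<theta> * real (card V) ^ s"
    (is "real (card ?B) \<le> _")
\<comment> \<open>For s < 2 there are no such sets, and the bound then amounts to \<theta> \<ge> 0,
  which follows from the bound on \<open>card R\<close>.\<close>
proof (cases "?B = {}")
  case True
  have "0 \<le> \<theta> * (real (card V))\<^sup>2" using assms(3) of_nat_0_le_iff[of "card R"] by linarith
  then have "0 \<le> \<theta>" using assms(4) by (simp add: zero_le_mult_iff)
  then show ?thesis unfolding True by simp
next
  case False
  then obtain K0 x0 y0 where K0: "K0 \<subseteq> V" "card K0 = s" "x0 \<in> K0" "y0 \<in> K0" "x0 \<noteq> y0" by auto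
  have "card {x0, y0} \<le> card K0"
    by (rule card_mono) (use K0 assms(1) in \<open>auto intro: finite_subset\<close>)
  then have "s \<ge> 2" using K0 by simp
  then obtain t where t: "s = t + 2" using le_Suc_ex[of 2 s] by (auto simp: add.commute)
  let ?P = "{L. L \<subseteq> V \<and> card L = t}"
  have finR: "finite R" using assms finite_subset by (metis finite_cartesian_product)
  have "?B \<subseteq> (\<Union>(x, y)\<in>R. (\<lambda>L. insert x (insert y L)) ` ?P)"
  proof
    fix K assume "K \<in> ?B"
    then obtain x y where x: "K \<subseteq> V" "card K = s" "x \<in> K" "y \<in> K" "x \<noteq> y" "(x, y) \<in> R" by auto
    have "finite K" using x assms finite_subset by blast
    then have "K - {x, y} \<in> ?P" using x t by (auto simp: card_Diff_subset)
    moreover have "K = insert x (insert y (K - {x, y}))" using x by auto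
    ultimately have "K \<in> (\<lambda>L. insert x (insert y L)) ` ?P" by (rule image_eqI[rotated])
    then show "K \<in> (\<Union>(x, y)\<in>R. (\<lambda>L. insert x (insert y L)) ` ?P)" using x(6) by (intro UN_I[of "(x, y)"]) auto
  qed
  then have "card ?B \<le> card (\<Union>(x, y)\<in>R. (\<lambda>L. insert x (insert y L)) ` ?P)"
    by (intro card_mono) (use assms finR in auto)
  also have "\<dots> \<le> (\<Sum>z\<in>R. card (case z of (x, y) \<Rightarrow> (\<lambda>L. insert x (insert y L)) ` ?P))" by (rule card_UN_le[OF finR])
  also have "\<dots> \<le> (\<Sum>z\<in>R. card V ^ t)"
  proof (rule sum_mono)
    fix z
    have "card (case z of (x, y) \<Rightarrow> (\<lambda>L. insert x (insert y L)) ` ?P) \<le> card ?P"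
      by (cases z) (use assms in \<open>auto intro: card_image_le\<close>)
    also have "\<dots> \<le> card V ^ t" using n_subsets[OF assms(1)] binomial_le_power by simp
    finally show "card (case z of (x, y) \<Rightarrow> (\<lambda>L. insert x (insert y L)) ` ?P) \<le> card V ^ t" .
  qed
  finally have "card ?B \<le> card R * card V ^ t" by simp
  then have "real (card ?B) \<le> real (card R * card V ^ t)" by (simp only: of_nat_le_iff)
  also have "\<dots> = real (card R) * real (card V) ^ t" by simp
  also have "\<dots> \<le> \<theta> * (real (card V))\<^sup>2 * real (card V) ^ t" by (intro mult_right_mono assms) simp
  finally show ?thesis by (simp add: t power_add mult_ac power2_eq_square)
qed

text \<open>\<open>H\<close> is the set of blue k-cliques or of hyperedges, and \<open>u\<close> is
  the vertex to be replaced. With \<open>m\<close> large enough, some member of \<open>W\<close>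
  lies outside any given copy of \<open>F\<close> and can stand in for \<open>u\<close>.\<close>

definition common_link :: "'a set \<Rightarrow> 'a set set \<Rightarrow> nat \<Rightarrow> nat \<Rightarrow> 'a \<Rightarrow> 'a set \<Rightarrow> 'a set set \<Rightarrow> bool" where
  "common_link V H m k u W \<L> \<longleftrightarrow> W \<subseteq> V - {u} \<and> card W = m \<and>
     (\<forall>K\<in>\<L>. K \<subseteq> V - {u} \<and> card K = k - 1 \<and> K \<inter> W = {} \<and> (\<forall>w\<in>W. insert w K \<in> H))"

text \<open>A vertex of part 0 is good if it misses few transversals; any \<open>m\<close> good vertices have
  almost all transversals of the other parts in their common link.\<close>

lemma exists_common_link:
  fixes V :: "'a set"
  assumes fin: "finite V" and k: "k \<ge> 2" and V0: "card V > 0"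
    and miss: "real (card (transversals V p {..<r} k - H)) \<le> \<theta> * real (card V) ^ k"
    and \<eta>: "\<eta> > 0" and big: "real (card (part V p 0)) \<ge> \<theta> / \<eta> * real (card V) + real m + 1"
    and \<alpha>: "\<alpha> \<ge> 0" "\<And>j. j \<in> {1..<r} \<Longrightarrow> \<alpha> \<le> real (card (part V p j))" and r: "r > 0"
    and u: "u \<in> V"
  shows "\<exists>W \<L>. common_link V H m k u W \<L> \<and>
     real (card \<L>) \<ge> real ((r - 1) choose (k - 1)) * \<alpha> ^ (k - 1) - real m * \<eta> * real (card V) ^ (k - 1) - real (card V) ^ (k - 2)"
proof -
  let ?A = "part V p 0" and ?T = "transversals V p {1..<r} (k - 1)" and ?n = "real (card V)"
  define M where "M w = {K \<in> ?T. insert w K \<notin> H}" for w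
  have finA: "finite ?A" using fin by (simp add: part_def)
  have finT: "finite ?T" by (rule finite_transversals[OF fin])
  have finM: "finite (M w)" for w using finT by (simp add: M_def)
  \<comment> \<open>A pair of \<open>w\<close> and a set \<open>K\<close> in \<open>M w\<close>
    yields the missing transversal \<open>insert w K\<close>, from which \<open>w\<close> is
    recovered as its only vertex in part 0.\<close>
  have sumM: "(\<Sum>w\<in>?A. card (M w)) \<le> card (transversals V p {..<r} k - H)"
  proof -
    have "(\<Sum>w\<in>?A. card (M w)) = card (Sigma ?A M)" by (simp add: finA finM)
    also have "\<dots> = card ((\<lambda>(w, K). insert w K) ` Sigma ?A M)"
    proof (rule card_image[symmetric], rule inj_onI)
      fix a b assume a: "a \<in> Sigma ?A M" "b \<in> Sigma ?A M"
        and eq: "(\<lambda>(w, K). insert w K) a = (\<lambda>(w, K). insert w K) b"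
      obtain w K w' K' where ab: "a = (w, K)" "b = (w', K')" by (cases a, cases b) auto
      have K: "p ` K \<subseteq> {1..<r}" "p ` K' \<subseteq> {1..<r}" "p w = 0" "p w' = 0"
        using a ab by (auto simp: M_def transversals_iff part_def)
      have nK: "p x \<noteq> 0" if "x \<in> K \<or> x \<in> K'" for x using K(1,2) that by force
      have eq': "insert w K = insert w' K'" using eq ab by simp
      have "x = w" if "x \<in> insert w K" "p x = 0" for x using nK[of x] that by auto
      then have "{x \<in> insert w K. p x = 0} = {w}" using K(3) by blast
      moreover have "x = w'" if "x \<in> insert w' K'" "p x = 0" for x using nK[of x] that by auto
      then have "{x \<in> insert w' K'. p x = 0} = {w'}" using K(4) by blast
      ultimately have "w = w'" using eq' by auto
      moreover have "w \<notin> K" "w' \<notin> K'" using nK K by auto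
      ultimately show "a = b" using ab eq' by (metis insert_ident)
    qed
    also have "\<dots> \<le> card (transversals V p {..<r} k - H)"
    proof (rule card_mono)
      show "(\<lambda>(w, K). insert w K) ` Sigma ?A M \<subseteq> transversals V p {..<r} k - H"
      proof
        fix S assume "S \<in> (\<lambda>(w, K). insert w K) ` Sigma ?A M"
        then obtain w K where S: "S = insert w K" "w \<in> V" "p w = 0" "K \<in> ?T" "S \<notin> H"
          by (auto simp: M_def part_def)
        have K: "K \<subseteq> V" "card K = k - 1" "inj_on p K" "p ` K \<subseteq> {1..<r}" using S by (auto simp: transversals_iff)
        have w: "p w \<notin> p ` K" using K(4) S(3) by force
        then have "w \<notin> K" by auto
        then have "card S = k" using K k fin S(1) finite_subset[OF K(1) fin] by simp
        moreover have "inj_on p S" using K(3) w S(1) by auto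
        ultimately show "S \<in> transversals V p {..<r} k - H"
          using S K r by (auto simp: transversals_iff)
      qed
    qed (simp add: finite_transversals fin)
    finally show ?thesis .
  qed
  \<comment> \<open>Markov's inequality: few vertices of part 0 can miss more than an \<eta>
    proportion of the possible links.\<close>
  define G where "G = {w \<in> ?A. real (card (M w)) \<le> \<eta> * ?n ^ (k - 1)}"
  have GA: "G \<subseteq> ?A" by (auto simp: G_def)
  have npos: "?n ^ (k - 1) > 0" using V0 by simp
  have "real (card (?A - G)) * (\<eta> * ?n ^ (k - 1)) = (\<Sum>w\<in>?A - G. \<eta> * ?n ^ (k - 1))" by simp
  also have "\<dots> \<le> (\<Sum>w\<in>?A - G. real (card (M w)))" by (intro sum_mono) (auto simp: G_def)
  also have "\<dots> \<le> (\<Sum>w\<in>?A. real (card (M w)))" by (rule sum_mono2) (use finA in auto)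
  also have "\<dots> = real (\<Sum>w\<in>?A. card (M w))" by simp
  also have "\<dots> \<le> real (card (transversals V p {..<r} k - H))" using sumM by (simp only: of_nat_le_iff)
  also have "\<dots> \<le> \<theta> * ?n ^ k" by (rule miss)
  also have "?n ^ k = ?n * ?n ^ (k - 1)" using k by (simp flip: power_Suc)
  finally have "real (card (?A - G)) * \<eta> * ?n ^ (k - 1) \<le> \<theta> * ?n * ?n ^ (k - 1)" by (simp add: mult_ac)
  then have "real (card (?A - G)) * \<eta> \<le> \<theta> * ?n" using npos by (simp only: mult_le_cancel_right_pos)
  then have "real (card (?A - G)) \<le> \<theta> / \<eta> * ?n" using \<eta> by (simp add: field_simps)
  moreover have "card ?A = card (?A - G) + card G"
    using card_Diff_subset[OF finite_subset[OF GA finA] GA] card_mono[OF finA GA] by simp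
  ultimately have "real (card G) \<ge> real m + 1" using big by simp
  then have "card G \<ge> m + 1" by linarith
  \<comment> \<open>The additional 1 in the size of \<open>G\<close> allows for \<open>u\<close>,
    which must stay out of \<open>W\<close>.\<close>
  then have "m \<le> card (G - {u})" using finite_subset[OF GA finA] by (cases "u \<in> G") auto
  then obtain W where W: "W \<subseteq> G - {u}" "card W = m" by (meson obtain_subset_with_card_n)
  define \<L> where "\<L> = ?T - ((\<Union>w\<in>W. M w) \<union> {K. K \<subseteq> V \<and> card K = k - 1 \<and> K \<inter> {u} \<noteq> {}})"
  have finW: "finite W" using W(1) GA finA finite_subset by (metis Diff_subset)
  have "card ((\<Union>w\<in>W. M w) \<union> {K. K \<subseteq> V \<and> card K = k - 1 \<and> K \<inter> {u} \<noteq> {}})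
      \<le> (\<Sum>w\<in>W. card (M w)) + card {u} * card V ^ (k - 1 - 1)"
    by (intro order_trans[OF card_Un_le] add_mono card_UN_le finW card_sets_hitting[OF fin]) (use u in simp)
  then have "real (card ((\<Union>w\<in>W. M w) \<union> {K. K \<subseteq> V \<and> card K = k - 1 \<and> K \<inter> {u} \<noteq> {}}))
      \<le> real ((\<Sum>w\<in>W. card (M w)) + card {u} * card V ^ (k - 1 - 1))" by (simp only: of_nat_le_iff)
  also have "\<dots> = (\<Sum>w\<in>W. real (card (M w))) + ?n ^ (k - 2)" by (simp add: numeral_2_eq_2)
  also have "(\<Sum>w\<in>W. real (card (M w))) \<le> (\<Sum>w\<in>W. \<eta> * ?n ^ (k - 1))"
    by (rule sum_mono) (use W in \<open>auto simp: G_def\<close>)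
  finally have bad: "real (card ((\<Union>w\<in>W. M w) \<union> {K. K \<subseteq> V \<and> card K = k - 1 \<and> K \<inter> {u} \<noteq> {}}))
      \<le> real m * \<eta> * ?n ^ (k - 1) + ?n ^ (k - 2)" using W(2) by simp
  have "card {1..<r} = r - 1" by simp
  then have "real ((r - 1) choose (k - 1)) * \<alpha> ^ (k - 1) \<le> real (card ?T)"
    using card_transversals_ge[OF fin _ \<alpha>, of "{1..<r}" "k - 1"] by simp
  moreover have "card ?T \<le> card \<L> + card ((\<Union>w\<in>W. M w) \<union> {K. K \<subseteq> V \<and> card K = k - 1 \<and> K \<inter> {u} \<noteq> {}})"
  proof -
    have "card ?T \<le> card (\<L> \<union> ((\<Union>w\<in>W. M w) \<union> {K. K \<subseteq> V \<and> card K = k - 1 \<and> K \<inter> {u} \<noteq> {}}))"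
      by (rule card_mono) (use finT finM finW fin in \<open>auto simp: \<L>_def\<close>)
    then show ?thesis using card_Un_le order_trans by blast
  qed
  ultimately have "real (card \<L>) \<ge> real ((r - 1) choose (k - 1)) * \<alpha> ^ (k - 1) - real m * \<eta> * ?n ^ (k - 1) - ?n ^ (k - 2)"
    using bad by linarith
  moreover have "W \<subseteq> V - {u}" using W(1) GA by (auto simp: part_def)
  moreover have "\<forall>K\<in>\<L>. K \<subseteq> V - {u} \<and> card K = k - 1 \<and> K \<inter> W = {} \<and> (\<forall>w\<in>W. insert w K \<in> H)"
  proof
    fix K assume K: "K \<in> \<L>"
    then have T: "K \<subseteq> V" "card K = k - 1" "p ` K \<subseteq> {1..<r}" by (auto simp: \<L>_def transversals_iff)
    have "p x = 0" if "x \<in> W" for x using W GA that by (auto simp: part_def)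
    then have "K \<inter> W = {}" using T(3) by force
    then show "K \<subseteq> V - {u} \<and> card K = k - 1 \<and> K \<inter> W = {} \<and> (\<forall>w\<in>W. insert w K \<in> H)"
      using K T by (auto simp: \<L>_def M_def)
  qed
  ultimately show ?thesis unfolding common_link_def using W(2) by blast
qed

text \<open>Matches the leading coefficient of the number of s-transversals with the Turan density
  required by \<open>stability\<close>.\<close>

lemma fact_choose_prod:
  assumes "s \<le> r" "r > 0"
  shows "fact s * real (r choose s) / real r ^ s = (\<Prod>i<s. 1 - real i / real r)"
  using assms(1)
proof (induction s)
  case (Suc s)
  have "real (Suc s * (r choose Suc s)) = real ((r - s) * (r choose s))" unfolding binomial_Suc_mult ..
  then have e: "real (Suc s) * real (r choose Suc s) = (real r - real s) * real (r choose s)"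
    using Suc.prems by (simp add: of_nat_diff del: of_nat_Suc mult_Suc)
  have "fact (Suc s) * real (r choose Suc s) / real r ^ Suc s
      = fact s * (real (Suc s) * real (r choose Suc s)) / (real r ^ s * real r)" by (simp add: mult_ac)
  also have "\<dots> = (fact s * real (r choose s) / real r ^ s) * (1 - real s / real r)"
    unfolding e using assms(2) by (simp add: field_simps)
  finally show ?case using Suc by simp
qed simp

lemma dens_lower:
  assumes "card V > 0" "k \<le> r" "r > 0"
    and "real (card (clq V E k)) \<ge> (real (r choose k) / real r ^ k - e) * real (card V) ^ k"
  shows "dens V E k \<ge> (\<Prod>i<k. 1 - real i / real r) - fact k * e"
proof -
  have "fact k * ((real (r choose k) / real r ^ k - e) * real (card V) ^ k) / real (card V) ^ k \<le> dens V E k"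
    unfolding dens_def by (intro divide_right_mono mult_left_mono assms) auto
  moreover have "fact k * ((real (r choose k) / real r ^ k - e) * real (card V) ^ k) / real (card V) ^ k
      = fact k * real (r choose k) / real r ^ k - fact k * e"
    using assms(1) by (simp add: right_diff_distrib)
  ultimately show ?thesis using fact_choose_prod[OF assms(2,3)] by simp
qed

text \<open>\<open>H\<close> is only assumed to consist of cliques of \<open>E\<close> up to o(n^k)
  members. For blue-red graphs the two notions agree; for hypergraphs the cliques are those of the
  graph of thick pairs, which is where freeness can be used.\<close>

lemma asymptotic_common_link:
  fixes V :: "'x \<Rightarrow> 'a set" and E :: "'x \<Rightarrow> 'a \<Rightarrow> 'a \<Rightarrow> bool" and H :: "'x \<Rightarrow> 'a set set"
  assumes ev: "\<forall>\<^sub>F x in \<F>. fgraph (V x) (E x)"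
    and n: "filterlim (\<lambda>x. card (V x)) at_top \<F>"
    and k: "2 \<le> k" "k \<le> r"
    and zero: "((\<lambda>x. dens (V x) (E x) (Suc r)) \<longlongrightarrow> 0) \<F>"
    and H: "\<forall>\<^sub>F x in \<F>. H x \<subseteq> {K. K \<subseteq> V x \<and> card K = k}"
    and e: "(e \<longlongrightarrow> 0) \<F>" "(e' \<longlongrightarrow> 0) \<F>"
    and lower: "\<forall>\<^sub>F x in \<F>. real (card (H x)) \<ge> (real (r choose k) / real r ^ k - e x) * real (card (V x)) ^ k"
    and shadow: "\<forall>\<^sub>F x in \<F>. real (card (H x - clq (V x) (E x) k)) \<le> e' x * real (card (V x)) ^ k"
    and \<eta>: "\<eta> > 0"
  shows "\<forall>\<^sub>F x in \<F>. \<forall>u\<in>V x. \<exists>W \<L>. common_link (V x) (H x) m k u W \<L> \<and>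
     real (card \<L>) \<ge> (1 - \<eta>) * real ((r - 1) choose (k - 1)) * (real (card (V x)) / real r) ^ (k - 1)"
proof -
  have r: "r > 0" using k by simp
  have npos: "\<forall>\<^sub>F x in \<F>. 1 \<le> card (V x)" using n unfolding filterlim_at_top by blast
  define e1 where "e1 x = fact k * (e x + e' x)" for x
  have e1: "(e1 \<longlongrightarrow> 0) \<F>"
    unfolding e1_def using tendsto_mult[OF tendsto_const tendsto_add[OF e]] by simp
  have "\<forall>\<^sub>F x in \<F>. dens (V x) (E x) k \<ge> (\<Prod>i<k. 1 - real i / real r) - e1 x"
    using ev npos H lower shadow
  proof eventually_elim
    case (elim x)
    interpret fgraph "V x" "E x" by (rule elim)
    have finH: "finite (H x)" by (rule finite_subset[OF elim(3)]) (use finV in auto)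
    have "card (H x) \<le> card (clq (V x) (E x) k \<union> (H x - clq (V x) (E x) k))"
      by (rule card_mono) (use finH finite_clq finV in auto)
    also have "\<dots> \<le> card (clq (V x) (E x) k) + card (H x - clq (V x) (E x) k)" by (rule card_Un_le)
    finally have "real (card (H x)) \<le> real (card (clq (V x) (E x) k)) + real (card (H x - clq (V x) (E x) k))"
      by linarith
    then have "real (card (clq (V x) (E x) k)) \<ge> (real (r choose k) / real r ^ k - (e x + e' x)) * real (card (V x)) ^ k"
      using elim(4,5) by (simp add: algebra_simps)
    from dens_lower[OF _ k(2) r this] elim(2) show ?case by (simp add: e1_def)
  qed
  from stability[OF ev ev _ n k zero e1 this] obtain \<theta> where \<theta>: "(\<theta> \<longlongrightarrow> 0) \<F>"
    "\<forall>\<^sub>F x in \<F>. \<forall>p. opt_partition (V x) (E x) r p \<longrightarrow>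
       nearly_turan (V x) (E x) (E x) r (\<theta> x) p"
    by blast
  define C where "C = real ((r - 1) choose (k - 1)) / real r ^ (k - 1)"
  have Cpos: "C > 0" using k r by (simp add: C_def)
  \<comment> \<open>Each of the \<open>m\<close> vertices of \<open>W\<close> may spoil a proportion
    \<eta>1 of the links. All together this costs less than half of \<eta>C, and the rest absorbs
    the errors that tend to 0.\<close>
  define \<eta>1 where "\<eta>1 = \<eta> * C / (2 * (real m + 1))"
  have \<eta>1: "\<eta>1 > 0" using \<eta> Cpos by (simp add: \<eta>1_def)
  \<comment> \<open>Bounds the k-transversals outside \<open>H\<close>: the upper bound for all
    transversals, minus the lower bound for \<open>card (H x)\<close>, plus the members of
    \<open>H x\<close> that are not transversals. The last are non-cliques (\<open>e'\<close>) or
    contain an edge inside a part (\<theta>).\<close>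
  define \<theta>2 where "\<theta>2 x = real (r choose k) * ((1 / real r + \<theta> x) ^ k - (1 / real r) ^ k) + e x + (e' x + \<theta> x)" for x
  have "(\<theta>2 \<longlongrightarrow> real (r choose k) * ((1 / real r + 0) ^ k - (1 / real r) ^ k) + 0 + (0 + 0)) \<F>"
    unfolding \<theta>2_def by (intro tendsto_intros \<theta> e)
  then have \<theta>2: "(\<theta>2 \<longlongrightarrow> 0) \<F>" by simp
  have "((\<lambda>x. 1 / real r - \<theta> x - \<theta>2 x / \<eta>1) \<longlongrightarrow> 1 / real r - 0 - 0 / \<eta>1) \<F>"
    by (intro tendsto_intros \<theta> \<theta>2) (use \<eta>1 in auto)
  then have ev1: "\<forall>\<^sub>F x in \<F>. 1 / real r - \<theta> x - \<theta>2 x / \<eta>1 > 1 / (2 * real r)"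
    by (rule order_tendstoD) (use r in \<open>simp add: field_simps\<close>)
  \<comment> \<open>This leaves room for m + 1 further vertices within a share n/(2r) of part
    0.\<close>
  have ev2: "\<forall>\<^sub>F x in \<F>. nat \<lceil>2 * real r * (real m + 1)\<rceil> \<le> card (V x)"
    using n unfolding filterlim_at_top by blast
  have inv: "((\<lambda>x. 1 / real (card (V x))) \<longlongrightarrow> 0) \<F>"
    by (rule tendsto_divide_0[OF tendsto_const])
      (rule filterlim_at_top_imp_at_infinity, rule filterlim_compose[OF filterlim_real_sequentially n])
  have "((\<lambda>x. real ((r - 1) choose (k - 1)) * (1 / real r - \<theta> x) ^ (k - 1) - real m * \<eta>1 - 1 / real (card (V x)))
      \<longlongrightarrow> real ((r - 1) choose (k - 1)) * (1 / real r - 0) ^ (k - 1) - real m * \<eta>1 - 0) \<F>"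
    by (intro tendsto_intros \<theta> inv)
  then have "((\<lambda>x. real ((r - 1) choose (k - 1)) * (1 / real r - \<theta> x) ^ (k - 1) - real m * \<eta>1 - 1 / real (card (V x)))
      \<longlongrightarrow> C - real m * \<eta>1) \<F>" by (simp add: C_def power_divide)
  moreover have "(1 - \<eta>) * C < C - real m * \<eta>1"
  proof -
    have "real m * \<eta>1 = \<eta> * C * (real m / (2 * (real m + 1)))" by (simp add: \<eta>1_def)
    also have "\<dots> < \<eta> * C * 1" using \<eta> Cpos by (intro mult_strict_left_mono) (auto simp: field_simps)
    finally show ?thesis by (simp add: algebra_simps)
  qed
  ultimately have ev3: "\<forall>\<^sub>F x in \<F>. real ((r - 1) choose (k - 1)) * (1 / real r - \<theta> x) ^ (k - 1) - real m * \<eta>1 - 1 / real (card (V x)) > (1 - \<eta>) * C"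
    by (rule order_tendstoD)
  have ev4: "\<forall>\<^sub>F x in \<F>. \<theta> x < 1 / real r"
    by (rule order_tendstoD[OF \<theta>(1)]) (use r in auto)
  show ?thesis
    using ev npos H lower shadow \<theta>(2) ev1 ev2 ev3 ev4
  proof eventually_elim
    case (elim x)
    interpret fgraph "V x" "E x" by (rule elim)
    let ?n = "real (card (V x))"
    have n: "?n > 0" "card (V x) > 0" using elim(2) by auto
    obtain p where p: "opt_partition (V x) (E x) r p" using exists_opt_partition[OF r] by blast
    have ins: "real (card (inside (V x) (E x) p)) \<le> \<theta> x * ?n\<^sup>2"
      and sz: "\<And>i. i < r \<Longrightarrow> \<bar>real (card (part (V x) p i)) - ?n / real r\<bar> \<le> \<theta> x * ?n"
      using elim(6) p by (auto simp: nearly_turan_def)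
    have pr: "p v < r" for v using p by (simp add: opt_partition_def)
    have finH: "finite (H x)" by (rule finite_subset[OF elim(3)]) (use finV in auto)
    let ?T = "transversals (V x) p {..<r} k"
    have finT: "finite ?T" by (rule finite_transversals[OF finV])
    have hi: "real (card (part (V x) p i)) \<le> (1 / real r + \<theta> x) * ?n" if "i < r" for i
      using sz[OF that] by (simp add: algebra_simps abs_le_iff)
    have lo: "(1 / real r - \<theta> x) * ?n \<le> real (card (part (V x) p i))" if "i < r" for i
      using sz[OF that] by (simp add: algebra_simps abs_le_iff)
    have \<theta>nn: "\<theta> x \<ge> 0"
    proof -
      have "0 \<le> \<theta> x * ?n" using sz[OF r] abs_ge_zero order_trans by blast
      then show ?thesis using n by (simp add: zero_le_mult_iff)
    qed
    have T_le: "real (card ?T) \<le> real (r choose k) * ((1 / real r + \<theta> x) * ?n) ^ k"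
      using card_transversals_le[OF finV, of "{..<r}" "(1 / real r + \<theta> x) * ?n" p k] hi \<theta>nn by simp
    let ?bad = "{K. K \<subseteq> V x \<and> card K = k \<and> (\<exists>a\<in>K. \<exists>b\<in>K. a \<noteq> b \<and> (a, b) \<in> inside (V x) (E x) p)}"
    have "H x - ?T \<subseteq> (H x - clq (V x) (E x) k) \<union> ?bad"
    proof
      fix K assume K: "K \<in> H x - ?T"
      have K': "K \<subseteq> V x" "card K = k" using K elim(3) by auto
      then have "\<not> inj_on p K" using K pr by (auto simp: transversals_iff)
      then obtain a b where ab: "a \<in> K" "b \<in> K" "a \<noteq> b" "p a = p b" by (auto simp: inj_on_def)
      show "K \<in> (H x - clq (V x) (E x) k) \<union> ?bad"
      proof (cases "K \<in> clq (V x) (E x) k")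
        case True
        then have "E x a b" using ab by (auto simp: clq_def dest: pairwiseD)
        then have "(a, b) \<in> inside (V x) (E x) p" using ab K' by (auto simp: inside_def)
        then show ?thesis using ab K' by blast
      qed (use K in auto)
    qed
    then have "card (H x - ?T) \<le> card ((H x - clq (V x) (E x) k) \<union> ?bad)"
      by (intro card_mono) (use finH finV in auto)
    also have "\<dots> \<le> card (H x - clq (V x) (E x) k) + card ?bad"
      by (rule card_Un_le)
    finally have "real (card (H x - ?T)) \<le> real (card (H x - clq (V x) (E x) k)) + real (card ?bad)"
      by linarith
    moreover have "real (card ?bad) \<le> \<theta> x * ?n ^ k"
      by (rule card_sets_bad_pair[OF finV _ ins n(2)]) (auto simp: inside_def)
    ultimately have HT: "real (card (H x - ?T)) \<le> (e' x + \<theta> x) * ?n ^ k"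
      using elim(5) by (simp add: algebra_simps)
    have "card (H x) = card (H x \<inter> ?T) + card (H x - ?T)"
      by (metis card_Diff_subset_Int card_Int_Diff finH)
    moreover have "card ?T = card (H x \<inter> ?T) + card (?T - H x)"
      by (metis Int_commute card_Int_Diff finT)
    ultimately have "real (card (?T - H x)) = real (card ?T) - real (card (H x)) + real (card (H x - ?T))" by linarith
    also have "\<dots> \<le> \<theta>2 x * ?n ^ k"
    proof -
      have "real (card ?T) \<le> real (r choose k) * (1 / real r + \<theta> x) ^ k * ?n ^ k"
        using T_le by (simp only: power_mult_distrib mult.assoc)
      moreover have "\<theta>2 x * ?n ^ k = real (r choose k) * (1 / real r + \<theta> x) ^ k * ?n ^ k
          - (real (r choose k) / real r ^ k - e x) * ?n ^ k + (e' x + \<theta> x) * ?n ^ k"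
        by (simp add: \<theta>2_def algebra_simps power_divide)
      ultimately show ?thesis using elim(4) HT by linarith
    qed
    finally have miss: "real (card (?T - H x)) \<le> \<theta>2 x * ?n ^ k" .
    have big: "\<theta>2 x / \<eta>1 * ?n + real m + 1 \<le> real (card (part (V x) p 0))"
    proof -
      have "2 * real r * (real m + 1) \<le> ?n" using elim(8) by linarith
      then have "real m + 1 \<le> 1 / (2 * real r) * ?n" using r by (simp add: field_simps)
      also have "\<dots> \<le> (1 / real r - \<theta> x - \<theta>2 x / \<eta>1) * ?n" using elim(7) by (intro mult_right_mono) auto
      finally have "\<theta>2 x / \<eta>1 * ?n + real m + 1 \<le> (1 / real r - \<theta> x) * ?n" by (simp add: algebra_simps)
      then show ?thesis using lo[OF r] by linarith
    qed
    have n1: "?n ^ (k - 1) = ?n * ?n ^ (k - 2)" using k by (simp flip: power_Suc add: Suc_diff_Suc numeral_2_eq_2)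
    show ?case
    proof
      fix u assume u: "u \<in> V x"
      from exists_common_link[OF finV k(1) n(2) miss \<eta>1 big _ _ r u, of "(1 / real r - \<theta> x) * ?n"] lo elim(10)
      obtain W \<L> where WL: "common_link (V x) (H x) m k u W \<L>"
        and cL: "real (card \<L>) \<ge> real ((r - 1) choose (k - 1)) * ((1 / real r - \<theta> x) * ?n) ^ (k - 1) - real m * \<eta>1 * ?n ^ (k - 1) - ?n ^ (k - 2)"
        by auto
      have "real ((r - 1) choose (k - 1)) * ((1 / real r - \<theta> x) * ?n) ^ (k - 1) - real m * \<eta>1 * ?n ^ (k - 1) - ?n ^ (k - 2)
          = (real ((r - 1) choose (k - 1)) * (1 / real r - \<theta> x) ^ (k - 1) - real m * \<eta>1 - 1 / ?n) * ?n ^ (k - 1)"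
      proof -
        have "1 / ?n * ?n ^ (k - 1) = ?n ^ (k - 2)" using n n1 by simp
        then show ?thesis unfolding power_mult_distrib by (simp only: left_diff_distrib mult.assoc)
      qed
      moreover have "(1 - \<eta>) * C * ?n ^ (k - 1) \<le> (real ((r - 1) choose (k - 1)) * (1 / real r - \<theta> x) ^ (k - 1) - real m * \<eta>1 - 1 / ?n) * ?n ^ (k - 1)"
        using elim(9) by (intro mult_right_mono) auto
      moreover have "(1 - \<eta>) * C * ?n ^ (k - 1) = (1 - \<eta>) * real ((r - 1) choose (k - 1)) * (?n / real r) ^ (k - 1)"
        by (simp add: C_def power_divide)
      ultimately have "(1 - \<eta>) * real ((r - 1) choose (k - 1)) * (?n / real r) ^ (k - 1) \<le> real (card \<L>)"
        using cL by linarith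
      with WL show "\<exists>W \<L>. common_link (V x) (H x) m k u W \<L> \<and>
       real (card \<L>) \<ge> (1 - \<eta>) * real ((r - 1) choose (k - 1)) * (?n / real r) ^ (k - 1)"
        by (intro exI[of _ W] exI[of _ \<L>] conjI)
    qed
  qed
qed

section \<open>Blue-red graphs and Berge hypergraphs\<close>

definition adj :: "('a, 'z) hypergraph_scheme \<Rightarrow> 'a \<Rightarrow> 'a \<Rightarrow> bool" where
  "adj G u v \<longleftrightarrow> {u, v} \<in> edges G"

lemma graph_finite: "is_graph G \<Longrightarrow> finite (verts G)"
  by (simp add: uniform_def is_hypergraph_def)

lemma graph_edge: "is_graph G \<Longrightarrow> {u, v} \<in> edges G \<Longrightarrow> u \<in> verts G \<and> v \<in> verts G \<and> u \<noteq> v"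
  by (auto simp: uniform_def is_hypergraph_def)

lemma graph_edgeE:
  assumes "is_graph G" "e \<in> edges G"
  obtains u v where "e = {u, v}" "u \<noteq> v" "u \<in> verts G" "v \<in> verts G"
proof -
  have "card e = 2" "e \<subseteq> verts G" using assms by (auto simp: uniform_def is_hypergraph_def)
  then show ?thesis using that by (auto simp: card_2_iff)
qed

lemma graph_finite_edges: "is_graph G \<Longrightarrow> finite (edges G)"
  by (auto simp: uniform_def is_hypergraph_def intro: finite_subset[of _ "Pow (verts G)"])

lemma graph_fgraph:
  assumes "is_graph G" shows "fgraph (verts G) (adj G)"
proof
  show "\<not> adj G x x" for x using graph_edge[OF assms, of x x] by (auto simp: adj_def)
qed (use graph_finite[OF assms] in \<open>simp_all add: adj_def insert_commute\<close>)

lemma graph_blue_part: "is_graph G \<Longrightarrow> is_graph (blue_part G)"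
  by (auto simp: uniform_def is_hypergraph_def blue_part_def)

lemma verts_blue_part [simp]: "verts (blue_part G) = verts G" by (simp add: blue_part_def)

lemma adj_blue_part: "adj (blue_part G) u v \<longleftrightarrow> adj G u v \<and> color G {u, v} = Blue"
  by (auto simp: adj_def blue_part_def)

lemma isomorphic_complete_iff:
  "isomorphic (complete_graph k) S \<longleftrightarrow>
     finite (verts S) \<and> card (verts S) = k \<and> edges S = {e. e \<subseteq> verts S \<and> card e = 2}"
proof -
  have img: "(\<lambda>e. f ` e) ` {e. e \<subseteq> {..<k} \<and> card e = 2} = {e. e \<subseteq> A \<and> card e = 2}"
    if f: "bij_betw f {..<k} A" for f :: "nat \<Rightarrow> 'a" and A
  proof (intro equalityI subsetI)
    fix e assume "e \<in> (\<lambda>e. f ` e) ` {e. e \<subseteq> {..<k} \<and> card e = 2}"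
    then obtain d where d: "e = f ` d" "d \<subseteq> {..<k}" "card d = 2" by auto
    then have "inj_on f d" using f by (auto simp: bij_betw_def intro: inj_on_subset)
    then show "e \<in> {e. e \<subseteq> A \<and> card e = 2}" using d f by (auto simp: card_image bij_betw_def)
  next
    fix e assume e: "e \<in> {e. e \<subseteq> A \<and> card e = 2}"
    then obtain d where d: "d \<subseteq> {..<k}" "e = f ` d" using f by (metis bij_betw_def mem_Collect_eq subset_image_iff)
    then have "inj_on f d" using f by (auto simp: bij_betw_def intro: inj_on_subset)
    then have "card d = 2" using d e by (simp add: card_image)
    then show "e \<in> (\<lambda>e. f ` e) ` {e. e \<subseteq> {..<k} \<and> card e = 2}" using d by auto
  qed
  show ?thesis
  proof
    assume "isomorphic (complete_graph k) S"
    then obtain f where f: "bij_betw f {..<k} (verts S)" and e: "edges S = (\<lambda>e. f ` e) ` {e. e \<subseteq> {..<k} \<and> card e = 2}"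
      by (auto simp: isomorphic_def complete_graph_def)
    show "finite (verts S) \<and> card (verts S) = k \<and> edges S = {e. e \<subseteq> verts S \<and> card e = 2}"
      using bij_betw_finite[OF f] bij_betw_same_card[OF f] e img[OF f] by simp
  next
    assume S: "finite (verts S) \<and> card (verts S) = k \<and> edges S = {e. e \<subseteq> verts S \<and> card e = 2}"
    then obtain f where f: "bij_betw f {..<k} (verts S)"
      using ex_bij_betw_nat_finite[of "verts S"] by (auto simp: atLeast0LessThan)
    then show "isomorphic (complete_graph k) S"
      unfolding isomorphic_def using S img[OF f] f by (intro exI[of _ f]) (simp add: complete_graph_def)
  qed
qed

text \<open>A copy of a complete graph is determined by its vertex set, so all counting can be done
  with vertex sets.\<close>

lemma bij_copies_clq:
  assumes "is_graph G"
  shows "bij_betw verts (copies (complete_graph k) G) (clq (verts G) (adj G) k)"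
proof (rule bij_betwI[where g = "\<lambda>K. \<lparr>verts = K, edges = {e. e \<subseteq> K \<and> card e = 2}\<rparr>"])
  show "verts \<in> copies (complete_graph k) G \<rightarrow> clq (verts G) (adj G) k"
  proof
    fix S assume S: "S \<in> copies (complete_graph k) G"
    then have S: "verts S \<subseteq> verts G" "edges S \<subseteq> edges G" "card (verts S) = k" "edges S = {e. e \<subseteq> verts S \<and> card e = 2}"
      by (auto simp: copies_def subhypergraph_def isomorphic_complete_iff)
    have "adj G x y" if "x \<in> verts S" "y \<in> verts S" "x \<noteq> y" for x y
    proof -
      have "{x, y} \<in> edges S" unfolding S(4) using that by simp
      then show ?thesis using S(2) by (auto simp: adj_def)
    qed
    then show "verts S \<in> clq (verts G) (adj G) k" using S by (auto simp: clq_def pairwise_def)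
  qed
  show "(\<lambda>K. \<lparr>verts = K, edges = {e. e \<subseteq> K \<and> card e = 2}\<rparr>) \<in> clq (verts G) (adj G) k \<rightarrow> copies (complete_graph k) G"
  proof
    fix K assume K: "K \<in> clq (verts G) (adj G) k"
    have fin: "finite K" by (rule finite_clq_mem[OF graph_finite[OF assms] K])
    have "e \<in> edges G" if "e \<subseteq> K" "card e = 2" for e
      using that K by (auto simp: card_2_iff clq_def adj_def dest: pairwiseD)
    then show "\<lparr>verts = K, edges = {e. e \<subseteq> K \<and> card e = 2}\<rparr> \<in> copies (complete_graph k) G"
      using K fin by (auto simp: copies_def subhypergraph_def isomorphic_complete_iff is_hypergraph_def clq_def)
  qed
  show "\<lparr>verts = verts S, edges = {e. e \<subseteq> verts S \<and> card e = 2}\<rparr> = S"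
    if "S \<in> copies (complete_graph k) G" for S
    using that by (auto simp: copies_def isomorphic_complete_iff)
qed simp

lemma g_eq:
  assumes "is_graph G"
  shows "g k G = card (clq (verts G) (adj (blue_part G)) k) + card (edges (red_part G))"
  using bij_betw_same_card[OF bij_copies_clq[OF graph_blue_part[OF assms]]]
  by (simp add: g_def num_copies_def)

lemma card_blue_cliques_at:
  assumes "is_graph G"
  shows "card {S \<in> blue_cliques k G. u \<in> verts S} = card {K \<in> clq (verts G) (adj (blue_part G)) k. u \<in> K}"
proof -
  have b: "bij_betw verts (blue_cliques k G) (clq (verts G) (adj (blue_part G)) k)"
    unfolding blue_cliques_def using bij_copies_clq[OF graph_blue_part[OF assms]] by simp
  have "bij_betw verts {S \<in> blue_cliques k G. u \<in> verts S} (verts ` {S \<in> blue_cliques k G. u \<in> verts S})"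
    by (rule bij_betw_imageI[OF inj_on_subset[OF bij_betw_imp_inj_on[OF b]]]) auto
  moreover have "verts ` {S \<in> blue_cliques k G. u \<in> verts S} = {K \<in> clq (verts G) (adj (blue_part G)) k. u \<in> K}"
    using bij_betw_imp_surj_on[OF b] by auto
  ultimately show ?thesis using bij_betw_same_card by fastforce
qed

lemma free_of_iff:
  assumes F: "is_graph F"
  shows "free_of F G \<longleftrightarrow> \<not> emb F (verts G) (adj G)"
proof -
  have "copies F G \<noteq> {} \<longleftrightarrow> emb F (verts G) (adj G)"
  proof
    assume "copies F G \<noteq> {}"
    then obtain S where "S \<in> copies F G" by blast
    then obtain f where S: "verts S \<subseteq> verts G" "edges S \<subseteq> edges G"
      and f: "bij_betw f (verts F) (verts S)" "edges S = (\<lambda>e. f ` e) ` edges F"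
      unfolding copies_def subhypergraph_def isomorphic_def by blast
    have "adj G (f a) (f b)" if "{a, b} \<in> edges F" for a b
    proof -
      have "f ` {a, b} \<in> edges S" unfolding f(2) using that by (rule imageI)
      then show ?thesis using S(2) by (auto simp: adj_def)
    qed
    then show "emb F (verts G) (adj G)" using S(1) f(1) unfolding emb_def bij_betw_def by (intro exI[of _ f]) simp
  next
    assume "emb F (verts G) (adj G)"
    then obtain f where f: "inj_on f (verts F)" "f ` verts F \<subseteq> verts G"
      "\<And>a b. {a, b} \<in> edges F \<Longrightarrow> adj G (f a) (f b)" by (auto simp: emb_def)
    define S where "S = \<lparr>verts = f ` verts F, edges = (\<lambda>e. f ` e) ` edges F\<rparr>"
    have "edges S \<subseteq> edges G"
    proof
      fix e assume "e \<in> edges S"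
      then obtain d where d: "d \<in> edges F" "e = f ` d" by (auto simp: S_def)
      obtain a b where "d = {a, b}" using graph_edgeE[OF F d(1)] by metis
      then show "e \<in> edges G" using d f(3)[of a b] by (simp add: adj_def)
    qed
    moreover have "is_hypergraph S" using F by (auto simp: S_def is_hypergraph_def uniform_def)
    moreover have "isomorphic F S" using f(1) by (auto simp: isomorphic_def S_def bij_betw_def)
    ultimately have "S \<in> copies F G" using f(2) by (auto simp: copies_def subhypergraph_def S_def)
    then show "copies F G \<noteq> {}" by blast
  qed
  then show ?thesis by (auto simp: free_of_def)
qed

lemma emb_mono:
  assumes "emb F V E" "\<And>x y. E x y \<Longrightarrow> E' x y"
  shows "emb F V E'"
proof -
  obtain f where "inj_on f (verts F)" "f ` verts F \<subseteq> V" "\<And>a b. {a, b} \<in> edges F \<Longrightarrow> E (f a) (f b)"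
    using assms(1) by (auto simp: emb_def)
  then show ?thesis using assms(2) unfolding emb_def by (intro exI[of _ f]) simp
qed

lemma emb_colored:
  assumes "emb F V E" "is_graph F" "\<And>x y. E x y \<Longrightarrow> p x \<noteq> p y" "\<And>x. p x < r"
  shows "\<exists>c. proper_coloring F r c"
proof -
  obtain f where "\<And>a b. {a, b} \<in> edges F \<Longrightarrow> E (f a) (f b)" using assms(1) by (auto simp: emb_def)
  then have "proper_coloring F r (p \<circ> f)" using assms(3,4) by (auto simp: proper_coloring_def)
  then show ?thesis by blast
qed

lemma exists_proper_coloring:
  assumes "is_graph F" shows "\<exists>m c. proper_coloring F m c"
proof -
  obtain c :: "'a \<Rightarrow> nat" and n where c: "c ` verts F = {i. i < n}" "inj_on c (verts F)"
    using finite_imp_inj_to_nat_seg[OF graph_finite[OF assms]] by auto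
  have "proper_coloring F n c"
    using c by (auto simp: proper_coloring_def inj_on_def dest: graph_edge[OF assms])
  then show ?thesis by blast
qed

lemma chromatic_coloring:
  assumes "is_graph F" shows "\<exists>c. proper_coloring F (chromatic_number F) c"
  unfolding chromatic_number_def by (rule LeastI_ex) (rule exists_proper_coloring[OF assms])

lemma less_chromatic: "s < chromatic_number F \<Longrightarrow> \<not> proper_coloring F s c"
  unfolding chromatic_number_def by (drule not_less_Least) blast

section \<open>Lower bounds from the Turan construction, and cloning\<close>

lemma card_part_mod:
  assumes "i < r" shows "real n / real r - 1 \<le> real (card (part {..<n} (\<lambda>v. v mod r) i))"
proof -
  have "card ((\<lambda>t. i + r * t) ` {..<n div r}) \<le> card (part {..<n} (\<lambda>v. v mod r) i)"
  proof (rule card_mono)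
    show "(\<lambda>t. i + r * t) ` {..<n div r} \<subseteq> part {..<n} (\<lambda>v. v mod r) i"
    proof
      fix v assume "v \<in> (\<lambda>t. i + r * t) ` {..<n div r}"
      then obtain t where t: "v = i + r * t" "t < n div r" by auto
      have "i + r * t < r + r * t" using assms by simp
      also have "\<dots> = r * Suc t" by simp
      also have "\<dots> \<le> r * (n div r)" using t by (intro mult_left_mono) auto
      also have "\<dots> \<le> n" by simp
      finally show "v \<in> part {..<n} (\<lambda>v. v mod r) i" using t assms by (simp add: part_def)
    qed
  qed (simp add: part_def)
  moreover have "card ((\<lambda>t. i + r * t) ` {..<n div r}) = n div r"
    using assms by (subst card_image) (auto simp: inj_on_def)
  moreover have "real n / real r - 1 \<le> real (n div r)"
  proof -
    have "real n / real r < real (n div r) + 1" using assms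
      by (metis floor_divide_of_nat_eq floor_less_iff less_add_one of_int_of_nat_eq linorder_not_less le_floor_iff real_of_int_floor_add_one_gt)
    then show ?thesis by simp
  qed
  ultimately show ?thesis by linarith
qed

lemma card_transversals_mod:
  assumes "r > 0" "n \<ge> r"
  shows "real (r choose k) * (real n / real r - 1) ^ k \<le> real (card (transversals {..<n} (\<lambda>v. v mod r) {..<r} k))"
proof -
  have "0 \<le> real n / real r - 1" using assms by (simp add: field_simps)
  from card_transversals_ge[OF _ _ this, of "{..<n}" "{..<r}" "\<lambda>v. v mod r" k] show ?thesis
    using card_part_mod by simp
qed

lemma Max_image_ge: "finite (f ` A) \<Longrightarrow> a \<in> A \<Longrightarrow> f a \<le> Max (f ` A)"
  by (rule Max_ge) auto

text \<open>The witness is the complete r-partite graph on residue classes modulo \<open>r\<close>,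
  entirely blue. An embedding of \<open>F\<close> would colour it with \<open>r\<close>
  colours.\<close>

lemma ex_col_ge:
  assumes F: "is_graph F" and r: "r < chromatic_number F" "r > 0" "n \<ge> r"
  shows "real (r choose k) * (real n / real r - 1) ^ k \<le> real (ex_col k n F)"
proof -
  define G :: "nat blue_red_graph" where
    "G = \<lparr>verts = {..<n}, edges = {{u, v} | u v. u < n \<and> v < n \<and> u mod r \<noteq> v mod r}, color = (\<lambda>_. Blue)\<rparr>"
  have G: "is_graph G" by (auto simp: G_def uniform_def is_hypergraph_def card_insert_if)
  have adjG: "adj (blue_part G) u v \<longleftrightarrow> u < n \<and> v < n \<and> u mod r \<noteq> v mod r" for u v
    by (auto simp: adj_def blue_part_def G_def doubleton_eq_iff)
  have adjG': "adj G u v \<Longrightarrow> u mod r \<noteq> v mod r" for u v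
    by (auto simp: adj_def G_def doubleton_eq_iff)
  have "free_of F G"
    unfolding free_of_iff[OF F]
  proof
    assume "emb F (verts G) (adj G)"
    from emb_colored[OF this F, of "\<lambda>v. v mod r" r] adjG' r(2) obtain c where "proper_coloring F r c" by auto
    then show False using less_chromatic[OF r(1)] by blast
  qed
  then have mem: "G \<in> free_blue_red_graphs n F" using G by (simp add: free_blue_red_graphs_def G_def)
  have "transversals {..<n} (\<lambda>v. v mod r) {..<r} k \<subseteq> clq (verts G) (adj (blue_part G)) k"
  proof
    fix K assume "K \<in> transversals {..<n} (\<lambda>v. v mod r) {..<r} k"
    then have K: "K \<subseteq> {..<n}" "card K = k" "inj_on (\<lambda>v. v mod r) K" by (auto simp: transversals_iff)
    have "pairwise (adj (blue_part G)) K"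
      unfolding pairwise_def adjG using K by (auto simp: inj_on_def)
    then show "K \<in> clq (verts G) (adj (blue_part G)) k" using K by (simp add: clq_def G_def)
  qed
  then have "card (transversals {..<n} (\<lambda>v. v mod r) {..<r} k) \<le> card (clq (verts G) (adj (blue_part G)) k)"
    by (intro card_mono finite_clq) (simp_all add: G_def)
  also have "\<dots> \<le> g k G" by (simp add: g_eq[OF G])
  also have "\<dots> \<le> ex_col k n F"
    unfolding ex_col_def by (rule Max_image_ge[OF ex_col_values_finite mem])
  finally show ?thesis using card_transversals_mod[OF r(2,3), of k] by linarith
qed

text \<open>Replacing \<open>u\<close> by a copy of the vertices in \<open>W\<close> creates no copy of \<open>F\<close>, because one of them
  is not used by the copy.\<close>

lemma clone_col:
  assumes F: "is_graph F" and G: "G \<in> free_blue_red_graphs n F" "g k G = ex_col k n F"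
    and u: "u \<in> verts G"
    and link: "common_link (verts G) (clq (verts G) (adj (blue_part G)) k) (Suc (card (verts F))) k u W \<L>"
    and k: "k > 0"
  shows "card \<L> \<le> card {S \<in> blue_cliques k G. u \<in> verts S} + card {e \<in> edges (red_part G). u \<in> e}"
proof -
  have W: "W \<subseteq> verts G - {u}" "card W = Suc (card (verts F))"
    and L: "\<And>K. K \<in> \<L> \<Longrightarrow> K \<subseteq> verts G - {u} \<and> card K = k - 1 \<and> K \<inter> W = {} \<and>
      (\<forall>w\<in>W. insert w K \<in> clq (verts G) (adj (blue_part G)) k)"
    using link by (auto simp: common_link_def)
  have gr: "is_graph G" and cn: "card (verts G) = n" and fr: "free_of F G"
    using G(1) by (auto simp: free_blue_red_graphs_def)
  have finV: "finite (verts G)" by (rule graph_finite[OF gr])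
  define Z where "Z = \<Union> \<L>"
  \<comment> \<open>All old edges at \<open>u\<close> are dropped, and \<open>u\<close> is joined in
    blue to every vertex of the common link. Each such vertex is blue-adjacent to all of
    \<open>W\<close>.\<close>
  define G' :: "nat blue_red_graph" where
    "G' = \<lparr>verts = verts G, edges = {e \<in> edges G. u \<notin> e} \<union> (\<lambda>z. {u, z}) ` Z,
      color = (\<lambda>e. if u \<in> e then Blue else color G e)\<rparr>"
  have ZV: "Z \<subseteq> verts G - {u}" using L by (auto simp: Z_def)
  have gr': "is_graph G'"
    unfolding uniform_def is_hypergraph_def
  proof (intro conjI ballI)
    show "finite (verts G')" using finV by (simp add: G'_def)
    show "edges G' \<subseteq> Pow (verts G')" using gr ZV u by (auto simp: G'_def uniform_def is_hypergraph_def)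
    fix e assume "e \<in> edges G'"
    then consider "e \<in> edges G" | z where "z \<in> Z" "e = {u, z}" by (auto simp: G'_def)
    then show "card e = 2"
    proof cases
      case 1
      then show ?thesis using gr by (simp add: uniform_def)
    next
      case 2
      then have "u \<noteq> z" using ZV by auto
      then show ?thesis using 2 by simp
    qed
  qed
  have adj1: "adj G' a b \<longleftrightarrow> adj G a b" if "a \<noteq> u" "b \<noteq> u" for a b
    using that by (auto simp: adj_def G'_def doubleton_eq_iff)
  have adj2: "adj G' u b \<longleftrightarrow> b \<in> Z" for b
    using ZV by (auto simp: adj_def G'_def doubleton_eq_iff)
  have col: "color G' {a, b} = (if a = u \<or> b = u then Blue else color G {a, b})" for a b
    by (auto simp: G'_def)
  have ZW: "adj (blue_part G) w z" if zw: "z \<in> Z" "w \<in> W" for z w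
  proof -
    obtain K where K: "K \<in> \<L>" "z \<in> K" using zw by (auto simp: Z_def)
    have "w \<noteq> z" using L[OF K(1)] K(2) zw by auto
    moreover have "pairwise (adj (blue_part G)) (insert w K)" using L[OF K(1)] zw by (auto simp: clq_def)
    ultimately show ?thesis using K(2) by (auto dest: pairwiseD)
  qed
  have "free_of F G'"
    unfolding free_of_iff[OF F]
  proof
    assume "emb F (verts G') (adj G')"
    then obtain f where f: "inj_on f (verts F)" "f ` verts F \<subseteq> verts G"
      "\<And>a b. {a, b} \<in> edges F \<Longrightarrow> adj G' (f a) (f b)" by (auto simp: emb_def G'_def)
    have "card (f ` verts F) \<le> card (verts F)" by (rule card_image_le[OF graph_finite[OF F]])
    then have "\<not> W \<subseteq> f ` verts F"
      using card_mono[of "f ` verts F" W] graph_finite[OF F] W(2) by auto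
    then obtain w where w: "w \<in> W" "w \<notin> f ` verts F" by auto
    define h where "h a = (if f a = u then w else f a)" for a
    have "inj_on h (verts F)" using f(1) w(2) by (auto simp: inj_on_def h_def)
    moreover have "h ` verts F \<subseteq> verts G" using f(2) w(1) W(1) by (auto simp: h_def)
    moreover have "adj G (h a) (h b)" if "{a, b} \<in> edges F" for a b
    proof -
      have ab: "a \<in> verts F" "b \<in> verts F" "a \<noteq> b" using graph_edge[OF F that] by auto
      then have ne: "f a \<noteq> f b" using f(1) by (auto simp: inj_on_def)
      have e: "adj G' (f a) (f b)" by (rule f(3)[OF that])
      then have e': "adj G' (f b) (f a)" by (simp add: adj_def insert_commute)
      consider "f a = u" | "f b = u" "f a \<noteq> u" | "f a \<noteq> u" "f b \<noteq> u" by blast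
      then show ?thesis
      proof cases
        case 1
        then have "adj (blue_part G) w (f b)" using e adj2 w ZW by auto
        then show ?thesis using 1 ne by (auto simp: h_def adj_blue_part)
      next
        case 2
        then have "adj (blue_part G) w (f a)" using e' adj2 w ZW by auto
        then have "adj G w (f a)" by (simp add: adj_blue_part)
        then have "adj G (f a) w" by (simp add: adj_def insert_commute)
        then show ?thesis using 2 by (simp add: h_def)
      next
        case 3
        then show ?thesis using e adj1 by (auto simp: h_def)
      qed
    qed
    ultimately have "emb F (verts G) (adj G)" by (auto simp: emb_def)
    then show False using fr free_of_iff[OF F] by blast
  qed
  then have "G' \<in> free_blue_red_graphs n F" using gr' cn by (simp add: free_blue_red_graphs_def G'_def)
  then have le: "g k G' \<le> g k G"
    unfolding G(2) ex_col_def by (rule Max_image_ge[OF ex_col_values_finite])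
  let ?C = "clq (verts G) (adj (blue_part G)) k"
  have finC: "finite ?C" by (rule finite_clq[OF finV])
  \<comment> \<open>A set \<open>K\<close> in \<L> is recognised as a blue clique as part of some
    \<open>insert w K\<close>, which takes a \<open>w\<close> in \<open>W\<close>.\<close>
  have W0: "W \<noteq> {}" using W(2) by auto
  have adjb1: "adj (blue_part G') a b \<longleftrightarrow> adj (blue_part G) a b" if "a \<noteq> u" "b \<noteq> u" for a b
    using adj1[OF that] col[of a b] that by (auto simp: adj_blue_part)
  have adjb2: "adj (blue_part G') u b" "adj (blue_part G') b u" if "b \<in> Z" for b
  proof -
    show "adj (blue_part G') u b" using adj2[of b] col[of u b] that by (auto simp: adj_blue_part)
    then show "adj (blue_part G') b u" by (simp add: adj_def insert_commute)
  qed
  have sub: "{K \<in> ?C. u \<notin> K} \<union> insert u ` \<L> \<subseteq> clq (verts G') (adj (blue_part G')) k"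
  proof (intro Un_least subsetI)
    fix K assume K: "K \<in> {K \<in> ?C. u \<notin> K}"
    have "pairwise (adj (blue_part G')) K"
      unfolding pairwise_def
    proof (intro ballI impI)
      fix x y assume "x \<in> K" "y \<in> K" "x \<noteq> y"
      then show "adj (blue_part G') x y" using adjb1[of x y] K by (auto simp: clq_def dest: pairwiseD)
    qed
    moreover have "verts G' = verts G" by (simp add: G'_def)
    ultimately show "K \<in> clq (verts G') (adj (blue_part G')) k" using K by (simp add: clq_def)
  next
    fix S assume "S \<in> insert u ` \<L>"
    then obtain K where K: "S = insert u K" "K \<in> \<L>" by auto
    have KZ: "K \<subseteq> Z" using K by (auto simp: Z_def)
    obtain w where w: "w \<in> W" using W0 by auto
    have "insert w K \<in> ?C" using L[OF K(2)] w by blast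
    then have pw: "pairwise (adj (blue_part G)) K" unfolding clq_def by (auto intro: pairwise_subset)
    have Ku: "u \<notin> K" "K \<subseteq> verts G" "card K = k - 1" using L[OF K(2)] by auto
    have "finite K" using Ku(2) finV finite_subset by blast
    then have "card S = k" using K(1) Ku k by simp
    moreover have "pairwise (adj (blue_part G')) S"
      unfolding K(1) pairwise_insert
    proof (intro conjI allI impI)
      show "pairwise (adj (blue_part G')) K"
        unfolding pairwise_def
      proof (intro ballI impI)
        fix x y assume "x \<in> K" "y \<in> K" "x \<noteq> y"
        then show "adj (blue_part G') x y" using adjb1[of x y] pw Ku(1) by (auto dest: pairwiseD)
      qed
    qed (use adjb2 KZ in auto)
    ultimately show "S \<in> clq (verts G') (adj (blue_part G')) k"
      using K(1) Ku u by (auto simp: clq_def G'_def)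
  qed
  have finL: "finite \<L>" by (rule finite_subset[of _ "Pow (verts G)"]) (use L finV in auto)
  have "card ({K \<in> ?C. u \<notin> K} \<union> insert u ` \<L>) = card {K \<in> ?C. u \<notin> K} + card (insert u ` \<L>)"
    by (rule card_Un_disjoint) (use finC finL in auto)
  also have "card (insert u ` \<L>) = card \<L>"
  proof (rule card_image, rule inj_onI)
    fix K K' assume "K \<in> \<L>" "K' \<in> \<L>" "insert u K = insert u K'"
    moreover have "u \<notin> K" "u \<notin> K'" using L \<open>K \<in> \<L>\<close> \<open>K' \<in> \<L>\<close> by auto
    ultimately show "K = K'" by (metis insert_ident)
  qed
  finally have c1: "card {K \<in> ?C. u \<notin> K} + card \<L> \<le> card (clq (verts G') (adj (blue_part G')) k)"
    using card_mono[OF finite_clq sub] finV by (simp add: G'_def)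
  have "edges (red_part G') = {e \<in> edges (red_part G). u \<notin> e}"
    by (auto simp: red_part_def G'_def)
  then have c2: "card (edges (red_part G')) = card {e \<in> edges (red_part G). u \<notin> e}" by simp
  have finR: "finite (edges (red_part G))" using graph_finite_edges[OF gr] by (simp add: red_part_def)
  have "card ?C = card {K \<in> ?C. u \<in> K} + card {K \<in> ?C. u \<notin> K}"
    using card_Int_Diff[OF finC, of "{K. u \<in> K}"] by (simp add: Int_def set_diff_eq)
  moreover have "card (edges (red_part G)) = card {e \<in> edges (red_part G). u \<in> e} + card {e \<in> edges (red_part G). u \<notin> e}"
    using card_Int_Diff[OF finR, of "{K. u \<in> K}"] by (simp add: Int_def set_diff_eq)
  ultimately show ?thesis
    using le c1 c2 unfolding g_eq[OF gr] g_eq[OF gr'] card_blue_cliques_at[OF gr] by linarith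
qed

section \<open>Berge copies as pairs of injections, and thick pairs\<close>

definition berge_emb :: "'b hypergraph \<Rightarrow> 'a hypergraph \<Rightarrow> ('b \<Rightarrow> 'a) \<Rightarrow> ('b set \<Rightarrow> 'a set) \<Rightarrow> bool" where
  "berge_emb F H f \<psi> \<longleftrightarrow> inj_on f (verts F) \<and> f ` verts F \<subseteq> verts H \<and> inj_on \<psi> (edges F) \<and>
     (\<forall>e\<in>edges F. \<psi> e \<in> edges H \<and> f ` e \<subseteq> \<psi> e)"

text \<open>\<open>\<psi>\<close> is the bijection of \<open>is_berge\<close> read backwards: it
  assigns to each edge of \<open>F\<close> a hyperedge containing its image, so that only
  injectivity has to be tracked.\<close>

lemma berge_free_iff:
  assumes F: "is_graph F" and H: "is_hypergraph H"
  shows "berge_free F H \<longleftrightarrow> \<not> (\<exists>f \<psi>. berge_emb F H f \<psi>)"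
proof -
  have "(\<exists>S F'. subhypergraph S H \<and> is_graph F' \<and> isomorphic F F' \<and> is_berge S F') \<longleftrightarrow> (\<exists>f \<psi>. berge_emb F H f \<psi>)"
  proof
    assume "\<exists>S F'. subhypergraph S H \<and> is_graph F' \<and> isomorphic F F' \<and> is_berge S F'"
    then obtain S F' where SF: "subhypergraph S H" "isomorphic F F'" "is_berge S F'" by blast
    have S: "verts S \<subseteq> verts H" "edges S \<subseteq> edges H" using SF(1) by (auto simp: subhypergraph_def)
    obtain f where f: "bij_betw f (verts F) (verts F')" "edges F' = (\<lambda>e. f ` e) ` edges F"
      using SF(2) unfolding isomorphic_def by blast
    obtain \<phi> where \<phi>: "verts F' \<subseteq> verts S" "bij_betw \<phi> (edges S) (edges F')" "\<And>h. h \<in> edges S \<Longrightarrow> \<phi> h \<subseteq> h"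
      using SF(3) unfolding is_berge_def by blast
    have inj: "inj_on f (verts F)" using f(1) by (simp add: bij_betw_def)
    have injE: "inj_on (\<lambda>e. f ` e) (edges F)"
      using F inj_on_image_Pow[OF inj] by (auto simp: uniform_def is_hypergraph_def intro: inj_on_subset)
    define \<psi> where "\<psi> e = inv_into (edges S) \<phi> (f ` e)" for e
    have im: "f ` e \<in> \<phi> ` edges S" if "e \<in> edges F" for e
      using that \<phi>(2) f(2) by (auto simp: bij_betw_def)
    have mem: "\<psi> e \<in> edges S" "\<phi> (\<psi> e) = f ` e" if "e \<in> edges F" for e
      unfolding \<psi>_def using inv_into_into[OF im[OF that]] f_inv_into_f[OF im[OF that]] by auto
    have "inj_on \<psi> (edges F)"
      using mem(2) injE by (metis inj_on_def)
    moreover have "\<psi> e \<in> edges H \<and> f ` e \<subseteq> \<psi> e" if "e \<in> edges F" for e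
      using mem[OF that] \<phi>(3)[of "\<psi> e"] S(2) by auto
    moreover have "f ` verts F \<subseteq> verts H" using f(1) \<phi>(1) S(1) by (auto simp: bij_betw_def)
    ultimately show "\<exists>f \<psi>. berge_emb F H f \<psi>" using inj unfolding berge_emb_def by blast
  next
    assume "\<exists>f \<psi>. berge_emb F H f \<psi>"
    then obtain f \<psi> where f: "inj_on f (verts F)" "f ` verts F \<subseteq> verts H" and \<psi>: "inj_on \<psi> (edges F)"
      "\<And>e. e \<in> edges F \<Longrightarrow> \<psi> e \<in> edges H \<and> f ` e \<subseteq> \<psi> e" by (auto simp: berge_emb_def)
    have FP: "edges F \<subseteq> Pow (verts F)" using F by (simp add: uniform_def is_hypergraph_def)
    have injE: "inj_on (\<lambda>e. f ` e) (edges F)"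
      using FP inj_on_image_Pow[OF f(1)] by (auto intro: inj_on_subset)
    define S where "S = \<lparr>verts = verts H, edges = \<psi> ` edges F\<rparr>"
    define F' where "F' = \<lparr>verts = f ` verts F, edges = (\<lambda>e. f ` e) ` edges F\<rparr>"
    have "subhypergraph S H" using H \<psi>(2) by (auto simp: subhypergraph_def S_def is_hypergraph_def)
    moreover have "is_graph F'"
    proof -
      have "card (f ` e) = 2" if "e \<in> edges F" for e
        using that F FP f(1) by (subst card_image) (auto simp: uniform_def intro: inj_on_subset)
      then show ?thesis using F by (auto simp: uniform_def is_hypergraph_def F'_def)
    qed
    moreover have "isomorphic F F'" using f(1) by (auto simp: isomorphic_def F'_def bij_betw_def)
    moreover have "is_berge S F'"
    proof -
      let ?\<phi> = "\<lambda>h. f ` (inv_into (edges F) \<psi> h)"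
      have inv: "inv_into (edges F) \<psi> (\<psi> e) = e" if "e \<in> edges F" for e
        using inv_into_f_f[OF \<psi>(1) that] .
      have "bij_betw ?\<phi> (edges S) (edges F')"
        unfolding bij_betw_def
      proof
        show "inj_on ?\<phi> (edges S)" using injE inv by (auto simp: S_def inj_on_def)
        show "?\<phi> ` edges S = edges F'" using inv by (auto simp: S_def F'_def image_image)
      qed
      moreover have "?\<phi> h \<subseteq> h" if h: "h \<in> edges S" for h
      proof -
        obtain e where e: "e \<in> edges F" "h = \<psi> e" using h by (auto simp: S_def)
        then show ?thesis using inv[OF e(1)] \<psi>(2)[OF e(1)] by simp
      qed
      ultimately show ?thesis using f(2) unfolding is_berge_def by (auto simp: S_def F'_def)
    qed
    ultimately show "\<exists>S F'. subhypergraph S H \<and> is_graph F' \<and> isomorphic F F' \<and> is_berge S F'" by blast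
  qed
  then show ?thesis by (simp add: berge_free_def)
qed

text \<open>The hyperedges are the k-transversals of the residue classes modulo \<open>r\<close>. In
  a Berge copy the two ends of every edge lie in one transversal, so the residues would be a proper
  r-colouring of \<open>F\<close>.\<close>

lemma ex_berge_ge:
  assumes F: "is_graph F" and r: "r < chromatic_number F" "r > 0" "n \<ge> r"
  shows "real (r choose k) * (real n / real r - 1) ^ k \<le> real (ex_berge k n F)"
proof -
  let ?p = "\<lambda>v. v mod r"
  define H :: "nat hypergraph" where "H = \<lparr>verts = {..<n}, edges = transversals {..<n} ?p {..<r} k\<rparr>"
  have H: "is_hypergraph H" by (auto simp: H_def is_hypergraph_def transversals_iff)
  have "berge_free F H"
    unfolding berge_free_iff[OF F H]
  proof
    assume "\<exists>f \<psi>. berge_emb F H f \<psi>"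
    then obtain f \<psi> where "berge_emb F H f \<psi>" by blast
    then have f: "inj_on f (verts F)" "\<And>e. e \<in> edges F \<Longrightarrow> \<psi> e \<in> edges H \<and> f ` e \<subseteq> \<psi> e"
      by (auto simp: berge_emb_def)
    have "?p (f a) \<noteq> ?p (f b)" if "{a, b} \<in> edges F" for a b
    proof -
      have "f a \<noteq> f b" using graph_edge[OF F that] f(1) by (auto simp: inj_on_def)
      moreover have "inj_on ?p (\<psi> {a, b})" "f a \<in> \<psi> {a, b}" "f b \<in> \<psi> {a, b}"
        using f(2)[OF that] by (auto simp: H_def transversals_iff)
      ultimately show ?thesis by (auto simp: inj_on_def)
    qed
    then have "proper_coloring F r (\<lambda>v. ?p (f v))" using r by (auto simp: proper_coloring_def)
    then show False using less_chromatic r by blast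
  qed
  then have mem: "H \<in> berge_free_hypergraphs k n F"
    using H by (auto simp: berge_free_hypergraphs_def uniform_def H_def transversals_iff)
  have "card (edges H) \<le> ex_berge k n F"
    unfolding ex_berge_def by (rule Max_image_ge[OF ex_berge_values_finite mem])
  then show ?thesis using card_transversals_mod[OF r(2,3), of k] by (simp add: H_def)
qed

text \<open>A greedy choice: before each step fewer than \<open>card I\<close> elements are
  taken.\<close>

lemma distinct_representatives:
  assumes "finite I" "\<And>i. i \<in> I \<Longrightarrow> finite (S i) \<and> card I \<le> card (S i)"
  shows "\<exists>\<psi>. inj_on \<psi> I \<and> (\<forall>i\<in>I. \<psi> i \<in> S i)"
  using assms
proof (induction I rule: finite_induct)
  case (insert x I)
  have "\<exists>\<psi>. inj_on \<psi> I \<and> (\<forall>i\<in>I. \<psi> i \<in> S i)"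
    by (rule insert.IH) (use insert in fastforce)
  then obtain \<psi> where \<psi>: "inj_on \<psi> I" "\<forall>i\<in>I. \<psi> i \<in> S i" by blast
  have "card (\<psi> ` I) < card (S x)"
    using insert.prems[of x] insert.hyps card_image_le[OF insert.hyps(1), of \<psi>] by simp
  then have "\<not> S x \<subseteq> \<psi> ` I" using card_mono[of "\<psi> ` I" "S x"] insert.hyps by auto
  then obtain y where y: "y \<in> S x" "y \<notin> \<psi> ` I" by blast
  have eq: "(\<psi>(x := y)) ` I = \<psi> ` I" using insert.hyps by auto
  have "inj_on (\<psi>(x := y)) (insert x I)"
    using \<psi>(1) y(2) insert.hyps by (auto simp: inj_on_def)
  moreover have "\<forall>i\<in>insert x I. (\<psi>(x := y)) i \<in> S i" using \<psi>(2) y(1) by auto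
  ultimately show ?case by blast
qed simp

text \<open>For \<open>q = card (edges F)\<close> a copy of \<open>F\<close> in this graph extends
  greedily to a Berge copy, while pairs that are not thick destroy only O(n^2) hyperedges.\<close>

definition thick :: "nat \<Rightarrow> 'a hypergraph \<Rightarrow> 'a \<Rightarrow> 'a \<Rightarrow> bool" where
  "thick q H x y \<longleftrightarrow> x \<noteq> y \<and> q \<le> card {h \<in> edges H. {x, y} \<subseteq> h}"

lemma hypergraph_finite_edges: "is_hypergraph H \<Longrightarrow> finite (edges H)"
  by (auto simp: is_hypergraph_def intro: finite_subset[of _ "Pow (verts H)"])

lemma thick_fgraph: "is_hypergraph H \<Longrightarrow> fgraph (verts H) (thick q H)"
  by unfold_locales (auto simp: thick_def is_hypergraph_def insert_commute)

lemma berge_free_thick: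
  assumes F: "is_graph F" and H: "is_hypergraph H" and free: "berge_free F H"
  shows "\<not> emb F (verts H) (thick (card (edges F)) H)"
proof
  assume "emb F (verts H) (thick (card (edges F)) H)"
  then obtain f where f: "inj_on f (verts F)" "f ` verts F \<subseteq> verts H"
    "\<And>a b. {a, b} \<in> edges F \<Longrightarrow> thick (card (edges F)) H (f a) (f b)" by (auto simp: emb_def)
  have "\<exists>\<psi>. inj_on \<psi> (edges F) \<and> (\<forall>e\<in>edges F. \<psi> e \<in> {h \<in> edges H. f ` e \<subseteq> h})"
  proof (rule distinct_representatives[OF graph_finite_edges[OF F]])
    fix e assume e: "e \<in> edges F"
    obtain a b where ab: "e = {a, b}" using graph_edgeE[OF F e] by metis
    then show "finite {h \<in> edges H. f ` e \<subseteq> h} \<and> card (edges F) \<le> card {h \<in> edges H. f ` e \<subseteq> h}"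
      using f(3)[of a b] e hypergraph_finite_edges[OF H] by (simp add: thick_def)
  qed
  then obtain \<psi> where "inj_on \<psi> (edges F)" "\<forall>e\<in>edges F. \<psi> e \<in> {h \<in> edges H. f ` e \<subseteq> h}" by blast
  then have "berge_emb F H f \<psi>" using f by (auto simp: berge_emb_def)
  then show False using free berge_free_iff[OF F H] by blast
qed

text \<open>A hyperedge that is not a clique contains a pair that is not thick, and each such pair
  lies in fewer than \<open>q\<close> hyperedges.\<close>

lemma card_thin_edges:
  assumes H: "uniform k H"
  shows "card (edges H - clq (verts H) (thick q H) k) \<le> q * (card (verts H))\<^sup>2"
proof -
  have H': "is_hypergraph H" using H by (simp add: uniform_def)
  have finV: "finite (verts H)" using H' by (simp add: is_hypergraph_def)
  have finE: "finite (edges H)" by (rule hypergraph_finite_edges[OF H'])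
  define P where "P = {z \<in> verts H \<times> verts H. case z of (x, y) \<Rightarrow> x \<noteq> y \<and> \<not> thick q H x y}"
  have finP: "finite P" using finV by (simp add: P_def)
  have "edges H - clq (verts H) (thick q H) k \<subseteq> (\<Union>z\<in>P. {h \<in> edges H. {fst z, snd z} \<subseteq> h})"
  proof
    fix h assume h: "h \<in> edges H - clq (verts H) (thick q H) k"
    have hV: "h \<subseteq> verts H" "card h = k" using h H by (auto simp: uniform_def is_hypergraph_def)
    then obtain x y where "x \<in> h" "y \<in> h" "x \<noteq> y" "\<not> thick q H x y"
      using h by (auto simp: clq_def pairwise_def)
    then have "(x, y) \<in> P" "h \<in> {h \<in> edges H. {fst (x, y), snd (x, y)} \<subseteq> h}" using h hV by (auto simp: P_def)
    then show "h \<in> (\<Union>z\<in>P. {h \<in> edges H. {fst z, snd z} \<subseteq> h})" by blast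
  qed
  then have "card (edges H - clq (verts H) (thick q H) k) \<le> card (\<Union>z\<in>P. {h \<in> edges H. {fst z, snd z} \<subseteq> h})"
    by (intro card_mono) (use finP finE in auto)
  also have "\<dots> \<le> (\<Sum>z\<in>P. card {h \<in> edges H. {fst z, snd z} \<subseteq> h})" by (rule card_UN_le[OF finP])
  also have "\<dots> \<le> (\<Sum>z\<in>P. q)" by (rule sum_mono) (auto simp: P_def thick_def)
  also have "\<dots> = q * card P" by simp
  also have "card P \<le> card (verts H \<times> verts H)" by (rule card_mono) (auto simp: P_def finV)
  finally show ?thesis by (simp add: card_cartesian_product power2_eq_square)
qed

text \<open>\<open>W\<close> is larger than in \<open>clone_col\<close> because the substitute for \<open>u\<close> must avoid the hyperedges
  in use as well, in order that the new hyperedges are distinct from the old ones.\<close>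

lemma clone_berge:
  fixes H :: "nat hypergraph"
  assumes F: "is_graph F" and H: "H \<in> berge_free_hypergraphs k n F" "card (edges H) = ex_berge k n F"
    and u: "u \<in> verts H"
    and link: "common_link (verts H) (edges H) (Suc (card (verts F) + card (edges F) * k)) k u W \<L>"
    and k: "k > 0"
  shows "card \<L> \<le> card {h \<in> edges H. u \<in> h}"
proof -
  have W: "W \<subseteq> verts H - {u}" "card W = Suc (card (verts F) + card (edges F) * k)"
    and L: "\<And>K. K \<in> \<L> \<Longrightarrow> K \<subseteq> verts H - {u} \<and> card K = k - 1 \<and> K \<inter> W = {} \<and>
      (\<forall>w\<in>W. insert w K \<in> edges H)"
    using link by (auto simp: common_link_def)
  have un: "uniform k H" and cn: "card (verts H) = n" and fr: "berge_free F H"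
    using H(1) by (auto simp: berge_free_hypergraphs_def)
  have hy: "is_hypergraph H" using un by (simp add: uniform_def)
  have finV: "finite (verts H)" using hy by (simp add: is_hypergraph_def)
  have finE: "finite (edges H)" by (rule hypergraph_finite_edges[OF hy])
  define H' :: "nat hypergraph" where "H' = \<lparr>verts = verts H, edges = {h \<in> edges H. u \<notin> h} \<union> insert u ` \<L>\<rparr>"
  have Lu: "u \<notin> K" if "K \<in> \<L>" for K using L[OF that] by auto
  have un': "uniform k H'"
    unfolding uniform_def is_hypergraph_def
  proof (intro conjI ballI)
    show "finite (verts H')" using finV by (simp add: H'_def)
    show "edges H' \<subseteq> Pow (verts H')" using hy L u by (auto simp: H'_def is_hypergraph_def)
    fix e assume "e \<in> edges H'"
    then consider "e \<in> edges H" | K where "K \<in> \<L>" "e = insert u K" by (auto simp: H'_def)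
    then show "card e = k"
    proof cases
      case 1
      then show ?thesis using un by (simp add: uniform_def)
    next
      case 2
      have "finite K" using L[OF 2(1)] finV finite_subset by blast
      then show ?thesis using 2 L[OF 2(1)] Lu[OF 2(1)] k by simp
    qed
  qed
  have hy': "is_hypergraph H'" using un' by (simp add: uniform_def)
  have "berge_free F H'"
    unfolding berge_free_iff[OF F hy']
  proof
    assume "\<exists>f \<psi>. berge_emb F H' f \<psi>"
    then obtain f \<psi> where f: "inj_on f (verts F)" "f ` verts F \<subseteq> verts H" and \<psi>: "inj_on \<psi> (edges F)"
      "\<And>e. e \<in> edges F \<Longrightarrow> \<psi> e \<in> edges H' \<and> f ` e \<subseteq> \<psi> e" by (auto simp: berge_emb_def H'_def)
    define U where "U = f ` verts F \<union> (\<Union>e\<in>edges F. \<psi> e)"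
    have "finite (\<psi> e)" if "e \<in> edges F" for e
      using \<psi>(2)[OF that] hy' finite_subset[of "\<psi> e" "verts H'"] by (auto simp: is_hypergraph_def)
    then have finU: "finite U" using graph_finite[OF F] graph_finite_edges[OF F] by (auto simp: U_def)
    have "card U \<le> card (f ` verts F) + card (\<Union>e\<in>edges F. \<psi> e)" unfolding U_def by (rule card_Un_le)
    also have "\<dots> \<le> card (verts F) + (\<Sum>e\<in>edges F. card (\<psi> e))"
      by (intro add_mono card_image_le card_UN_le graph_finite graph_finite_edges F)
    also have "(\<Sum>e\<in>edges F. card (\<psi> e)) = (\<Sum>e\<in>edges F. k)"
      by (rule sum.cong) (use \<psi>(2) un' in \<open>auto simp: uniform_def\<close>)
    finally have "card U < card W" using W(2) by simp
    then have "\<not> W \<subseteq> U" using card_mono[OF finU, of W] by auto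
    then obtain w where w: "w \<in> W" "w \<notin> U" by auto
    \<comment> \<open>Exchanging \<open>u\<close> for \<open>w\<close> turns a new hyperedge
      \<open>insert u K\<close> into \<open>insert w K\<close>, which belongs to \<open>H\<close>.
      The exchange is injective on the hyperedges in use because none of them contains
      \<open>w\<close>.\<close>
    define sw where "sw h = (if u \<in> h then insert w (h - {u}) else h)" for h
    define f' where "f' a = (if f a = u then w else f a)" for a
    have wne: "w \<noteq> u" using w(1) W(1) by auto
    have wf: "w \<notin> f ` verts F" and w\<psi>: "\<And>e. e \<in> edges F \<Longrightarrow> w \<notin> \<psi> e" using w(2) by (auto simp: U_def)
    have "inj_on f' (verts F)" using f(1) wf by (auto simp: inj_on_def f'_def)
    moreover have "f' ` verts F \<subseteq> verts H" using f(2) w(1) W(1) by (auto simp: f'_def)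
    moreover have "inj_on (\<lambda>e. sw (\<psi> e)) (edges F)"
    proof (rule inj_onI)
      fix d e assume de: "d \<in> edges F" "e \<in> edges F" "sw (\<psi> d) = sw (\<psi> e)"
      have rec: "h = (if w \<in> sw h then insert u (sw h - {w}) else sw h)" if "w \<notin> h" for h
        using that wne by (auto simp: sw_def)
      have "\<psi> d = \<psi> e" using rec[OF w\<psi>[OF de(1)]] rec[OF w\<psi>[OF de(2)]] de(3) by metis
      then show "d = e" using \<psi>(1) de by (auto simp: inj_on_def)
    qed
    moreover have "sw (\<psi> e) \<in> edges H \<and> f' ` e \<subseteq> sw (\<psi> e)" if e: "e \<in> edges F" for e
    proof
      have m: "\<psi> e \<in> edges H'" "f ` e \<subseteq> \<psi> e" using \<psi>(2)[OF e] by auto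
      show "f' ` e \<subseteq> sw (\<psi> e)" using m(2) by (auto simp: f'_def sw_def)
      show "sw (\<psi> e) \<in> edges H"
      proof (cases "u \<in> \<psi> e")
        case True
        then obtain K where K: "K \<in> \<L>" "\<psi> e = insert u K" using m(1) by (auto simp: H'_def)
        then have "sw (\<psi> e) = insert w K" using Lu by (auto simp: sw_def)
        then show ?thesis using L[OF K(1)] w(1) by simp
      next
        case False
        then show ?thesis using m(1) by (auto simp: H'_def sw_def)
      qed
    qed
    ultimately have "berge_emb F H f' (\<lambda>e. sw (\<psi> e))" by (simp add: berge_emb_def)
    then show False using fr berge_free_iff[OF F hy] by blast
  qed
  then have "H' \<in> berge_free_hypergraphs k n F" using un' cn by (simp add: berge_free_hypergraphs_def H'_def)
  then have le: "card (edges H') \<le> card (edges H)"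
    unfolding H(2) ex_berge_def by (rule Max_image_ge[OF ex_berge_values_finite])
  have finL: "finite \<L>" by (rule finite_subset[of _ "Pow (verts H)"]) (use L finV in auto)
  have "card (edges H') = card {h \<in> edges H. u \<notin> h} + card (insert u ` \<L>)"
    unfolding H'_def using finE finL by (simp, intro card_Un_disjoint) auto
  also have "card (insert u ` \<L>) = card \<L>"
  proof (rule card_image, rule inj_onI)
    fix K K' assume K: "K \<in> \<L>" "K' \<in> \<L>" "insert u K = insert u K'"
    then show "K = K'" using Lu[OF K(1)] Lu[OF K(2)] by (metis insert_ident)
  qed
  finally have "card (edges H') = card {h \<in> edges H. u \<notin> h} + card \<L>" .
  moreover have "card (edges H) = card {h \<in> edges H. u \<in> h} + card {h \<in> edges H. u \<notin> h}"
    using card_Int_Diff[OF finE, of "{K. u \<in> K}"] by (simp add: Int_def set_diff_eq)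
  ultimately show ?thesis using le by linarith
qed

section \<open>Neighbourhoods and recolouring\<close>

text \<open>A transversal either meets one of the parts in \<open>I\<close>, where \<open>N\<close>
  has few vertices, or lies in the remaining parts.\<close>

lemma transversals_le_hitting:
  assumes fin: "finite V" and N: "N \<subseteq> V"
    and D: "D = (\<Union>i\<in>I. part N p i)" and I: "finite I" "\<And>i. i \<in> I \<Longrightarrow> real (card (part N p i)) \<le> c"
    and s: "s > 0"
  shows "real (card (transversals N p J s)) \<le>
    real (card I) * c * real (card V) ^ (s - 1) + real (card (transversals N p (J - I) s))"
proof -
  let ?H = "{K. K \<subseteq> V \<and> card K = s \<and> K \<inter> D \<noteq> {}}"
  have finN: "finite N" using N fin finite_subset by blast
  have DV: "D \<subseteq> V" using N by (auto simp: D part_def)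
  have "transversals N p J s \<subseteq> ?H \<union> transversals N p (J - I) s"
    using N by (fastforce simp: transversals_iff D part_def)
  then have "card (transversals N p J s) \<le> card (?H \<union> transversals N p (J - I) s)"
    by (intro card_mono finite_UnI finite_transversals finN) (use fin in auto)
  also have "\<dots> \<le> card ?H + card (transversals N p (J - I) s)" by (rule card_Un_le)
  also have "card ?H \<le> card D * card V ^ (s - 1)" by (rule card_sets_hitting[OF fin DV])
  finally have "real (card (transversals N p J s)) \<le> real (card D * card V ^ (s - 1) + card (transversals N p (J - I) s))"
    by (simp only: of_nat_le_iff add_le_cancel_right)
  moreover have "real (card D) \<le> real (card I) * c"
  proof -
    have "card D \<le> (\<Sum>i\<in>I. card (part N p i))" unfolding D by (rule card_UN_le[OF I(1)])
    then have "real (card D) \<le> (\<Sum>i\<in>I. real (card (part N p i)))" by (metis of_nat_le_iff of_nat_sum)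
    also have "\<dots> \<le> (\<Sum>i\<in>I. c)" by (intro sum_mono I(2))
    finally show ?thesis by simp
  qed
  then have "real (card D) * real (card V) ^ (s - 1) \<le> real (card I) * c * real (card V) ^ (s - 1)"
    by (intro mult_right_mono) auto
  ultimately show ?thesis by simp
qed

lemma transversals_mono: "N \<subseteq> V \<Longrightarrow> transversals N p J s \<subseteq> transversals V p J s"
  unfolding transversals_iff subset_iff by blast

text \<open>Every vertex of part \<open>j\<close> outside \<open>N\<close> lies on as many
  transversals as the other parts of \<open>J\<close> have (s-1)-transversals, and all of these are
  lost; different vertices of part \<open>j\<close> lose different ones.\<close>

lemma transversals_missing:
  assumes fin: "finite V" and N: "N \<subseteq> V" and J: "finite J" "j \<in> J" and s: "s > 0"
  shows "card (transversals N p J s) + card (part V p j - N) * card (transversals V p (J - {j}) (s - 1))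
    \<le> card (transversals V p J s)"
proof -
  let ?A = "part V p j - N" and ?T = "transversals V p (J - {j}) (s - 1)"
  let ?f = "\<lambda>(y, L). insert y L"
  have finT: "finite (transversals V p J s)" by (rule finite_transversals[OF fin])
  have pL: "p y = j \<and> y \<notin> L \<and> (\<forall>x\<in>L. p x \<noteq> j)" if "y \<in> ?A" "L \<in> ?T" for y L
    using that by (auto simp: part_def transversals_iff)
  have "inj_on ?f (?A \<times> ?T)"
  proof (rule inj_onI)
    fix a b assume ab: "a \<in> ?A \<times> ?T" "b \<in> ?A \<times> ?T" "?f a = ?f b"
    obtain y L y' L' where e: "a = (y, L)" "b = (y', L')" by (cases a, cases b) auto
    have 1: "p y = j" "y \<notin> L" "\<forall>x\<in>L. p x \<noteq> j" using pL[of y L] ab e by auto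
    have 2: "p y' = j" "y' \<notin> L'" "\<forall>x\<in>L'. p x \<noteq> j" using pL[of y' L'] ab e by auto
    have eq: "insert y L = insert y' L'" using ab e by simp
    then have "y = y'" using 1 2 by blast
    then show "a = b" using e eq 1 2 by (metis insert_ident)
  qed
  then have "card (?f ` (?A \<times> ?T)) = card ?A * card ?T" by (simp add: card_image card_cartesian_product)
  moreover have "?f ` (?A \<times> ?T) \<subseteq> transversals V p J s - transversals N p J s"
  proof
    fix K assume "K \<in> ?f ` (?A \<times> ?T)"
    then obtain y L where K: "K = insert y L" "y \<in> ?A" "L \<in> ?T" by auto
    have L: "L \<subseteq> V" "card L = s - 1" "inj_on p L" "p ` L \<subseteq> J - {j}" using K by (auto simp: transversals_iff)
    have "finite L" using L(1) fin finite_subset by blast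
    moreover have y: "p y = j" "y \<notin> L" "\<forall>x\<in>L. p x \<noteq> j" "y \<in> V" using pL[OF K(2,3)] K(2) by (auto simp: part_def)
    ultimately have "card K = s" using K(1) L(2) s by simp
    moreover have "inj_on p K" unfolding K(1) using L(3) y by auto
    moreover have "K \<subseteq> V" "p ` K \<subseteq> J" using K(1) L(1,4) J(2) y by auto
    ultimately have "K \<in> transversals V p J s" by (simp add: transversals_iff)
    moreover have "K \<notin> transversals N p J s" using K by (auto simp: transversals_iff)
    ultimately show "K \<in> transversals V p J s - transversals N p J s" by blast
  qed
  ultimately have "card ?A * card ?T \<le> card (transversals V p J s - transversals N p J s)"
    using card_mono[of "transversals V p J s - transversals N p J s"] finT by (metis finite_Diff)
  also have "\<dots> = card (transversals V p J s) - card (transversals N p J s)"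
    by (rule card_Diff_subset[OF finite_subset[OF transversals_mono[OF N] finT] transversals_mono[OF N]])
  finally show ?thesis using card_mono[OF finT transversals_mono[OF N]] by linarith
qed

context fgraph
begin

lemma card_clq_at:
  "card {K \<in> clq V E k. u \<in> K} \<le> card (clq (ext V E {u}) E (k - 1))"
proof (rule card_inj_on_le[where f = "\<lambda>K. K - {u}"])
  show "inj_on (\<lambda>K. K - {u}) {K \<in> clq V E k. u \<in> K}"
    by (auto simp: inj_on_def)
  show "(\<lambda>K. K - {u}) ` {K \<in> clq V E k. u \<in> K} \<subseteq> clq (ext V E {u}) E (k - 1)"
  proof
    fix L assume "L \<in> (\<lambda>K. K - {u}) ` {K \<in> clq V E k. u \<in> K}"
    then obtain K where K: "L = K - {u}" "u \<in> K" "K \<subseteq> V" "card K = k" "pairwise E K"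
      by (auto simp: clq_def)
    have "pairwise E L" using K by (auto intro: pairwise_subset)
    moreover have "L \<subseteq> ext V E {u}" using K by (auto simp: ext_def dest: pairwiseD)
    ultimately show "L \<in> clq (ext V E {u}) E (k - 1)" using K by (simp add: clq_def)
  qed
  show "finite (clq (ext V E {u}) E (k - 1))" by (intro finite_clq finite_ext finV)
qed

text \<open>With the next lemma: inside any \<open>N\<close>, cliques and transversals agree up to
  \<theta>n^s sets, since a set of one kind but not of the other contains a bad pair of
  \<open>inside\<close> or \<open>cross_missing\<close>.\<close>

lemma card_clq_le_transversals:
  assumes N: "N \<subseteq> V" and p: "\<forall>v. p v < r" and n: "card V > 0"
    and ins: "real (card (inside V E p)) \<le> \<theta> * (real (card V))\<^sup>2"
  shows "real (card (clq N E s)) \<le> \<theta> * real (card V) ^ s + real (card (transversals N p {..<r} s))"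
proof -
  let ?B = "{K. K \<subseteq> V \<and> card K = s \<and> (\<exists>x\<in>K. \<exists>y\<in>K. x \<noteq> y \<and> (x, y) \<in> inside V E p)}"
  have finN: "finite N" using N finV finite_subset by blast
  have "clq N E s \<subseteq> ?B \<union> transversals N p {..<r} s"
  proof
    fix K assume K: "K \<in> clq N E s"
    show "K \<in> ?B \<union> transversals N p {..<r} s"
    proof (cases "inj_on p K")
      case True
      then show ?thesis using K p by (auto simp: clq_def transversals_iff)
    next
      case False
      then obtain x y where xy: "x \<in> K" "y \<in> K" "x \<noteq> y" "p x = p y" by (auto simp: inj_on_def)
      then have "(x, y) \<in> inside V E p" using K N by (auto simp: inside_def clq_def dest: pairwiseD)
      then show ?thesis using xy K N by (auto simp: clq_def)
    qed
  qed
  then have "card (clq N E s) \<le> card (?B \<union> transversals N p {..<r} s)"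
    by (intro card_mono finite_UnI finite_transversals finN) (use finV in auto)
  also have "\<dots> \<le> card ?B + card (transversals N p {..<r} s)" by (rule card_Un_le)
  finally have "real (card (clq N E s)) \<le> real (card ?B) + real (card (transversals N p {..<r} s))" by linarith
  moreover have "real (card ?B) \<le> \<theta> * real (card V) ^ s"
    by (rule card_sets_bad_pair[OF finV _ ins n]) (auto simp: inside_def)
  ultimately show ?thesis by linarith
qed

lemma card_transversals_le_clq:
  assumes N: "N \<subseteq> V" and n: "card V > 0"
    and cross: "real (card (cross_missing V E p)) \<le> \<theta> * (real (card V))\<^sup>2"
  shows "real (card (transversals N p J s)) \<le> \<theta> * real (card V) ^ s + real (card (clq N E s))"
proof -
  let ?B = "{K. K \<subseteq> V \<and> card K = s \<and> (\<exists>x\<in>K. \<exists>y\<in>K. x \<noteq> y \<and> (x, y) \<in> cross_missing V E p)}"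
  have finN: "finite N" using N finV finite_subset by blast
  have "transversals N p J s \<subseteq> ?B \<union> clq N E s"
  proof
    fix K assume K: "K \<in> transversals N p J s"
    show "K \<in> ?B \<union> clq N E s"
    proof (cases "pairwise E K")
      case True
      then show ?thesis using K by (auto simp: clq_def transversals_iff)
    next
      case False
      then obtain x y where xy: "x \<in> K" "y \<in> K" "x \<noteq> y" "\<not> E x y" by (auto simp: pairwise_def)
      then have "(x, y) \<in> cross_missing V E p" using K N by (auto simp: cross_missing_def transversals_iff inj_on_def)
      then show ?thesis using xy K N by (auto simp: transversals_iff)
    qed
  qed
  then have "card (transversals N p J s) \<le> card (?B \<union> clq N E s)"
    by (intro card_mono finite_UnI finite_clq finN) (use finV in auto)
  also have "\<dots> \<le> card ?B + card (clq N E s)" by (rule card_Un_le)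
  finally have "real (card (transversals N p J s)) \<le> real (card ?B) + real (card (clq N E s))" by linarith
  moreover have "real (card ?B) \<le> \<theta> * real (card V) ^ s"
    by (rule card_sets_bad_pair[OF finV _ cross n]) (auto simp: cross_missing_def)
  ultimately show ?thesis by linarith
qed

lemma card_clq_le_power: "real (card (clq V E s)) \<le> real (card V) ^ s"
proof -
  have "card (clq V E s) \<le> card {K. K \<subseteq> V \<and> card K = s}"
    by (rule card_mono) (auto simp: clq_def finV)
  also have "\<dots> = card V choose s" by (rule n_subsets[OF finV])
  also have "\<dots> \<le> card V ^ s" by (rule binomial_le_power)
  finally show ?thesis by (metis of_nat_le_iff of_nat_power)
qed

end

text \<open>With b = \<open>card B\<close>, the sets \<open>C v\<close> cover \<open>U\<close> with
  total multiplicity at least sM. Elements covered fewer than \<open>s\<close> times contribute at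
  most (s-1)M in all, and any other element lies in the intersection for some s-subset of
  \<open>B\<close>. There are at most 2^b such subsets, so if all intersections were below M/(2b
  2^b), the total would be at most (s-1)M + M/2.\<close>

lemma common_members:
  fixes C :: "'a \<Rightarrow> 'b set" and M \<zeta> :: real
  assumes U: "finite U" "real (card U) \<le> M" "M > 0"
    and B: "finite B" "\<And>v. v \<in> B \<Longrightarrow> C v \<subseteq> U \<and> \<zeta> * M \<le> real (card (C v))"
    and s: "real s \<le> real (card B) * \<zeta>" "s > 0"
  shows "\<exists>S\<subseteq>B. card S = s \<and> M / (2 * real (card B) * 2 ^ card B) \<le> real (card {x \<in> U. \<forall>v\<in>S. x \<in> C v})"
proof (rule ccontr)
  assume neg: "\<not> ?thesis"
  define b where "b = card B"
  define d where "d x = card {v \<in> B. x \<in> C v}" for x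
  define I where "I S = {x \<in> U. \<forall>v\<in>S. x \<in> C v}" for S
  let ?P = "{S. S \<subseteq> B \<and> card S = s}"
  have b: "b > 0" using s by (cases "b = 0") (auto simp: b_def)
  have finP: "finite ?P" using B(1) by simp
  have "real (\<Sum>x\<in>U. d x) = (\<Sum>v\<in>B. real (card (C v)))"
  proof -
    have "(\<Sum>x\<in>U. d x) = (\<Sum>x\<in>U. \<Sum>v\<in>B. of_bool (x \<in> C v))"
      using B(1) by (intro sum.cong refl) (simp add: d_def of_bool_def sum.If_cases Int_def)
    also have "\<dots> = (\<Sum>v\<in>B. \<Sum>x\<in>U. of_bool (x \<in> C v))" by (rule sum.swap)
    also have "\<dots> = (\<Sum>v\<in>B. card (C v))"
    proof (rule sum.cong[OF refl])
      fix v assume "v \<in> B"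
      then have "U \<inter> {x. x \<in> C v} = C v" using B(2) by auto
      then show "(\<Sum>x\<in>U. of_bool (x \<in> C v)) = card (C v)"
        using U(1) by (simp add: of_bool_def sum.If_cases)
    qed
    finally show ?thesis by simp
  qed
  also have "\<dots> \<ge> (\<Sum>v\<in>B. \<zeta> * M)" by (intro sum_mono) (use B(2) in auto)
  finally have "real b * \<zeta> * M \<le> real (\<Sum>x\<in>U. d x)" by (simp add: b_def)
  moreover have "real s * M \<le> real b * \<zeta> * M" using s U(3) by (intro mult_right_mono) (auto simp: b_def)
  ultimately have low: "real s * M \<le> real (\<Sum>x\<in>U. d x)" by linarith
  have "(\<Sum>x\<in>U. d x) \<le> (\<Sum>x\<in>U. (s - 1) + b * card {S \<in> ?P. x \<in> I S})"
  proof (rule sum_mono)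
    fix x assume x: "x \<in> U"
    show "d x \<le> (s - 1) + b * card {S \<in> ?P. x \<in> I S}"
    proof (cases "d x \<ge> s")
      case True
      then obtain S where "S \<subseteq> {v \<in> B. x \<in> C v}" "card S = s"
        unfolding d_def by (rule obtain_subset_with_card_n)
      then have "S \<in> {S \<in> ?P. x \<in> I S}" using x by (auto simp: I_def)
      moreover have "finite {S \<in> ?P. x \<in> I S}" using B(1) by simp
      ultimately have "card {S \<in> ?P. x \<in> I S} > 0" by (auto simp only: card_gt_0_iff)
      then have "card {S \<in> ?P. x \<in> I S} \<ge> 1" by simp
      then have "b * 1 \<le> b * card {S \<in> ?P. x \<in> I S}" by (intro mult_left_mono) auto
      moreover have "d x \<le> b" unfolding d_def b_def by (rule card_mono[OF B(1)]) auto
      ultimately show ?thesis by linarith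
    qed auto
  qed
  also have "\<dots> = card U * (s - 1) + b * (\<Sum>x\<in>U. card {S \<in> ?P. x \<in> I S})"
    by (simp only: sum.distrib sum_distrib_left sum_constant of_nat_id)
  also have "(\<Sum>x\<in>U. card {S \<in> ?P. x \<in> I S}) = (\<Sum>S\<in>?P. card (I S))"
  proof -
    have "(\<Sum>x\<in>U. card {S \<in> ?P. x \<in> I S}) = (\<Sum>x\<in>U. \<Sum>S\<in>?P. of_bool (x \<in> I S))"
      using finP by (intro sum.cong refl) (simp add: of_bool_def sum.If_cases Int_def)
    also have "\<dots> = (\<Sum>S\<in>?P. \<Sum>x\<in>U. of_bool (x \<in> I S))" by (rule sum.swap)
    also have "\<dots> = (\<Sum>S\<in>?P. card (I S))"
    proof (rule sum.cong[OF refl])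
      fix S
      have "U \<inter> {x. x \<in> I S} = I S" by (auto simp: I_def)
      then show "(\<Sum>x\<in>U. of_bool (x \<in> I S)) = card (I S)"
        using U(1) by (simp add: of_bool_def sum.If_cases)
    qed
    finally show ?thesis .
  qed
  finally have "real (\<Sum>x\<in>U. d x) \<le> real (card U * (s - 1) + b * (\<Sum>S\<in>?P. card (I S)))" by (simp only: of_nat_le_iff)
  also have "\<dots> = real (card U) * real (s - 1) + real b * (\<Sum>S\<in>?P. real (card (I S)))" by simp
  also have "\<dots> \<le> M * real (s - 1) + real b * (2 ^ b * (M / (2 * real b * 2 ^ b)))"
  proof (intro add_mono mult_right_mono mult_left_mono)
    have "(\<Sum>S\<in>?P. real (card (I S))) \<le> (\<Sum>S\<in>?P. M / (2 * real b * 2 ^ b))"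
    proof (rule sum_mono)
      fix S assume "S \<in> ?P"
      then have "\<not> M / (2 * real b * 2 ^ b) \<le> real (card (I S))" using neg by (auto simp: I_def b_def)
      then show "real (card (I S)) \<le> M / (2 * real b * 2 ^ b)" by simp
    qed
    also have "\<dots> = real (card ?P) * (M / (2 * real b * 2 ^ b))" by simp
    also have "\<dots> \<le> 2 ^ b * (M / (2 * real b * 2 ^ b))"
    proof (rule mult_right_mono)
      have "card ?P \<le> card (Pow B)" by (rule card_mono) (use B(1) in auto)
      then have "card ?P \<le> 2 ^ b" using B(1) by (simp add: card_Pow b_def)
      then show "real (card ?P) \<le> 2 ^ b" by (metis of_nat_le_iff of_nat_numeral of_nat_power)
    qed (use U(3) in simp)
    finally show "(\<Sum>S\<in>?P. real (card (I S))) \<le> 2 ^ b * (M / (2 * real b * 2 ^ b))" .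
  qed (use U in auto)
  also have "\<dots> = M * real (s - 1) + M / 2" using b by simp
  also have "\<dots> < real s * M" using s(2) U(3) by (simp add: of_nat_diff algebra_simps)
  finally show False using low by simp
qed

lemma sigma_coloring:
  assumes F: "is_graph F" and chi: "chromatic_number F = Suc r"
  obtains c i where "proper_coloring F (Suc r) c" "i < Suc r" "card {v \<in> verts F. c v = i} = sigma F" "sigma F > 0"
proof -
  obtain c0 where c0: "proper_coloring F (Suc r) c0" using chromatic_coloring[OF F] chi by auto
  have "\<exists>c i. proper_coloring F (chromatic_number F) c \<and> i < chromatic_number F \<and> sigma F = card {v \<in> verts F. c v = i}"
    unfolding sigma_def by (rule LeastI_ex) (use c0 chi in auto)
  then obtain c i where c: "proper_coloring F (Suc r) c" "i < Suc r" "sigma F = card {v \<in> verts F. c v = i}"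
    using chi by auto
  have "sigma F > 0"
  proof (rule ccontr)
    assume "\<not> sigma F > 0"
    then have "{v \<in> verts F. c v = i} = {}" using c(3) graph_finite[OF F] by simp
    then have ne: "c v \<noteq> i" if "v \<in> verts F" for v using that by auto
    \<comment> \<open>If class \<open>i\<close> were empty, its colour could replace the last colour
      \<open>r\<close>, giving a proper colouring with only \<open>r\<close> colours.\<close>
    define c' where "c' v = (if c v = r then i else c v)" for v
    have lt: "c v < Suc r" if "v \<in> verts F" for v using c(1) that by (auto simp: proper_coloring_def)
    have "proper_coloring F r c'"
      unfolding proper_coloring_def
    proof (intro conjI allI impI)
      show "c' ` verts F \<subseteq> {..<r}"
      proof
        fix x assume "x \<in> c' ` verts F"
        then obtain v where v: "v \<in> verts F" "x = c' v" by auto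
        show "x \<in> {..<r}" using lt[OF v(1)] ne[OF v(1)] c(2) v(2) by (auto simp: c'_def)
      qed
      fix u v assume uv: "{u, v} \<in> edges F"
      have "u \<in> verts F" "v \<in> verts F" using graph_edge[OF F uv] by auto
      moreover have "c u \<noteq> c v" using c(1) uv by (auto simp: proper_coloring_def)
      ultimately show "c' u \<noteq> c' v" using ne[of u] ne[of v] by (auto simp: c'_def)
    qed
    then show False using less_chromatic chi by (metis lessI)
  qed
  then show ?thesis using that c by simp
qed

text \<open>\<open>S\<close> receives a colour class of size \<open>sigma F\<close>, and the other
  \<open>r\<close> classes go into the complete r-partite graph in the common neighbourhood of
  \<open>S\<close>. Nothing is asked of the edges within \<open>S\<close>.\<close>

lemma emb_sigma:
  assumes F: "is_graph F" and chi: "chromatic_number F = Suc r"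
    and G: "fgraph V E" and S: "S \<subseteq> V" "card S = sigma F"
    and X: "\<And>i. i < r \<Longrightarrow> X i \<subseteq> ext V E S \<and> card (X i) = Suc (card (verts F))"
      "\<And>i j x y. i < r \<Longrightarrow> j < r \<Longrightarrow> i \<noteq> j \<Longrightarrow> x \<in> X i \<Longrightarrow> y \<in> X j \<Longrightarrow> E x y"
  shows "emb F V E"
proof -
  interpret fgraph V E by (rule G)
  obtain c i0 where c: "proper_coloring F (Suc r) c" "i0 < Suc r" "card {v \<in> verts F. c v = i0} = sigma F"
    using sigma_coloring[OF F chi] by metis
  \<comment> \<open>Renumbers the colours other than \<open>i0\<close> as 0 to r - 1.\<close>
  define \<phi> where "\<phi> j = (if j < i0 then j else j - 1)" for j
  define Y where "Y j = (if j = i0 then S else X (\<phi> j))" for j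
  have \<phi>: "\<phi> j < r" if "j < Suc r" "j \<noteq> i0" for j using that c(2) by (auto simp: \<phi>_def)
  have \<phi>inj: "\<phi> j \<noteq> \<phi> l" if "j \<noteq> i0" "l \<noteq> i0" "j \<noteq> l" for j l using that by (auto simp: \<phi>_def split: if_splits)
  have SX: "E x y \<and> E y x" if "x \<in> S" "y \<in> X l" "l < r" for x y l
    using X(1)[OF that(3)] that symE by (auto simp: ext_def)
  show ?thesis
  proof (rule emb_blowup[OF _ c(1), where X = Y])
    show "is_hypergraph F" using F by (simp add: uniform_def)
    fix j assume j: "j < Suc r"
    have "card {v \<in> verts F. c v = j} \<le> card (verts F)" by (rule card_mono[OF graph_finite[OF F]]) auto
    then have "card {v \<in> verts F. c v = j} \<le> card (Y j)"
      using c(3) S(2) X(1)[OF \<phi>[OF j]] by (auto simp: Y_def)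
    moreover have "Y j \<subseteq> V" using S(1) X(1)[OF \<phi>[OF j]] by (auto simp: Y_def ext_def)
    ultimately show "Y j \<subseteq> V \<and> finite (Y j) \<and> card {v \<in> verts F. c v = j} \<le> card (Y j)"
      using finite_subset[OF _ finV] by blast
  next
    fix j l x y assume jl: "j < Suc r" "l < Suc r" "j \<noteq> l" "x \<in> Y j" "y \<in> Y l"
    consider "j = i0" | "l = i0" "j \<noteq> i0" | "j \<noteq> i0" "l \<noteq> i0" by blast
    then show "E x y"
    proof cases
      case 1
      then show ?thesis using jl SX[OF _ _ \<phi>[OF jl(2)]] by (auto simp: Y_def)
    next
      case 2
      then show ?thesis using jl SX[OF _ _ \<phi>[OF jl(1)]] by (auto simp: Y_def)
    next
      case 3
      then show ?thesis using jl X(2)[OF \<phi>[OF jl(1)] \<phi>[OF jl(2)] \<phi>inj] by (auto simp: Y_def)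
    qed
  qed (rule irrE)
qed

text \<open>Recolouring a red edge blue would otherwise increase the count.\<close>

lemma recolor:
  assumes G: "G \<in> free_blue_red_graphs n F" "g k G = ex_col k n F" and k: "k \<ge> 2"
    and e: "{a, b} \<in> edges (red_part G)"
  shows "card (clq (ext (verts G) (adj (blue_part G)) {a, b}) (adj (blue_part G)) (k - 2)) \<le> 1"
proof -
  have gr: "is_graph G" using G(1) by (simp add: free_blue_red_graphs_def)
  have finV: "finite (verts G)" by (rule graph_finite[OF gr])
  have red: "{a, b} \<in> edges G" "color G {a, b} = Red" using e by (auto simp: red_part_def)
  have ab: "a \<noteq> b" "a \<in> verts G" "b \<in> verts G" using graph_edge[OF gr red(1)] by auto
  define G' where "G' = G\<lparr>color := (color G)({a, b} := Blue)\<rparr>"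
  let ?E = "adj (blue_part G)" and ?E' = "adj (blue_part G')"
  let ?N = "ext (verts G) ?E {a, b}"
  let ?L = "clq ?N ?E (k - 2)"
  interpret B: fgraph "verts G" ?E
    using graph_fgraph[OF graph_blue_part[OF gr]] by simp
  have gr': "is_graph G'" using gr by (auto simp: G'_def uniform_def is_hypergraph_def)
  have adj': "adj G' = adj G" by (auto simp: fun_eq_iff adj_def G'_def)
  have V': "verts G' = verts G" by (simp add: G'_def)
  have "free_of F G' \<longleftrightarrow> free_of F G" by (simp add: free_of_def copies_def subhypergraph_def G'_def)
  then have "G' \<in> free_blue_red_graphs n F" using G(1) gr' V' by (simp add: free_blue_red_graphs_def)
  then have le: "g k G' \<le> g k G"
    unfolding G(2) ex_col_def by (rule Max_image_ge[OF ex_col_values_finite])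
  have E': "?E' x y \<longleftrightarrow> ?E x y \<or> {x, y} = {a, b}" for x y
    unfolding adj_blue_part adj' using red by (auto simp: G'_def adj_def)
  have notE: "\<not> ?E a b" using red by (simp add: adj_blue_part)
  have finL: "finite ?L" by (intro finite_clq finite_ext finV)
  have Lab: "a \<notin> K \<and> b \<notin> K" if "K \<in> ?L" for K
    using that B.irrE by (auto simp: clq_def ext_def)
  \<comment> \<open>A clique gained by the recolouring contains the pair \<open>a\<close>,
    \<open>b\<close>, so it was not blue before.\<close>
  have "clq (verts G) ?E k \<inter> (\<lambda>K. insert a (insert b K)) ` ?L = {}"
    using notE ab(1) by (auto simp: clq_def dest: pairwiseD)
  then have "card (clq (verts G) ?E k \<union> (\<lambda>K. insert a (insert b K)) ` ?L)
      = card (clq (verts G) ?E k) + card ((\<lambda>K. insert a (insert b K)) ` ?L)"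
    by (intro card_Un_disjoint finite_clq finV finite_imageI finL)
  also have "card ((\<lambda>K. insert a (insert b K)) ` ?L) = card ?L"
  proof (rule card_image, rule inj_onI)
    fix K K' assume K: "K \<in> ?L" "K' \<in> ?L" "insert a (insert b K) = insert a (insert b K')"
    have "K = insert a (insert b K) - {a, b}" using Lab[OF K(1)] by auto
    also have "\<dots> = insert a (insert b K') - {a, b}" using K(3) by (simp only:)
    also have "\<dots> = K'" using Lab[OF K(2)] by auto
    finally show "K = K'" .
  qed
  finally have "card (clq (verts G) ?E k) + card ?L = card (clq (verts G) ?E k \<union> (\<lambda>K. insert a (insert b K)) ` ?L)" ..
  also have "\<dots> \<le> card (clq (verts G') ?E' k)"
  proof (rule card_mono)
    show "finite (clq (verts G') ?E' k)" using finV V' by (simp add: finite_clq)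
    show "clq (verts G) ?E k \<union> (\<lambda>K. insert a (insert b K)) ` ?L \<subseteq> clq (verts G') ?E' k"
    proof (rule Un_least)
      show "clq (verts G) ?E k \<subseteq> clq (verts G') ?E' k"
        unfolding V' by (rule clq_mono) (use E' in auto)
      show "(\<lambda>K. insert a (insert b K)) ` ?L \<subseteq> clq (verts G') ?E' k"
      proof
        fix S assume "S \<in> (\<lambda>K. insert a (insert b K)) ` ?L"
        then obtain K where K: "S = insert a (insert b K)" "K \<in> ?L" by auto
        have K': "K \<subseteq> ?N" "card K = k - 2" "pairwise ?E K" using K(2) by (auto simp: clq_def)
        have KV: "K \<subseteq> verts G" using K'(1) by (auto simp: ext_def)
        have "finite K" using KV finV finite_subset by blast
        then have "card S = k" using K Lab[OF K(2)] K'(2) ab(1) k by simp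
        moreover have "pairwise ?E' S"
          unfolding pairwise_def
        proof (intro ballI impI)
          fix x y assume xy: "x \<in> S" "y \<in> S" "x \<noteq> y"
          have N: "?E z a \<and> ?E z b \<and> ?E a z \<and> ?E b z" if "z \<in> K" for z
            using K'(1) that B.symE by (auto simp: ext_def)
          show "?E' x y"
            unfolding E' using xy K(1) N K'(3) by (auto dest: pairwiseD)
        qed
        ultimately show "S \<in> clq (verts G') ?E' k"
          using K(1) KV ab V' by (simp add: clq_def)
      qed
    qed
  qed
  finally have c1: "card (clq (verts G) ?E k) + card ?L \<le> card (clq (verts G') ?E' k)" .
  have "edges (red_part G') = edges (red_part G) - {{a, b}}"
    by (auto simp: red_part_def G'_def)
  moreover have "finite (edges (red_part G))" using graph_finite_edges[OF gr] by (simp add: red_part_def)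
  ultimately have "card (edges (red_part G)) = Suc (card (edges (red_part G')))"
    using e by (metis card_Suc_Diff1)
  then show ?thesis using le c1 unfolding g_eq[OF gr] g_eq[OF gr'] by linarith
qed

text \<open>A diagonal choice: at \<open>n\<close> the rate is 1/(j+1) for the largest j \<le> n
  whose threshold \<open>N j\<close> is at most \<open>n\<close>. The rate takes only values at
  which \<open>P\<close> is known.\<close>

lemma vanishing_rate:
  fixes P :: "nat \<Rightarrow> real \<Rightarrow> bool"
  assumes "\<And>\<eta>. \<eta> > 0 \<Longrightarrow> \<forall>\<^sub>F n in sequentially. P n \<eta>"
  shows "\<exists>\<delta>. \<delta> \<longlonglongrightarrow> 0 \<and> (\<forall>\<^sub>F n in sequentially. P n (\<delta> n))"
proof -
  have "\<forall>j. \<exists>N. \<forall>n\<ge>N. P n (1 / real (Suc j))"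
    using assms[of "1 / real (Suc _)"] by (simp add: eventually_sequentially del: of_nat_Suc)
  then obtain N where N: "\<And>j n. n \<ge> N j \<Longrightarrow> P n (1 / real (Suc j))" by metis
  define S where "S n = {j. j \<le> n \<and> N j \<le> n}" for n
  define \<delta> where "\<delta> n = 1 / real (Suc (Max (S n)))" for n
  have finS: "finite (S n)" for n by (rule finite_subset[of _ "{..n}"]) (auto simp: S_def)
  have "\<delta> \<longlonglongrightarrow> 0"
  proof (rule LIMSEQ_I)
    fix e :: real assume "e > 0"
    then obtain j where j: "1 / real (Suc j) < e" using nat_approx_posE by metis
    have "norm (\<delta> n - 0) < e" if "n \<ge> max j (N j)" for n
    proof -
      have "j \<le> Max (S n)" by (rule Max_ge[OF finS]) (use that in \<open>auto simp: S_def\<close>)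
      then have "\<delta> n \<le> 1 / real (Suc j)" unfolding \<delta>_def by (intro divide_left_mono) auto
      then show ?thesis using j by (simp add: \<delta>_def)
    qed
    then show "\<exists>no. \<forall>n\<ge>no. norm (\<delta> n - 0) < e" by blast
  qed
  moreover have "\<forall>\<^sub>F n in sequentially. P n (\<delta> n)"
    unfolding eventually_sequentially
  proof (intro exI[of _ "N 0"] allI impI)
    fix n assume "N 0 \<le> n"
    then have "S n \<noteq> {}" by (auto simp: S_def)
    then have "Max (S n) \<in> S n" by (rule Max_in[OF finS])
    then show "P n (\<delta> n)" unfolding \<delta>_def by (intro N) (simp add: S_def)
  qed
  ultimately show ?thesis by blast
qed

lemma eventually_size_filter:
  assumes "eventually P (inf (filtercomap f at_top) (principal S))"
  shows "\<forall>\<^sub>F n :: nat in sequentially. \<forall>x\<in>S. f x = n \<longrightarrow> P x"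
proof -
  have "eventually (\<lambda>x. x \<in> S \<longrightarrow> P x) (filtercomap f at_top)"
    using assms by (simp add: eventually_inf_principal)
  then obtain N where "\<And>x. f x \<ge> N \<Longrightarrow> x \<in> S \<longrightarrow> P x"
    by (auto simp: eventually_filtercomap_at_top_linorder)
  then show ?thesis unfolding eventually_sequentially by blast
qed

section \<open>Extremal graphs\<close>

text \<open>The relative loss from bounding the residue classes below by n/r - 1 instead of
  n/r.\<close>

definition turan_err :: "nat \<Rightarrow> nat \<Rightarrow> nat \<Rightarrow> real" where
  "turan_err k r n = real (r choose k) * ((1 / real r) ^ k - (1 / real r - 1 / real n) ^ k)"

lemma turan_err_eq:
  assumes "n > 0"
  shows "real (r choose k) * (real n / real r - 1) ^ k = (real (r choose k) / real r ^ k - turan_err k r n) * real n ^ k"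
proof -
  have "real n / real r - 1 = (1 / real r - 1 / real n) * real n" using assms by (simp add: left_diff_distrib)
  then have "(real n / real r - 1) ^ k = (1 / real r - 1 / real n) ^ k * real n ^ k" by (simp only: power_mult_distrib)
  then show ?thesis by (simp add: turan_err_def algebra_simps power_divide)
qed

lemma inverse_size_tendsto:
  "filterlim f at_top \<F> \<Longrightarrow> ((\<lambda>x. 1 / real (f x :: nat)) \<longlongrightarrow> 0) \<F>"
  by (rule tendsto_divide_0[OF tendsto_const])
    (rule filterlim_at_top_imp_at_infinity, rule filterlim_compose[OF filterlim_real_sequentially])

lemma turan_err_tendsto:
  assumes "filterlim f at_top \<F>" shows "((\<lambda>x. turan_err k r (f x)) \<longlongrightarrow> 0) \<F>"
proof -
  have "((\<lambda>x. real (r choose k) * ((1 / real r) ^ k - (1 / real r - 1 / real (f x)) ^ k))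
      \<longlongrightarrow> real (r choose k) * ((1 / real r) ^ k - (1 / real r - 0) ^ k)) \<F>"
    by (intro tendsto_intros inverse_size_tendsto assms)
  then show ?thesis by (simp add: turan_err_def)
qed

text \<open>The place where \<open>k >= 3\<close> makes red edges, or hyperedges with a pair that is
  not thick, a lower-order term.\<close>

lemma square_le_power:
  assumes "3 \<le> k" "n > 0" shows "real n ^ 2 \<le> 1 / real n * real n ^ k"
proof -
  have "real n ^ k = real n * real n ^ (k - 1)" using assms by (simp flip: power_Suc)
  moreover have "real n ^ 2 \<le> real n ^ (k - 1)" using assms by (intro power_increasing) auto
  ultimately show ?thesis using assms by simp
qed

locale berge_problem =
  fixes k r :: nat and F :: "'f hypergraph"
  assumes k3: "3 \<le> k" and grF: "is_graph F" and chi: "chromatic_number F = Suc r" and kr: "k \<le> r"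
begin

abbreviation "V \<equiv> (verts :: nat blue_red_graph \<Rightarrow> nat set)"
abbreviation "sz \<equiv> (\<lambda>G :: nat blue_red_graph. card (verts G))"
abbreviation "E \<equiv> (adj :: nat blue_red_graph \<Rightarrow> nat \<Rightarrow> nat \<Rightarrow> bool)"
abbreviation "Eb \<equiv> (\<lambda>G :: nat blue_red_graph. adj (blue_part G))"

definition extremal :: "nat blue_red_graph set" where
  "extremal = {G. G \<in> free_blue_red_graphs (sz G) F \<and> g k G = ex_col k (sz G) F}"

text \<open>Convergence along the following two filters is convergence for \<open>n \<rightarrow> \<infinity>\<close>, uniformly over the
  extremal objects on \<open>n\<close> vertices.\<close>

definition colF :: "nat blue_red_graph filter" where
  "colF = inf (filtercomap sz at_top) (principal extremal)"

definition bergeF :: "nat hypergraph filter" where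
  "bergeF = inf (filtercomap (\<lambda>H. card (verts H)) at_top)
     (principal {H. H \<in> berge_free_hypergraphs k (card (verts H)) F \<and> card (edges H) = ex_berge k (card (verts H)) F})"

lemma r0: "r > 0" "r \<ge> 3" using k3 kr by auto

lemma hyF: "is_hypergraph F" using grF by (simp add: uniform_def)

lemma coloringF: obtains c where "proper_coloring F (Suc r) c"
  using chromatic_coloring[OF grF] chi by auto

lemma chi_gt: "r < chromatic_number F" by (simp add: chi)

lemma colF_extremal: "\<forall>\<^sub>F G in colF. G \<in> extremal"
  by (simp add: colF_def eventually_inf_principal)

lemma colF_size: "filterlim sz at_top colF"
  unfolding colF_def by (rule filterlim_mono[OF filterlim_filtercomap order_refl]) simp

lemma extremalD:
  assumes "G \<in> extremal"
  shows "is_graph G" "\<not> emb F (V G) (E G)" "G \<in> free_blue_red_graphs (sz G) F" "g k G = ex_col k (sz G) F"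
    "fgraph (V G) (E G)" "fgraph (V G) (Eb G)" "finite (V G)"
proof -
  show 1: "is_graph G" "G \<in> free_blue_red_graphs (sz G) F" "g k G = ex_col k (sz G) F"
    using assms by (auto simp: extremal_def free_blue_red_graphs_def)
  then show "\<not> emb F (V G) (E G)" using free_of_iff[OF grF] by (auto simp: free_blue_red_graphs_def)
  show "fgraph (V G) (E G)" by (rule graph_fgraph[OF 1(1)])
  show "fgraph (V G) (Eb G)" using graph_fgraph[OF graph_blue_part[OF 1(1)]] by simp
  show "finite (V G)" by (rule graph_finite[OF 1(1)])
qed

lemma Eb_E: "Eb G x y \<Longrightarrow> E G x y"
  by (simp add: adj_blue_part)

lemma colF_dens: "((\<lambda>G. dens (V G) (E G) (Suc r)) \<longlongrightarrow> 0) colF" "((\<lambda>G. dens (V G) (Eb G) (Suc r)) \<longlongrightarrow> 0) colF"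
proof -
  obtain c where c: "proper_coloring F (Suc r) c" by (rule coloringF)
  show "((\<lambda>G. dens (V G) (E G) (Suc r)) \<longlongrightarrow> 0) colF"
    by (rule free_dens_tendsto_0[OF _ colF_size hyF c])
      (use colF_extremal in \<open>auto elim!: eventually_mono dest: extremalD\<close>)
  show "((\<lambda>G. dens (V G) (Eb G) (Suc r)) \<longlongrightarrow> 0) colF"
  proof (rule free_dens_tendsto_0[OF _ colF_size hyF c])
    show "\<forall>\<^sub>F G in colF. fgraph (V G) (Eb G)"
      using colF_extremal by (auto elim!: eventually_mono dest: extremalD)
    show "\<forall>\<^sub>F G in colF. \<not> emb F (V G) (Eb G)"
      using colF_extremal
    proof eventually_elim
      case (elim G)
      then show ?case using extremalD(2)[OF elim] emb_mono[of F "V G" "Eb G" "E G"] Eb_E by blast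
    qed
  qed
qed

text \<open>The second summand pays for the red edges, at most n^2 in number.\<close>

definition errc :: "nat blue_red_graph \<Rightarrow> real" where
  "errc G = turan_err k r (sz G) + 1 / real (sz G)"

lemma errc: "(errc \<longlongrightarrow> 0) colF"
  unfolding errc_def[abs_def]
  using tendsto_add[OF turan_err_tendsto[OF colF_size] inverse_size_tendsto[OF colF_size]] by simp

lemma colF_large: "\<forall>\<^sub>F G in colF. N \<le> sz G"
  using colF_size unfolding filterlim_at_top by blast

lemma colF_lower: "\<forall>\<^sub>F G in colF. real (card (clq (V G) (Eb G) k)) \<ge> (real (r choose k) / real r ^ k - errc G) * real (sz G) ^ k"
  using colF_extremal colF_large[of r]
proof eventually_elim
  case (elim G)
  note ex = extremalD[OF elim(1)]
  have n: "sz G > 0" using elim(2) r0 by simp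
  have "real (r choose k) * (real (sz G) / real r - 1) ^ k \<le> real (ex_col k (sz G) F)"
    by (rule ex_col_ge[OF grF chi_gt r0(1) elim(2)])
  also have "\<dots> = real (card (clq (V G) (Eb G) k)) + real (card (edges (red_part G)))"
    using ex(4) g_eq[OF ex(1), of k] by simp
  also have "real (card (edges (red_part G))) \<le> 1 / real (sz G) * real (sz G) ^ k"
  proof -
    have "card (edges (red_part G)) \<le> card {e. e \<subseteq> V G \<and> card e = 2}"
      by (rule card_mono) (use ex(1,7) in \<open>auto simp: red_part_def uniform_def is_hypergraph_def\<close>)
    also have "\<dots> = sz G choose 2" by (rule n_subsets[OF ex(7)])
    also have "\<dots> \<le> sz G ^ 2" by (rule binomial_le_power)
    finally have "real (card (edges (red_part G))) \<le> real (sz G) ^ 2" by (metis of_nat_le_iff of_nat_power)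
    then show ?thesis using square_le_power[OF k3 n] by linarith
  qed
  finally show ?case unfolding turan_err_eq[OF n] errc_def by (simp add: algebra_simps)
qed

section \<open>Minimum degree of extremal graphs and hypergraphs\<close>

lemma col_degree:
  assumes "\<eta> > 0"
  shows "\<forall>\<^sub>F G in colF. \<forall>u\<in>V G.
    (1 - \<eta>) * real ((r - 1) choose (k - 1)) * (real (sz G) / real r) ^ (k - 1)
     \<le> real (card {S \<in> blue_cliques k G. u \<in> verts S} + card {e \<in> edges (red_part G). u \<in> e})"
proof -
  have "\<forall>\<^sub>F G in colF. \<forall>u\<in>V G. \<exists>W \<L>.
     common_link (V G) (clq (V G) (Eb G) k) (Suc (card (verts F))) k u W \<L> \<and>
     real (card \<L>) \<ge> (1 - \<eta>) * real ((r - 1) choose (k - 1)) * (real (card (V G)) / real r) ^ (k - 1)"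
  \<comment> \<open>Here \<open>H\<close> consists of cliques of the blue relation, so its error
    \<open>e'\<close> is 0.\<close>
  proof (rule asymptotic_common_link[OF _ colF_size _ kr colF_dens(2) _ errc tendsto_const colF_lower _ assms])
    show "\<forall>\<^sub>F G in colF. fgraph (V G) (Eb G)"
      using colF_extremal by (auto elim!: eventually_mono dest: extremalD)
    show "\<forall>\<^sub>F G in colF. clq (V G) (Eb G) k \<subseteq> {K. K \<subseteq> V G \<and> card K = k}"
      by (rule always_eventually) (auto simp: clq_def)
  qed (use k3 in auto)
  then show ?thesis
    using colF_extremal
  proof eventually_elim
    case (elim G)
    note ex = extremalD[OF elim(2)]
    show ?case
    proof
      fix u assume u: "u \<in> V G"
      with elim(1) obtain W \<L> where W: "common_link (V G) (clq (V G) (Eb G) k) (Suc (card (verts F))) k u W \<L>"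
        and L: "real (card \<L>) \<ge> (1 - \<eta>) * real ((r - 1) choose (k - 1)) * (real (card (V G)) / real r) ^ (k - 1)"
        by blast
      have "card \<L> \<le> card {S \<in> blue_cliques k G. u \<in> verts S} + card {e \<in> edges (red_part G). u \<in> e}"
        by (rule clone_col[OF grF ex(3,4) u W]) (use k3 in auto)
      then show "(1 - \<eta>) * real ((r - 1) choose (k - 1)) * (real (sz G) / real r) ^ (k - 1)
         \<le> real (card {S \<in> blue_cliques k G. u \<in> verts S} + card {e \<in> edges (red_part G). u \<in> e})"
        using L by linarith
    qed
  qed
qed

lemma berge_degree:
  assumes "\<eta> > 0"
  shows "\<forall>\<^sub>F H in bergeF. \<forall>u\<in>verts H.
    (1 - \<eta>) * real ((r - 1) choose (k - 1)) * (real (card (verts H)) / real r) ^ (k - 1)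
     \<le> real (card {h \<in> edges H. u \<in> h})"
proof -
  let ?n = "\<lambda>H :: nat hypergraph. card (verts H)" and ?q = "card (edges F)"
  have mem: "\<forall>\<^sub>F H in bergeF. H \<in> berge_free_hypergraphs k (?n H) F \<and> card (edges H) = ex_berge k (?n H) F"
    by (simp add: bergeF_def eventually_inf_principal)
  have size: "filterlim ?n at_top bergeF"
    unfolding bergeF_def by (rule filterlim_mono[OF filterlim_filtercomap order_refl]) simp
  have large: "\<forall>\<^sub>F H in bergeF. r \<le> ?n H"
    using size unfolding filterlim_at_top by blast
  have hy: "is_hypergraph H" "uniform k H" "berge_free F H" if "H \<in> berge_free_hypergraphs k n F" for H n
    using that by (auto simp: berge_free_hypergraphs_def uniform_def)
  obtain c where c: "proper_coloring F (Suc r) c" by (rule coloringF)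
  have fg: "\<forall>\<^sub>F H in bergeF. fgraph (verts H) (thick ?q H)"
    using mem by eventually_elim (auto intro: thick_fgraph hy)
  have dens0: "((\<lambda>H. dens (verts H) (thick ?q H) (Suc r)) \<longlongrightarrow> 0) bergeF"
  proof (rule free_dens_tendsto_0[OF fg size hyF c])
    show "\<forall>\<^sub>F H in bergeF. \<not> emb F (verts H) (thick ?q H)"
      using mem by eventually_elim (auto dest: berge_free_thick[OF grF hy(1) hy(3)])
  qed
  have "\<forall>\<^sub>F H in bergeF. \<forall>u\<in>verts H. \<exists>W \<L>.
     common_link (verts H) (edges H) (Suc (card (verts F) + ?q * k)) k u W \<L> \<and>
     real (card \<L>) \<ge> (1 - \<eta>) * real ((r - 1) choose (k - 1)) * (real (card (verts H)) / real r) ^ (k - 1)"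
  \<comment> \<open>The choice of \<open>e'\<close> reflects \<open>card_thin_edges\<close>: qn^2 is
    at most (q/n)n^k.\<close>
  proof (rule asymptotic_common_link[OF fg size _ kr dens0 _ turan_err_tendsto[OF size, of k r], where e' = "\<lambda>H. real ?q * (1 / real (?n H))"])
    show "2 \<le> k" using k3 by simp
    show "\<forall>\<^sub>F H in bergeF. edges H \<subseteq> {K. K \<subseteq> verts H \<and> card K = k}"
      using mem
    proof eventually_elim
      case (elim H)
      then have "uniform k H" using hy(2) by blast
      then show ?case unfolding uniform_def is_hypergraph_def by blast
    qed
    show "((\<lambda>H. real ?q * (1 / real (?n H))) \<longlongrightarrow> 0) bergeF"
      using tendsto_mult[OF tendsto_const inverse_size_tendsto[OF size]] by simp
    show "\<forall>\<^sub>F H in bergeF. (real (r choose k) / real r ^ k - turan_err k r (?n H)) * real (?n H) ^ k \<le> real (card (edges H))"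
      using mem large
    proof eventually_elim
      case (elim H)
      then have "?n H > 0" using r0 by simp
      from ex_berge_ge[OF grF chi_gt r0(1) elim(2), of k] show ?case
        unfolding turan_err_eq[OF \<open>?n H > 0\<close>] using elim(1) by simp
    qed
    show "\<forall>\<^sub>F H in bergeF. real (card (edges H - clq (verts H) (thick ?q H) k)) \<le> real ?q * (1 / real (?n H)) * real (?n H) ^ k"
      using mem large
    proof eventually_elim
      case (elim H)
      then have n: "?n H > 0" using r0 by simp
      have "card (edges H - clq (verts H) (thick ?q H) k) \<le> ?q * (?n H)\<^sup>2"
        using card_thin_edges[OF hy(2), of H "?n H" ?q] elim(1) by blast
      then have "real (card (edges H - clq (verts H) (thick ?q H) k)) \<le> real (?q * (?n H)\<^sup>2)"
        by (simp only: of_nat_le_iff)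
      also have "\<dots> = real ?q * real (?n H) ^ 2" by simp
      also have "\<dots> \<le> real ?q * (1 / real (?n H) * real (?n H) ^ k)"
        by (intro mult_left_mono square_le_power[OF k3 n]) simp
      finally show ?case by (simp only: mult.assoc)
    qed
  qed (rule assms)
  then show ?thesis
    using mem
  proof eventually_elim
    case (elim H)
    show ?case
    proof
      fix u assume u: "u \<in> verts H"
      with elim(1) obtain W \<L> where W: "common_link (verts H) (edges H) (Suc (card (verts F) + ?q * k)) k u W \<L>"
        and L: "real (card \<L>) \<ge> (1 - \<eta>) * real ((r - 1) choose (k - 1)) * (real (card (verts H)) / real r) ^ (k - 1)"
        by blast
      have "card \<L> \<le> card {h \<in> edges H. u \<in> h}"
        by (rule clone_berge[OF grF _ _ u W]) (use elim k3 in auto)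
      then show "(1 - \<eta>) * real ((r - 1) choose (k - 1)) * (real (card (verts H)) / real r) ^ (k - 1)
         \<le> real (card {h \<in> edges H. u \<in> h})" using L by linarith
    qed
  qed
qed

section \<open>Neighbourhoods of single vertices\<close>

abbreviation "near \<rho> G p \<equiv> nearly_turan (V G) (Eb G) (E G) r \<rho> p"

lemma col_near:
  assumes \<rho>: "\<rho> > 0"
  shows "\<forall>\<^sub>F G in colF. \<forall>p. opt_partition (V G) (E G) r p \<longrightarrow> near \<rho> G p"
proof -
  have fg: "\<forall>\<^sub>F G in colF. fgraph (V G) (Eb G)" "\<forall>\<^sub>F G in colF. fgraph (V G) (E G)"
    using colF_extremal by (auto elim!: eventually_mono dest: extremalD)
  have err: "((\<lambda>G. fact k * errc G) \<longlongrightarrow> 0) colF"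
    using tendsto_mult[OF tendsto_const errc] by simp
  have low: "\<forall>\<^sub>F G in colF. dens (V G) (Eb G) k \<ge> (\<Prod>i<k. 1 - real i / real r) - fact k * errc G"
    using colF_lower colF_large[of 1] by eventually_elim (intro dens_lower kr r0, auto)
  have k2: "2 \<le> k" using k3 by simp
  obtain \<theta> where \<theta>: "(\<theta> \<longlongrightarrow> 0) colF"
    "\<forall>\<^sub>F G in colF. \<forall>p. opt_partition (V G) (E G) r p \<longrightarrow>
       near (\<theta> G) G p"
    by (rule stability[OF fg Eb_E colF_size k2 kr colF_dens(1) err low])
  have "\<forall>\<^sub>F G in colF. \<theta> G < \<rho>" by (rule order_tendstoD(2)[OF \<theta>(1) \<rho>])
  with \<theta>(2) show ?thesis
  proof eventually_elim
    case (elim G)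
    have "\<theta> G * (real (sz G))\<^sup>2 \<le> \<rho> * (real (sz G))\<^sup>2" "\<theta> G * real (sz G) \<le> \<rho> * real (sz G)"
      using elim(2) by (auto intro!: mult_right_mono)
    then show ?case using elim(1) unfolding nearly_turan_def by (meson order_trans)
  qed
qed

text \<open>The number of (k-1)-transversals of r - 1 parts of size n/r, divided by n^(k-1): the
  k-clique degree in the Turan graph.\<close>

definition Cr :: real where "Cr = real ((r - 1) choose (k - 1)) / real r ^ (k - 1)"

lemma Cr_pos: "Cr > 0" using kr k3 r0 by (simp add: Cr_def)

text \<open>The degree bound in the form needed from here on. Three losses of \<rho>/3 occur: in the
  degree bound itself, for cliques in the neighbourhood that are not transversals, and for the red
  edges at \<open>u\<close>, of which there are at most n.\<close>

lemma col_link: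
  assumes \<rho>: "\<rho> > 0"
  shows "\<forall>\<^sub>F G in colF. \<forall>p. opt_partition (V G) (E G) r p \<longrightarrow> (\<forall>u\<in>V G.
    (Cr - \<rho>) * real (sz G) ^ (k - 1) \<le> real (card (transversals (ext (V G) (Eb G) {u}) p {..<r} (k - 1))))"
proof -
  define \<eta> where "\<eta> = \<rho> / (3 * Cr)"
  have \<eta>: "\<eta> > 0" using \<rho> Cr_pos by (simp add: \<eta>_def)
  have inv: "\<forall>\<^sub>F G in colF. 1 / real (sz G) < \<rho> / 3"
    by (rule order_tendstoD(2)[OF inverse_size_tendsto[OF colF_size]]) (use \<rho> in simp)
  have "\<rho> / 3 > 0" using \<rho> by simp
  from col_near[OF this] show ?thesis
    using col_degree[OF \<eta>] colF_extremal colF_large[of 1] inv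
  proof eventually_elim
    case (elim G)
    note ex = extremalD[OF elim(3)]
    interpret B: fgraph "V G" "Eb G" by (rule ex(6))
    let ?n = "real (sz G)"
    have n: "?n > 0" "sz G > 0" using elim(4) by auto
    have np: "?n ^ (k - 1) \<ge> 0" by simp
    show ?case
    proof (intro allI impI ballI)
      fix p u assume p: "opt_partition (V G) (E G) r p" and u: "u \<in> V G"
      have pr: "\<forall>v. p v < r" using p by (simp add: opt_partition_def)
      let ?N = "ext (V G) (Eb G) {u}"
      have NV: "?N \<subseteq> V G" by (auto simp: ext_def)
      have "card (inside (V G) (Eb G) p) \<le> card (inside (V G) (E G) p)"
        by (rule card_mono[OF fgraph.finite_inside[OF ex(5)]]) (use Eb_E in \<open>auto simp: inside_def\<close>)
      moreover have "near (\<rho> / 3) G p" using elim(1) p by blast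
      ultimately have ins: "real (card (inside (V G) (Eb G) p)) \<le> \<rho> / 3 * ?n\<^sup>2" by (simp add: nearly_turan_def)
      have "(1 - \<eta>) * Cr * ?n ^ (k - 1) = (1 - \<eta>) * real ((r - 1) choose (k - 1)) * (?n / real r) ^ (k - 1)"
        by (simp add: Cr_def power_divide)
      also have "\<dots> \<le> real (card {S \<in> blue_cliques k G. u \<in> verts S}) + real (card {e \<in> edges (red_part G). u \<in> e})"
        using elim(2) u by simp
      also have "real (card {S \<in> blue_cliques k G. u \<in> verts S}) \<le> real (card (clq ?N (Eb G) (k - 1)))"
        unfolding card_blue_cliques_at[OF ex(1)] using B.card_clq_at by simp
      also have "real (card (clq ?N (Eb G) (k - 1))) \<le> \<rho> / 3 * ?n ^ (k - 1) + real (card (transversals ?N p {..<r} (k - 1)))"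
        by (rule B.card_clq_le_transversals[OF NV pr n(2) ins])
      also have "real (card {e \<in> edges (red_part G). u \<in> e}) \<le> \<rho> / 3 * ?n ^ (k - 1)"
      proof -
        have "{e \<in> edges (red_part G). u \<in> e} \<subseteq> (\<lambda>v. {u, v}) ` V G"
        proof
          fix e assume "e \<in> {e \<in> edges (red_part G). u \<in> e}"
          then have e: "e \<in> edges G" "u \<in> e" by (auto simp: red_part_def)
          obtain x y where xy: "e = {x, y}" "x \<in> V G" "y \<in> V G" using graph_edgeE[OF ex(1) e(1)] by metis
          then consider "u = x" | "u = y" using e(2) by auto
          then show "e \<in> (\<lambda>v. {u, v}) ` V G" using xy by cases auto
        qed
        then have "card {e \<in> edges (red_part G). u \<in> e} \<le> card ((\<lambda>v. {u, v}) ` V G)"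
          by (rule card_mono[rotated]) (use ex(7) in simp)
        also have "\<dots> \<le> sz G" by (rule card_image_le[OF ex(7)])
        finally have "real (card {e \<in> edges (red_part G). u \<in> e}) \<le> ?n ^ 1" by simp
        also have "\<dots> = 1 / ?n * ?n ^ 2" using n by (simp add: power2_eq_square)
        also have "\<dots> \<le> \<rho> / 3 * ?n ^ (k - 1)"
          using elim(5) n k3 \<rho> by (intro mult_mono power_increasing) auto
        finally show ?thesis .
      qed
      finally have "(1 - \<eta>) * Cr * ?n ^ (k - 1) \<le> \<rho> / 3 * ?n ^ (k - 1) + real (card (transversals ?N p {..<r} (k - 1))) + \<rho> / 3 * ?n ^ (k - 1)"
        by simp
      moreover have "(1 - \<eta>) * Cr * ?n ^ (k - 1) = (Cr - \<rho> / 3) * ?n ^ (k - 1)"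
        using Cr_pos by (simp add: \<eta>_def left_diff_distrib)
      moreover have "(Cr - \<rho> / 3) * ?n ^ (k - 1) = (Cr - \<rho>) * ?n ^ (k - 1) + \<rho> / 3 * ?n ^ (k - 1) + \<rho> / 3 * ?n ^ (k - 1)"
        by (simp add: algebra_simps)
      ultimately show "(Cr - \<rho>) * ?n ^ (k - 1) \<le> real (card (transversals ?N p {..<r} (k - 1)))"
        by linarith
    qed
  qed
qed

text \<open>Chosen so that two parts with at most \<open>cc * n\<close> neighbours each contribute
  at most 2cc = 1/(2r^(k-1)). By Pascal's rule, losing two parts instead of one costs at least
  1/r^(k-1), twice as much.\<close>

definition cc :: real where "cc = 1 / (4 * real r ^ (k - 1))"

lemma cc_pos: "cc > 0" using r0 by (simp add: cc_def)

lemma near_part: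
  assumes "near \<rho> G p" "i < r"
  shows "(1 / real r - \<rho>) * real (sz G) \<le> real (card (part (V G) p i))"
    "real (card (part (V G) p i)) \<le> (1 / real r + \<rho>) * real (sz G)"
proof -
  have "\<bar>real (card (part (V G) p i)) - real (sz G) / real r\<bar> \<le> \<rho> * real (sz G)"
    using assms by (simp add: nearly_turan_def)
  then show "(1 / real r - \<rho>) * real (sz G) \<le> real (card (part (V G) p i))"
    "real (card (part (V G) p i)) \<le> (1 / real r + \<rho>) * real (sz G)"
    by (auto simp: algebra_simps abs_le_iff)
qed

lemma col_all_but_one:
  "\<forall>\<^sub>F G in colF. \<forall>p. opt_partition (V G) (E G) r p \<longrightarrow> (\<forall>u\<in>V G.
     \<exists>i0<r. \<forall>i<r. i \<noteq> i0 \<longrightarrow> cc * real (sz G) \<le> real (card (part (ext (V G) (Eb G) {u}) p i)))"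
proof -
  \<comment> \<open>The gap between the degree bound and what is possible with two poor parts. It is
    positive at \<rho> = 0 by Pascal's rule, hence for some \<rho> > 0.\<close>
  define f where "f \<rho> = Cr - \<rho> - (2 * cc + real ((r - 2) choose (k - 1)) * (1 / real r + \<rho>) ^ (k - 1))" for \<rho>
  have lim: "(f \<longlongrightarrow> Cr - 0 - (2 * cc + real ((r - 2) choose (k - 1)) * (1 / real r + 0) ^ (k - 1))) (at_right 0)"
    unfolding f_def by (intro tendsto_intros)
  have pos: "Cr - 0 - (2 * cc + real ((r - 2) choose (k - 1)) * (1 / real r + 0) ^ (k - 1)) > 0"
  proof -
    have "r - 1 = Suc (r - 2)" "k - 1 = Suc (k - 2)" using r0 k3 by auto
    then have "(r - 1) choose (k - 1) = (r - 2 choose (k - 2)) + (r - 2 choose (k - 1))" by simp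
    then have "real ((r - 1) choose (k - 1)) = real (r - 2 choose (k - 2)) + real (r - 2 choose (k - 1))" by simp
    moreover have "(r - 2) choose (k - 2) \<ge> 1" using kr by (simp add: Suc_leI)
    then have "real ((r - 2) choose (k - 2)) \<ge> 1" by simp
    ultimately have "1 \<le> real ((r - 1) choose (k - 1)) - real ((r - 2) choose (k - 1))" by simp
    then have "1 / real r ^ (k - 1) \<le> (real ((r - 1) choose (k - 1)) - real ((r - 2) choose (k - 1))) / real r ^ (k - 1)"
      by (intro divide_right_mono) auto
    moreover have "2 * cc = 1 / real r ^ (k - 1) / 2" by (simp add: cc_def)
    moreover have "1 / real r ^ (k - 1) > 0" using r0 by simp
    moreover have L: "Cr - 0 - (2 * cc + real ((r - 2) choose (k - 1)) * (1 / real r + 0) ^ (k - 1))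
        = (real ((r - 1) choose (k - 1)) - real ((r - 2) choose (k - 1))) / real r ^ (k - 1) - 2 * cc"
      by (simp add: Cr_def power_divide diff_divide_distrib)
    moreover have "0 < L" if "y \<le> d" "c = y / 2" "0 < y" "L = d - c" for y d c L :: real
      using that by simp
    ultimately show ?thesis by blast
  qed
  have "\<forall>\<^sub>F \<rho> in at_right 0. 0 < f \<rho>" by (rule order_tendstoD(1)[OF lim pos])
  then have "\<forall>\<^sub>F \<rho> in at_right (0::real). 0 < f \<rho> \<and> 0 < \<rho>"
    using eventually_at_right_less[of "0::real"] by eventually_elim auto
  then obtain \<rho> where \<rho>: "f \<rho> > 0" "\<rho> > 0" using eventually_happens' trivial_limit_at_right_real by blast
  show ?thesis
    using col_link[OF \<rho>(2)] col_near[OF \<rho>(2)] colF_extremal colF_large[of 1]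
  proof eventually_elim
    case (elim G)
    note ex = extremalD[OF elim(3)]
    let ?n = "real (sz G)"
    have n: "?n > 0" using elim(4) by auto
    show ?case
    proof (intro allI impI ballI, rule ccontr)
      fix p u assume p: "opt_partition (V G) (E G) r p" and u: "u \<in> V G"
      let ?N = "ext (V G) (Eb G) {u}"
      assume neg: "\<not> (\<exists>i0<r. \<forall>i<r. i \<noteq> i0 \<longrightarrow> cc * ?n \<le> real (card (part ?N p i)))"
      \<comment> \<open>The negated claim is used at one index to find a poor part \<open>i\<close>,
        and then at \<open>i\<close> itself to find a second one.\<close>
      obtain i where i: "i < r" "real (card (part ?N p i)) \<le> cc * ?n" using neg r0(1) by force
      obtain j where j: "j < r" "j \<noteq> i" "real (card (part ?N p j)) \<le> cc * ?n" using neg i(1) by force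
      have NV: "?N \<subseteq> V G" by (auto simp: ext_def)
      have nr: "near \<rho> G p" using elim(2) p by blast
      have "real (card (transversals ?N p {..<r} (k - 1))) \<le>
        real (card {i, j}) * (cc * ?n) * ?n ^ (k - 1 - 1) + real (card (transversals ?N p ({..<r} - {i, j}) (k - 1)))"
        by (rule transversals_le_hitting[OF ex(7) NV refl]) (use i j k3 in auto)
      also have "real (card {i, j}) * (cc * ?n) * ?n ^ (k - 1 - 1) = 2 * cc * ?n ^ (k - 1)"
      proof -
        have "k - 1 = Suc (k - 1 - 1)" using k3 by simp
        then have "?n ^ (k - 1) = ?n * ?n ^ (k - 1 - 1)" by (metis power_Suc)
        then show ?thesis using j(2) by simp
      qed
      also have "real (card (transversals ?N p ({..<r} - {i, j}) (k - 1)))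
          \<le> real (card (transversals (V G) p ({..<r} - {i, j}) (k - 1)))"
        using card_mono[OF finite_transversals[OF ex(7)] transversals_mono[OF NV]] by simp
      also have "\<dots> \<le> real (card ({..<r} - {i, j}) choose (k - 1)) * ((1 / real r + \<rho>) * ?n) ^ (k - 1)"
        by (rule card_transversals_le[OF ex(7)]) (use near_part(2)[OF nr] \<rho> in auto)
      also have "card ({..<r} - {i, j}) = r - 2" using i j by (subst card_Diff_subset) auto
      finally have "real (card (transversals ?N p {..<r} (k - 1)))
          \<le> (2 * cc + real ((r - 2) choose (k - 1)) * (1 / real r + \<rho>) ^ (k - 1)) * ?n ^ (k - 1)"
        unfolding power_mult_distrib by (simp add: algebra_simps)
      moreover have "(Cr - \<rho>) * ?n ^ (k - 1) \<le> real (card (transversals ?N p {..<r} (k - 1)))"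
        using elim(1) p u by blast
      ultimately have "(Cr - \<rho>) * ?n ^ (k - 1) \<le> (2 * cc + real ((r - 2) choose (k - 1)) * (1 / real r + \<rho>) ^ (k - 1)) * ?n ^ (k - 1)"
        by linarith
      then have "Cr - \<rho> \<le> 2 * cc + real ((r - 2) choose (k - 1)) * (1 / real r + \<rho>) ^ (k - 1)"
        using n by simp
      then show False using \<rho>(1) by (simp add: f_def)
    qed
  qed
qed

text \<open>Such a vertex draws almost all its transversals from the other r - 1 parts, whose total
  barely exceeds the degree bound. Each vertex missed in part \<open>j\<close> destroys of the order
  of n^(k-2) of them, so few can be missed.\<close>

lemma col_nearly_complete:
  assumes \<epsilon>: "\<epsilon> > 0"
  shows "\<forall>\<^sub>F G in colF. \<forall>p. opt_partition (V G) (E G) r p \<longrightarrow> (\<forall>v\<in>V G.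
     real (card (part (ext (V G) (Eb G) {v}) p (p v))) \<le> \<epsilon> * real (sz G) \<longrightarrow>
     (\<forall>j<r. j \<noteq> p v \<longrightarrow> real (card (part (V G) p j - ext (V G) (Eb G) {v})) \<le> \<epsilon> * (2 * real r ^ k + 1) * real (sz G)))"
proof -
  define s where "s = k - 2"
  have ks: "k - 1 = Suc s" using k3 by (simp add: s_def)
  let ?R = "1 / real r"
  \<comment> \<open>\<open>f\<close> bounds the proportion of transversals that may be lost. As
    \<rho> tends to 0 it tends to \<epsilon>, since the binomial term cancels against
    \<open>Cr\<close>.\<close>
  define f where "f \<rho> = \<epsilon> + real ((r - 1) choose (k - 1)) * (?R + \<rho>) ^ (k - 1) - Cr + \<rho>" for \<rho>
  have "(f \<longlongrightarrow> \<epsilon> + real ((r - 1) choose (k - 1)) * (?R + 0) ^ (k - 1) - Cr + 0) (at_right 0)"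
    unfolding f_def by (intro tendsto_intros)
  then have "(f \<longlongrightarrow> \<epsilon>) (at_right 0)" by (simp add: Cr_def power_divide)
  then have 1: "\<forall>\<^sub>F \<rho> in at_right 0. f \<rho> < 2 * \<epsilon>" by (rule order_tendstoD) (use \<epsilon> in simp)
  have "((\<lambda>\<rho>. (?R - \<rho>) ^ s) \<longlongrightarrow> (?R - 0) ^ s) (at_right 0)" by (intro tendsto_intros)
  then have 2: "\<forall>\<^sub>F \<rho> in at_right 0. (?R - \<rho>) ^ s > ?R ^ s / 2" by (rule order_tendstoD) (use r0 in simp)
  have "((\<lambda>\<rho>::real. \<rho>) \<longlongrightarrow> 0) (at_right 0)" by (rule tendsto_ident_at)
  then have 3: "\<forall>\<^sub>F \<rho> in at_right 0. \<rho> < ?R" by (rule order_tendstoD) (use r0 in simp)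
  have "\<forall>\<^sub>F \<rho> in at_right (0::real). f \<rho> < 2 * \<epsilon> \<and> (?R - \<rho>) ^ s > ?R ^ s / 2 \<and> \<rho> < ?R \<and> 0 < \<rho>"
    using 1 2 3 eventually_at_right_less[of "0::real"] by eventually_elim auto
  then obtain \<rho> where \<rho>: "f \<rho> < 2 * \<epsilon>" "(?R - \<rho>) ^ s > ?R ^ s / 2" "\<rho> < ?R" "\<rho> > 0"
    using eventually_happens' trivial_limit_at_right_real by blast
  show ?thesis
    using col_link[OF \<rho>(4)] col_near[OF \<rho>(4)] colF_extremal colF_large[of 1]
  proof eventually_elim
    case (elim G)
    note ex = extremalD[OF elim(3)]
    let ?n = "real (sz G)"
    have n: "?n > 0" using elim(4) by auto
    show ?case
    proof (intro allI impI ballI)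
      fix p v j assume p: "opt_partition (V G) (E G) r p" and v: "v \<in> V G"
        and small: "real (card (part (ext (V G) (Eb G) {v}) p (p v))) \<le> \<epsilon> * ?n" and j: "j < r" "j \<noteq> p v"
      let ?N = "ext (V G) (Eb G) {v}"
      let ?J = "{..<r} - {p v}"
      define x where "x = real (card (part (V G) p j - ?N))"
      have pv: "p v < r" using p by (simp add: opt_partition_def)
      have NV: "?N \<subseteq> V G" by (auto simp: ext_def)
      have nr: "near \<rho> G p" using elim(2) p by blast
      have cJ: "card ?J = r - 1" "card (?J - {j}) = r - 2" using pv j by auto
      have s1: "k - 1 - 1 = s" by (simp add: s_def)
      have nk: "?n ^ (k - 1) = ?n * ?n ^ s" unfolding ks by simp
      have "real (card (transversals ?N p {..<r} (k - 1))) \<le>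
        real (card {p v}) * (\<epsilon> * ?n) * ?n ^ (k - 1 - 1) + real (card (transversals ?N p ?J (k - 1)))"
        by (rule transversals_le_hitting[OF ex(7) NV refl]) (use small k3 in auto)
      then have a: "real (card (transversals ?N p {..<r} (k - 1))) \<le> \<epsilon> * ?n ^ (k - 1) + real (card (transversals ?N p ?J (k - 1)))"
        unfolding nk s1 by (simp add: mult.assoc)
      have "card (transversals ?N p ?J (k - 1)) + card (part (V G) p j - ?N) * card (transversals (V G) p (?J - {j}) (k - 1 - 1))
          \<le> card (transversals (V G) p ?J (k - 1))"
        by (rule transversals_missing[OF ex(7) NV]) (use j k3 in auto)
      then have "real (card (transversals ?N p ?J (k - 1)) + card (part (V G) p j - ?N) * card (transversals (V G) p (?J - {j}) (k - 1 - 1)))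
          \<le> real (card (transversals (V G) p ?J (k - 1)))" by (simp only: of_nat_le_iff)
      then have b: "real (card (transversals ?N p ?J (k - 1))) + x * real (card (transversals (V G) p (?J - {j}) s))
          \<le> real (card (transversals (V G) p ?J (k - 1)))"
        unfolding s1 by (simp add: x_def)
      have c: "real (card (transversals (V G) p ?J (k - 1))) \<le> real ((r - 1) choose (k - 1)) * (?R + \<rho>) ^ (k - 1) * ?n ^ (k - 1)"
        using card_transversals_le[OF ex(7), of ?J "(?R + \<rho>) * ?n" p "k - 1"] near_part(2)[OF nr] \<rho> cJ
        by (simp add: power_mult_distrib)
      have "real ((r - 2) choose s) * ((?R - \<rho>) * ?n) ^ s \<le> real (card (transversals (V G) p (?J - {j}) s))"
        using card_transversals_ge[OF ex(7), of "?J - {j}" "(?R - \<rho>) * ?n" p s] near_part(1)[OF nr] \<rho> cJ(2)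
        by simp
      moreover have "1 * ((?R - \<rho>) * ?n) ^ s \<le> real ((r - 2) choose s) * ((?R - \<rho>) * ?n) ^ s"
      proof (rule mult_right_mono)
        have "(r - 2) choose s > 0" using kr by (simp add: s_def)
        then show "1 \<le> real ((r - 2) choose s)" by linarith
      qed (use \<rho> in simp)
      moreover have "?R ^ s / 2 * ?n ^ s \<le> (?R - \<rho>) ^ s * ?n ^ s"
        using \<rho>(2) by (intro mult_right_mono) auto
      ultimately have d: "?R ^ s / 2 * ?n ^ s \<le> real (card (transversals (V G) p (?J - {j}) s))"
        by (simp add: power_mult_distrib)
      have "x * (?R ^ s / 2 * ?n ^ s) \<le> x * real (card (transversals (V G) p (?J - {j}) s))"
        by (rule mult_left_mono[OF d]) (simp add: x_def)
      moreover have "(Cr - \<rho>) * ?n ^ (k - 1) \<le> real (card (transversals ?N p {..<r} (k - 1)))"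
        using elim(1) p v by blast
      ultimately have "x * (?R ^ s / 2 * ?n ^ s) \<le> f \<rho> * ?n ^ (k - 1)"
        using a b c by (simp add: f_def algebra_simps)
      also have "\<dots> \<le> 2 * \<epsilon> * ?n ^ (k - 1)" using \<rho>(1) by (intro mult_right_mono) auto
      finally have "x * (?R ^ s / 2) * ?n ^ s \<le> 2 * \<epsilon> * ?n * ?n ^ s" by (simp only: nk mult.assoc)
      then have "x * (?R ^ s / 2) \<le> 2 * \<epsilon> * ?n" using n by simp
      then have "x \<le> \<epsilon> * (4 * real r ^ s) * ?n" using r0 by (simp add: power_divide field_simps)
      \<comment> \<open>The argument gives 4r^(k-2), which is at most 2r^k because r^2 \<ge>
        2.\<close>
      also have "\<dots> \<le> \<epsilon> * (2 * real r ^ k + 1) * ?n"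
      proof (intro mult_right_mono mult_left_mono)
        have "k = s + 2" using k3 by (simp add: s_def)
        then have "real r ^ k = real r ^ s * (real r * real r)" by (simp add: power_add power2_eq_square)
        moreover have "2 * 1 \<le> real r * real r" using r0 by (intro mult_mono) auto
        then have "real r ^ s * 2 \<le> real r ^ s * (real r * real r)" by (intro mult_left_mono) auto
        ultimately show "4 * real r ^ s \<le> 2 * real r ^ k + 1" by linarith
      qed (use \<epsilon> in auto)
      finally show "real (card (part (V G) p j - ?N)) \<le> \<epsilon> * (2 * real r ^ k + 1) * ?n" by (simp add: x_def)
    qed
  qed
qed

text \<open>The set \<open>B\<close> of the theorem. If it were large, then by pigeonhole \<open>sigma F\<close> of its vertices would
  have many \<open>r\<close>-cliques in their common neighbourhood, hence a large complete \<open>r\<close>-partite graph.\<close>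

definition exceptional :: "real \<Rightarrow> nat blue_red_graph \<Rightarrow> (nat \<Rightarrow> nat) \<Rightarrow> nat set" where
  "exceptional \<epsilon> G p = {v \<in> V G. \<epsilon> * real (sz G) < real (card (part (ext (V G) (E G) {v}) p (p v)))}"

text \<open>By optimality of the partition a vertex has at least as many neighbours in each part as
  in its own.\<close>

lemma exceptional_degree:
  assumes "fgraph (V G) (E G)" "opt_partition (V G) (E G) r p" "v \<in> exceptional \<epsilon> G p" "i < r"
  shows "\<epsilon> * real (sz G) \<le> real (card (part (ext (V G) (E G) {v}) p i))"
proof -
  interpret fgraph "V G" "E G" by (rule assms)
  have eq: "part (ext (V G) (E G) {v}) p i = {w \<in> V G. E G v w \<and> p w = i}" for i
    using symE by (auto simp: part_def ext_def)
  show ?thesis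
    using opt_partition_local[OF assms(2) _ assms(4), of v] assms(3) by (simp add: exceptional_def eq)
qed

text \<open>Otherwise the common neighbourhood of \<open>S\<close> contains a large complete
  r-partite graph, which together with \<open>S\<close> contains \<open>F\<close>.\<close>

lemma col_no_common_cliques:
  assumes \<zeta>: "\<zeta> > 0"
  shows "\<forall>\<^sub>F G in colF. \<forall>S\<subseteq>V G. card S = sigma F \<longrightarrow>
    real (card (clq (ext (V G) (E G) S) (E G) r)) < \<zeta> * real (sz G) ^ r"
proof -
  have "Suc (card (verts F)) > 0" by simp
  from erdos_clq[OF \<zeta> this, where s = r and 'a = nat] obtain n0 where n0:
    "\<forall>(V :: nat set) Z E. finite V \<and> card V \<ge> n0 \<and> Z \<subseteq> V
      \<and> real (card (clq Z E r)) \<ge> \<zeta> * real (card V) ^ r \<longrightarrow>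
    (\<exists>X. (\<forall>i<r. X i \<subseteq> Z \<and> card (X i) = Suc (card (verts F))) \<and>
      (\<forall>i<r. \<forall>j<r. i \<noteq> j \<longrightarrow> (\<forall>x\<in>X i. \<forall>y\<in>X j. E x y)))"
    by (rule exE)
  show ?thesis
    using colF_extremal colF_large[of n0]
  proof eventually_elim
    case (elim G)
    note ex = extremalD[OF elim(1)]
    show ?case
    proof (intro allI impI, rule ccontr)
      fix S assume S: "S \<subseteq> V G" "card S = sigma F"
        and "\<not> real (card (clq (ext (V G) (E G) S) (E G) r)) < \<zeta> * real (sz G) ^ r"
      then have ge: "\<zeta> * real (sz G) ^ r \<le> real (card (clq (ext (V G) (E G) S) (E G) r))" by simp
      have "ext (V G) (E G) S \<subseteq> V G" by (auto simp: ext_def)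
      with n0[rule_format, of "V G" "ext (V G) (E G) S" "E G"] ge ex(7) elim(2)
      obtain X where X: "\<forall>i<r. X i \<subseteq> ext (V G) (E G) S \<and> card (X i) = Suc (card (verts F))"
        "\<forall>i<r. \<forall>j<r. i \<noteq> j \<longrightarrow> (\<forall>x\<in>X i. \<forall>y\<in>X j. E G x y)" by auto
      have "emb F (V G) (E G)"
        by (rule emb_sigma[OF grF chi ex(5) S, of X]) (use X in auto)
      then show False using ex(2) by simp
    qed
  qed
qed

lemma col_exceptional_bound:
  assumes \<epsilon>: "\<epsilon> > 0"
  shows "\<exists>K :: real. \<forall>\<^sub>F G in colF. \<forall>p. opt_partition (V G) (E G) r p \<longrightarrow>
    real (card (exceptional \<epsilon> G p)) \<le> real r * K * (real (sigma F) - 1)"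
proof -
  let ?\<sigma> = "sigma F"
  have \<sigma>: "?\<sigma> > 0" using sigma_coloring[OF grF chi] by metis
  \<comment> \<open>A vertex of the exceptional set sees (\<epsilon>n)^r transversals; at most half
    of that number is lost to missing pairs.\<close>
  define \<zeta>1 where "\<zeta>1 = \<epsilon> ^ r / 2"
  have \<zeta>1: "\<zeta>1 > 0" using \<epsilon> by (simp add: \<zeta>1_def)
  \<comment> \<open>Large enough for \<open>K0\<close> sets of density \<zeta>1 to have average
    multiplicity at least \<open>sigma F\<close>, as \<open>common_members\<close> requires.\<close>
  define K0 where "K0 = nat \<lceil>real ?\<sigma> / \<zeta>1\<rceil>"
  have K0: "real ?\<sigma> \<le> real K0 * \<zeta>1"
  proof -
    have "real ?\<sigma> / \<zeta>1 \<le> real K0" unfolding K0_def by (rule real_nat_ceiling_ge)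
    then show ?thesis using \<zeta>1 by (simp add: field_simps)
  qed
  have K0pos: "K0 > 0" using K0 \<sigma> by (cases "K0 = 0") auto
  \<comment> \<open>The first term serves the case \<open>sigma F = 1\<close>, the second is the
    proportion delivered by \<open>common_members\<close>.\<close>
  define \<zeta> where "\<zeta> = min \<zeta>1 (1 / (2 * real K0 * 2 ^ K0))"
  have \<zeta>: "\<zeta> > 0" using \<zeta>1 K0pos by (simp add: \<zeta>_def)
  show ?thesis
  proof (rule exI[of _ "real K0"])
    show "\<forall>\<^sub>F G in colF. \<forall>p. opt_partition (V G) (E G) r p \<longrightarrow>
      real (card (exceptional \<epsilon> G p)) \<le> real r * real K0 * (real ?\<sigma> - 1)"
      using col_no_common_cliques[OF \<zeta>] col_near[OF \<zeta>1] colF_extremal colF_large[of 1]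
    proof eventually_elim
      case (elim G)
      note ex = extremalD[OF elim(3)]
      interpret fgraph "V G" "E G" by (rule ex(5))
      let ?n = "real (sz G)"
      have n: "?n > 0" "sz G > 0" using elim(4) by auto
      show ?case
      proof (intro allI impI)
        fix p assume p: "opt_partition (V G) (E G) r p"
        let ?B = "exceptional \<epsilon> G p"
        have BV: "?B \<subseteq> V G" by (auto simp: exceptional_def)
        have finB: "finite ?B" using BV finV finite_subset by blast
        have "cross_missing (V G) (E G) p \<subseteq> cross_missing (V G) (Eb G) p"
          using Eb_E by (auto simp: cross_missing_def)
        then have "card (cross_missing (V G) (E G) p) \<le> card (cross_missing (V G) (Eb G) p)"
          by (rule card_mono[OF fgraph.finite_cross_missing[OF ex(6)]])
        moreover have "near \<zeta>1 G p" using elim(2) p by blast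
        ultimately have cross: "real (card (cross_missing (V G) (E G) p)) \<le> \<zeta>1 * ?n\<^sup>2" by (simp add: nearly_turan_def)
        define C where "C v = clq (ext (V G) (E G) {v}) (E G) r" for v
        have CV: "C v \<subseteq> clq (V G) (E G) r" for v unfolding C_def by (rule clq_mono) (auto simp: ext_def)
        have Cge: "\<zeta>1 * ?n ^ r \<le> real (card (C v))" if v: "v \<in> ?B" for v
        proof -
          let ?N = "ext (V G) (E G) {v}"
          have "real (card {..<r} choose r) * (\<epsilon> * ?n) ^ r \<le> real (card (transversals ?N p {..<r} r))"
            by (rule card_transversals_ge) (use finV \<epsilon> exceptional_degree[OF ex(5) p v] in \<open>auto simp: finite_ext\<close>)
          also have "\<dots> \<le> \<zeta>1 * ?n ^ r + real (card (C v))"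
            unfolding C_def by (rule card_transversals_le_clq[OF _ n(2) cross]) (auto simp: ext_def)
          finally show ?thesis by (simp add: \<zeta>1_def power_mult_distrib)
        qed
        have no: "real (card (clq (ext (V G) (E G) S) (E G) r)) < \<zeta> * ?n ^ r" if "S \<subseteq> V G" "card S = ?\<sigma>" for S
          using elim(1) that by blast
        show "real (card ?B) \<le> real r * real K0 * (real ?\<sigma> - 1)"
        \<comment> \<open>The claimed bound is 0 here, so a single exceptional vertex must already
          give a contradiction. Otherwise the factor \<open>sigma F - 1\<close> is at least 1 and
          any constant bound suffices.\<close>
        proof (cases "?\<sigma> = 1")
          case True
          have "?B = {}"
          proof (rule ccontr)
            assume "?B \<noteq> {}"
            then obtain v where v: "v \<in> ?B" by blast
            have "real (card (C v)) < \<zeta> * ?n ^ r" unfolding C_def by (rule no) (use v BV True in auto)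
            moreover have "\<zeta> * ?n ^ r \<le> \<zeta>1 * ?n ^ r" by (intro mult_right_mono) (auto simp: \<zeta>_def)
            ultimately show False using Cge[OF v] by linarith
          qed
          then show ?thesis using True by simp
        next
          case False
          then have s2: "real ?\<sigma> - 1 \<ge> 1" using \<sigma> by linarith
          have "card ?B \<le> K0"
          proof (rule ccontr)
            assume "\<not> card ?B \<le> K0"
            then obtain B' where B': "B' \<subseteq> ?B" "card B' = K0" by (meson nat_le_linear obtain_subset_with_card_n)
            have "\<exists>S\<subseteq>B'. card S = ?\<sigma> \<and> ?n ^ r / (2 * real (card B') * 2 ^ card B')
                \<le> real (card {x \<in> clq (V G) (E G) r. \<forall>v\<in>S. x \<in> C v})"
            proof (rule common_members)
              show "finite (clq (V G) (E G) r)" by (rule finite_clq[OF finV])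
              show "real (card (clq (V G) (E G) r)) \<le> ?n ^ r" by (rule card_clq_le_power)
              show "finite B'" using B' finB finite_subset by blast
              show "C v \<subseteq> clq (V G) (E G) r \<and> \<zeta>1 * ?n ^ r \<le> real (card (C v))" if "v \<in> B'" for v
                using CV Cge B'(1) that by blast
            qed (use n K0 B' \<sigma> in auto)
            then obtain S where S: "S \<subseteq> B'" "card S = ?\<sigma>"
              "?n ^ r / (2 * real K0 * 2 ^ K0) \<le> real (card {x \<in> clq (V G) (E G) r. \<forall>v\<in>S. x \<in> C v})"
              unfolding B'(2) by blast
            have "card {x \<in> clq (V G) (E G) r. \<forall>v\<in>S. x \<in> C v} \<le> card (clq (ext (V G) (E G) S) (E G) r)"
              by (rule card_mono) (auto simp: finite_clq finite_ext finV C_def clq_def ext_def)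
            then have "?n ^ r / (2 * real K0 * 2 ^ K0) < \<zeta> * ?n ^ r"
              using S no[of S] B'(1) BV by force
            also have "\<dots> \<le> 1 / (2 * real K0 * 2 ^ K0) * ?n ^ r" by (intro mult_right_mono) (auto simp: \<zeta>_def)
            finally show False by simp
          qed
          then have "real (card ?B) \<le> real K0" by simp
          also have "\<dots> = 1 * real K0 * 1" by simp
          also have "\<dots> \<le> real r * real K0 * (real ?\<sigma> - 1)"
            using s2 r0 by (intro mult_mono) auto
          finally show ?thesis .
        qed
      qed
    qed
  qed
qed

text \<open>A vertex \<open>b\<close> outside the exceptional set is joined in blue to nearly all of
  every other part, and \<open>a\<close> has many blue neighbours in all parts but one. Their common
  blue neighbourhood is therefore large in at least r - 2 \<ge> k - 2 parts and contains more
  (k-2)-cliques than \<open>recolor\<close> permits. Exchanging \<open>a\<close> and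
  \<open>b\<close> covers the other end.\<close>

lemma col_red_exceptional:
  assumes \<epsilon>: "\<epsilon> > 0" "\<epsilon> < cc / (2 * (2 * real r ^ k + 1))"
  shows "\<forall>\<^sub>F G in colF. \<forall>p. opt_partition (V G) (E G) r p \<longrightarrow>
    (\<forall>a b. {a, b} \<in> edges (red_part G) \<longrightarrow> b \<in> exceptional \<epsilon> G p)"
proof -
  define c2 where "c2 = cc / 2"
  have c2: "c2 > 0" using cc_pos by (simp add: c2_def)
  have \<epsilon>c: "\<epsilon> * (2 * real r ^ k + 1) \<le> c2"
  proof -
    have "2 * real r ^ k + 1 > 0" by (simp add: add_nonneg_pos)
    then have "\<epsilon> * (2 * (2 * real r ^ k + 1)) < cc" using \<epsilon>(2) by (simp add: pos_less_divide_eq)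
    then show ?thesis by (simp add: c2_def algebra_simps)
  qed
  \<comment> \<open>Half of the (k-2)-transversals of the common neighbourhood remain as cliques
    after removing those with a missing pair.\<close>
  define \<rho> where "\<rho> = c2 ^ (k - 2) / 2"
  have \<rho>: "\<rho> > 0" using c2 by (simp add: \<rho>_def)
  show ?thesis
    using col_all_but_one col_nearly_complete[OF \<epsilon>(1)] col_near[OF \<rho>] colF_extremal colF_large[of "nat \<lceil>1 / \<rho>\<rceil> + 1"]
  proof eventually_elim
    case (elim G)
    note ex = extremalD[OF elim(4)]
    interpret B: fgraph "V G" "Eb G" by (rule ex(6))
    let ?n = "real (sz G)"
    have n: "?n > 0" "sz G > 0" using elim(5) by auto
    have "?n > 1 / \<rho>" using elim(5) by linarith
    then have n\<rho>: "1 < \<rho> * ?n" using \<rho> by (simp add: field_simps)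
    show ?case
    proof (intro allI impI, rule ccontr)
      fix p a b assume p: "opt_partition (V G) (E G) r p" and e: "{a, b} \<in> edges (red_part G)"
        and nb: "b \<notin> exceptional \<epsilon> G p"
      have pr: "p v < r" for v using p by (simp add: opt_partition_def)
      have ab: "a \<in> V G" "b \<in> V G" using e graph_edge[OF ex(1)] by (auto simp: red_part_def)
      let ?N = "ext (V G) (Eb G) {a, b}" and ?Na = "ext (V G) (Eb G) {a}" and ?Nb = "ext (V G) (Eb G) {b}"
      obtain i0 where i0: "i0 < r" "\<And>i. i < r \<Longrightarrow> i \<noteq> i0 \<Longrightarrow> cc * ?n \<le> real (card (part ?Na p i))"
        using elim(1) p ab(1) by blast
      have "part ?Nb p (p b) \<subseteq> part (ext (V G) (E G) {b}) p (p b)" using Eb_E by (auto simp: part_def ext_def)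
      then have "card (part ?Nb p (p b)) \<le> card (part (ext (V G) (E G) {b}) p (p b))"
        by (rule card_mono[rotated]) (use ex(7) in \<open>auto simp: part_def ext_def\<close>)
      then have "real (card (part ?Nb p (p b))) \<le> \<epsilon> * ?n" using nb ab(2) by (auto simp: exceptional_def)
      then have miss: "real (card (part (V G) p j - ?Nb)) \<le> \<epsilon> * (2 * real r ^ k + 1) * ?n" if "j < r" "j \<noteq> p b" for j
        using elim(2) p ab(2) that by blast
      \<comment> \<open>Left out are the part in which \<open>a\<close> may be poor and the part of
        \<open>b\<close> itself; the two may coincide.\<close>
      define J where "J = {..<r} - {i0, p b}"
      have lowN: "c2 * ?n \<le> real (card (part ?N p j))" if j: "j \<in> J" for j
      proof -
        have fin: "finite (part (V G) p j)" "finite (part ?N p j)" using ex(7) by (auto simp: part_def ext_def)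
        have "part ?Na p j \<subseteq> part ?N p j \<union> (part (V G) p j - ?Nb)" by (auto simp: part_def ext_def)
        then have "card (part ?Na p j) \<le> card (part ?N p j \<union> (part (V G) p j - ?Nb))"
          by (rule card_mono[rotated]) (use fin in auto)
        also have "\<dots> \<le> card (part ?N p j) + card (part (V G) p j - ?Nb)" by (rule card_Un_le)
        finally have "real (card (part ?Na p j)) \<le> real (card (part ?N p j)) + real (card (part (V G) p j - ?Nb))" by linarith
        moreover have "cc * ?n \<le> real (card (part ?Na p j))" using j i0 by (auto simp: J_def)
        moreover have "real (card (part (V G) p j - ?Nb)) \<le> \<epsilon> * (2 * real r ^ k + 1) * ?n" using j miss by (auto simp: J_def)
        moreover have "\<epsilon> * (2 * real r ^ k + 1) * ?n \<le> c2 * ?n" using \<epsilon>c by (intro mult_right_mono) auto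
        moreover have "cc * ?n = c2 * ?n + c2 * ?n" by (simp add: c2_def)
        ultimately show ?thesis by linarith
      qed
      have finJ: "finite J" by (simp add: J_def)
      have "card {..<r} - card {i0, p b} \<le> card J" unfolding J_def by (rule diff_card_le_card_Diff) simp
      moreover have "card {i0, p b} \<le> 2" by (simp add: card_insert_if)
      ultimately have "k - 2 \<le> card J" using kr by simp
      then have ch: "real (card J choose (k - 2)) \<ge> 1" using zero_less_binomial[of "k - 2" "card J"] by linarith
      have finN: "finite ?N" by (rule finite_ext[OF ex(7)])
      have "1 * (c2 * ?n) ^ (k - 2) \<le> real (card J choose (k - 2)) * (c2 * ?n) ^ (k - 2)"
        using ch c2 by (intro mult_right_mono) auto
      also have "\<dots> \<le> real (card (transversals ?N p J (k - 2)))"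
        by (rule card_transversals_ge[OF finN finJ _ lowN]) (use c2 in auto)
      also have "\<dots> \<le> \<rho> * ?n ^ (k - 2) + real (card (clq ?N (Eb G) (k - 2)))"
      proof (rule B.card_transversals_le_clq[OF _ n(2)])
        have "near \<rho> G p" using elim(3) p by blast
        then show "real (card (cross_missing (V G) (Eb G) p)) \<le> \<rho> * ?n\<^sup>2" by (simp add: nearly_turan_def)
      qed (auto simp: ext_def)
      also have "real (card (clq ?N (Eb G) (k - 2))) \<le> 1"
        using recolor[OF ex(3,4) _ e] k3 by simp
      finally have "\<rho> * ?n ^ (k - 2) \<le> 1" by (simp add: \<rho>_def power_mult_distrib)
      moreover have "\<rho> * ?n ^ 1 \<le> \<rho> * ?n ^ (k - 2)"
        using \<rho> n k3 by (intro mult_left_mono power_increasing) auto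
      ultimately show False using n\<rho> by simp
    qed
  qed
qed

text \<open>The conclusion of (ii) with the error of the part sizes as a parameter \<eta>, the shape
  that \<open>vanishing_rate\<close> takes.\<close>

definition structured :: "real \<Rightarrow> real \<Rightarrow> real \<Rightarrow> nat \<Rightarrow> nat blue_red_graph \<Rightarrow> bool" where
  "structured \<epsilon> K \<eta> n G \<longleftrightarrow> (\<exists>(A :: nat \<Rightarrow> nat set) B.
     (\<Union>i<r. A i) = verts G \<and> disjoint_family_on A {..<r} \<and>
     B \<subseteq> verts G \<and> real (card B) \<le> real r * K * (real (sigma F) - 1) \<and>
     (\<forall>i<r. \<bar>real (card (A i)) - real n / real r\<bar> \<le> \<eta> * (real n / real r)) \<and>
     (\<forall>e \<in> edges (red_part G). e \<subseteq> B) \<and>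
     (\<forall>v \<in> B.
        (\<forall>i<r. real (card (nbrs G v \<inter> A i)) \<ge> \<epsilon> * real n) \<and>
        (\<exists>i\<^sub>0<r. \<forall>i<r. i \<noteq> i\<^sub>0 \<longrightarrow> real (card (nbrs G v \<inter> A i)) \<ge> cc * real n)) \<and>
     (\<forall>i<r. \<forall>v \<in> A i - B.
        real (card (nbrs G v \<inter> A i)) \<le> \<epsilon> * real n \<and>
        (\<forall>j<r. j \<noteq> i \<longrightarrow>
           real (card (A j - nbrs G v)) \<le> \<epsilon> * (2 * real r ^ k + 1) * real n)))"

text \<open>\<open>K\<close> is fixed before \<eta>, so that it depends neither on \<open>n\<close>
  nor on the rate at which the part sizes converge.\<close>

lemma col_structure:
  assumes \<epsilon>: "\<epsilon> > 0" "\<epsilon> < cc / (2 * (2 * real r ^ k + 1))"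
  shows "\<exists>K :: real. \<forall>\<eta>>0. \<forall>\<^sub>F G in colF. structured \<epsilon> K \<eta> (sz G) G"
proof -
  obtain K :: real where K: "\<forall>\<^sub>F G in colF. \<forall>p. opt_partition (V G) (E G) r p \<longrightarrow>
    real (card (exceptional \<epsilon> G p)) \<le> real r * K * (real (sigma F) - 1)"
    using col_exceptional_bound[OF \<epsilon>(1)] by blast
  show ?thesis
  proof (intro exI[of _ K] allI impI)
    fix \<eta> :: real assume \<eta>: "\<eta> > 0"
    then have "\<eta> / real r > 0" using r0 by simp
    from col_near[OF this] K col_red_exceptional[OF \<epsilon>] col_nearly_complete[OF \<epsilon>(1)] col_all_but_one colF_extremal
    show "\<forall>\<^sub>F G in colF. structured \<epsilon> K \<eta> (sz G) G"
    proof eventually_elim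
      case (elim G)
      note ex = extremalD[OF elim(6)]
      interpret fgraph "V G" "E G" by (rule ex(5))
      let ?n = "real (sz G)"
      obtain p where p: "opt_partition (V G) (E G) r p" using exists_opt_partition[OF r0(1)] by blast
      have pr: "p v < r" for v using p by (simp add: opt_partition_def)
      define A where "A = part (V G) p"
      define B where "B = exceptional \<epsilon> G p"
      have nb: "nbrs G v \<inter> A i = part (ext (V G) (E G) {v}) p i" for v i
        by (auto simp: nbrs_def A_def part_def ext_def adj_def insert_commute)
      \<comment> \<open>The exceptional set and the conclusion refer to all edges, the neighbourhood
        lemmas to blue ones; blue neighbourhoods are smaller, which is the right direction in each
        use.\<close>
      have mono: "card (part (ext (V G) (Eb G) {v}) p i) \<le> card (part (ext (V G) (E G) {v}) p i)" for v i
        by (rule card_mono) (use finV Eb_E in \<open>auto simp: part_def ext_def\<close>)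
      have nrp: "near (\<eta> / real r) G p" using elim(1) p by blast
      have 1: "(\<Union>i<r. A i) = verts G" using pr by (auto simp: A_def part_def)
      have 2: "disjoint_family_on A {..<r}" by (auto simp: A_def part_def disjoint_family_on_def)
      have 3: "B \<subseteq> verts G" by (auto simp: B_def exceptional_def)
      have 4: "real (card B) \<le> real r * K * (real (sigma F) - 1)" unfolding B_def using elim(2) p by blast
      have 5: "\<bar>real (card (A i)) - ?n / real r\<bar> \<le> \<eta> * (?n / real r)" if "i < r" for i
        using nrp that by (simp add: nearly_turan_def A_def)
      have 6: "e \<subseteq> B" if e: "e \<in> edges (red_part G)" for e
      proof -
        have "e \<in> edges G" using e by (auto simp: red_part_def)
        then obtain a b where ab: "e = {a, b}" using graph_edgeE[OF ex(1)] by metis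
        have "b \<in> B" unfolding B_def using elim(3) p e ab by blast
        moreover have "{b, a} \<in> edges (red_part G)" using e ab by (simp add: insert_commute)
        then have "a \<in> B" unfolding B_def using elim(3) p by blast
        ultimately show ?thesis using ab by simp
      qed
      have 7: "(\<forall>i<r. real (card (nbrs G v \<inter> A i)) \<ge> \<epsilon> * ?n) \<and>
        (\<exists>i\<^sub>0<r. \<forall>i<r. i \<noteq> i\<^sub>0 \<longrightarrow> real (card (nbrs G v \<inter> A i)) \<ge> cc * ?n)" if v: "v \<in> B" for v
      proof
        show "\<forall>i<r. real (card (nbrs G v \<inter> A i)) \<ge> \<epsilon> * ?n"
          unfolding nb using exceptional_degree[OF ex(5) p] v by (simp add: B_def)
        have "v \<in> V G" using v 3 by blast
        then obtain i0 where i0: "i0 < r" "\<forall>i<r. i \<noteq> i0 \<longrightarrow> cc * ?n \<le> real (card (part (ext (V G) (Eb G) {v}) p i))"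
          using elim(5) p by blast
        show "\<exists>i\<^sub>0<r. \<forall>i<r. i \<noteq> i\<^sub>0 \<longrightarrow> real (card (nbrs G v \<inter> A i)) \<ge> cc * ?n"
          unfolding nb
        proof (intro exI[of _ i0] conjI allI impI i0(1))
          fix i assume "i < r" "i \<noteq> i0"
          then have "cc * ?n \<le> real (card (part (ext (V G) (Eb G) {v}) p i))" using i0(2) by blast
          then show "cc * ?n \<le> real (card (part (ext (V G) (E G) {v}) p i))" using mono[of v i] by linarith
        qed
      qed
      have 8: "real (card (nbrs G v \<inter> A i)) \<le> \<epsilon> * ?n \<and>
        (\<forall>j<r. j \<noteq> i \<longrightarrow> real (card (A j - nbrs G v)) \<le> \<epsilon> * (2 * real r ^ k + 1) * ?n)"
        if "i < r" and v: "v \<in> A i - B" for i v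
      proof
        have pv: "p v = i" "v \<in> V G" "v \<notin> B" using v by (auto simp: A_def part_def)
        then show le: "real (card (nbrs G v \<inter> A i)) \<le> \<epsilon> * ?n"
          unfolding nb by (auto simp: B_def exceptional_def)
        have "real (card (part (ext (V G) (Eb G) {v}) p (p v))) \<le> \<epsilon> * ?n"
          unfolding pv(1) using le[unfolded nb] mono[of v i] by linarith
        then have c: "real (card (part (V G) p j - ext (V G) (Eb G) {v})) \<le> \<epsilon> * (2 * real r ^ k + 1) * ?n" if "j < r" "j \<noteq> i" for j
          using elim(4) p pv that by blast
        show "\<forall>j<r. j \<noteq> i \<longrightarrow> real (card (A j - nbrs G v)) \<le> \<epsilon> * (2 * real r ^ k + 1) * ?n"
        proof (intro allI impI)
          fix j assume j: "j < r" "j \<noteq> i"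
          have "A j - nbrs G v \<subseteq> part (V G) p j - ext (V G) (Eb G) {v}"
            using Eb_E[of G _ v] by (auto simp: A_def nbrs_def ext_def adj_def insert_commute)
          then have "card (A j - nbrs G v) \<le> card (part (V G) p j - ext (V G) (Eb G) {v})"
            by (rule card_mono[rotated]) (use finite_part in auto)
          then show "real (card (A j - nbrs G v)) \<le> \<epsilon> * (2 * real r ^ k + 1) * ?n" using c[OF j] by linarith
        qed
      qed
      show ?case
        unfolding structured_def
        by (intro exI[of _ A] exI[of _ B] conjI allI ballI impI 1 2 3 4 5 6) (use 7 8 in blast)+
    qed
  qed
qed

section \<open>Return from filters of extremal objects to sequences in n\<close>

lemma colF_sequentially:
  assumes "\<forall>\<^sub>F G in colF. P (sz G) G"
  shows "\<forall>\<^sub>F n in sequentially. \<forall>G \<in> free_blue_red_graphs n F. g k G = ex_col k n F \<longrightarrow> P n G"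
  using eventually_size_filter[OF assms[unfolded colF_def]]
  by eventually_elim (auto simp: extremal_def free_blue_red_graphs_def)

lemma bergeF_sequentially:
  assumes "\<forall>\<^sub>F H in bergeF. P (card (verts H)) H"
  shows "\<forall>\<^sub>F n in sequentially. \<forall>H \<in> berge_free_hypergraphs k n F. card (edges H) = ex_berge k n F \<longrightarrow> P n H"
  using eventually_size_filter[OF assms[unfolded bergeF_def]]
  by eventually_elim (auto simp: berge_free_hypergraphs_def)

lemma vertex_degrees_col:
  "\<exists>\<delta> :: nat \<Rightarrow> real. \<delta> \<longlonglongrightarrow> 0 \<and>
        (\<forall>\<^sub>F n in sequentially. \<forall>G \<in> free_blue_red_graphs n F. g k G = ex_col k n F \<longrightarrow>
          (\<forall>u \<in> verts G.
             real (card {S \<in> blue_cliques k G. u \<in> verts S}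
                   + card {e \<in> edges (red_part G). u \<in> e})
             \<ge> (1 + \<delta> n) * real ((r - 1) choose (k - 1)) * (real n / real r) ^ (k - 1)))"
proof -
  have "\<exists>\<delta>. \<delta> \<longlonglongrightarrow> 0 \<and> (\<forall>\<^sub>F n in sequentially. \<forall>G \<in> free_blue_red_graphs n F. g k G = ex_col k n F \<longrightarrow>
        (\<forall>u \<in> verts G. (1 - \<delta> n) * real ((r - 1) choose (k - 1)) * (real n / real r) ^ (k - 1)
          \<le> real (card {S \<in> blue_cliques k G. u \<in> verts S} + card {e \<in> edges (red_part G). u \<in> e})))"
    by (rule vanishing_rate, rule colF_sequentially, erule col_degree)
  then obtain \<delta> where "\<delta> \<longlonglongrightarrow> 0" "\<forall>\<^sub>F n in sequentially. \<forall>G \<in> free_blue_red_graphs n F. g k G = ex_col k n F \<longrightarrow>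
        (\<forall>u \<in> verts G. (1 - \<delta> n) * real ((r - 1) choose (k - 1)) * (real n / real r) ^ (k - 1)
          \<le> real (card {S \<in> blue_cliques k G. u \<in> verts S} + card {e \<in> edges (red_part G). u \<in> e}))"
    by blast
  then show ?thesis using tendsto_minus[of \<delta> 0 sequentially] by (intro exI[of _ "\<lambda>n. - \<delta> n"]) simp
qed

lemma vertex_degrees_berge:
  "\<exists>\<delta> :: nat \<Rightarrow> real. \<delta> \<longlonglongrightarrow> 0 \<and>
        (\<forall>\<^sub>F n in sequentially. \<forall>H \<in> berge_free_hypergraphs k n F.
          card (edges H) = ex_berge k n F \<longrightarrow>
          (\<forall>u \<in> verts H.
             real (card {h \<in> edges H. u \<in> h})
             \<ge> (1 + \<delta> n) * real ((r - 1) choose (k - 1)) * (real n / real r) ^ (k - 1)))"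
proof -
  have "\<exists>\<delta>. \<delta> \<longlonglongrightarrow> 0 \<and> (\<forall>\<^sub>F n in sequentially. \<forall>H \<in> berge_free_hypergraphs k n F. card (edges H) = ex_berge k n F \<longrightarrow>
        (\<forall>u \<in> verts H. (1 - \<delta> n) * real ((r - 1) choose (k - 1)) * (real n / real r) ^ (k - 1)
          \<le> real (card {h \<in> edges H. u \<in> h})))"
    by (rule vanishing_rate, rule bergeF_sequentially, erule berge_degree)
  then obtain \<delta> where "\<delta> \<longlonglongrightarrow> 0" "\<forall>\<^sub>F n in sequentially. \<forall>H \<in> berge_free_hypergraphs k n F. card (edges H) = ex_berge k n F \<longrightarrow>
        (\<forall>u \<in> verts H. (1 - \<delta> n) * real ((r - 1) choose (k - 1)) * (real n / real r) ^ (k - 1)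
          \<le> real (card {h \<in> edges H. u \<in> h}))"
    by blast
  then show ?thesis using tendsto_minus[of \<delta> 0 sequentially] by (intro exI[of _ "\<lambda>n. - \<delta> n"]) simp
qed

lemma structure_col:
  assumes "0 < \<epsilon>" "\<epsilon> < cc / (2 * (2 * real r ^ k + 1))"
  shows "\<exists>K :: real. \<exists>\<delta> :: nat \<Rightarrow> real. \<delta> \<longlonglongrightarrow> 0 \<and>
          (\<forall>\<^sub>F n in sequentially. \<forall>G \<in> free_blue_red_graphs n F. g k G = ex_col k n F \<longrightarrow>
            structured \<epsilon> K (\<delta> n) n G)"
proof -
  obtain K :: real where K: "\<And>\<eta>. \<eta> > 0 \<Longrightarrow> \<forall>\<^sub>F G in colF. structured \<epsilon> K \<eta> (sz G) G"
    using col_structure[OF assms] by blast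
  show ?thesis by (rule exI[of _ K], rule vanishing_rate, rule colF_sequentially, rule K)
qed

end

theorem theorem1p7:
  fixes k r :: nat and F :: "'f hypergraph"
  assumes "k \<ge> 3"
    and "is_graph F"
    and "chromatic_number F = r + 1"
    and "r + 1 > k"
  shows
    (* (i) *)
    "(\<exists>\<delta> :: nat \<Rightarrow> real. \<delta> \<longlonglongrightarrow> 0 \<and>
        (\<forall>\<^sub>F n in sequentially. \<forall>G \<in> free_blue_red_graphs n F. g k G = ex_col k n F \<longrightarrow>
          (\<forall>u \<in> verts G.
             real (card {S \<in> blue_cliques k G. u \<in> verts S}
                   + card {e \<in> edges (red_part G). u \<in> e})
             \<ge> (1 + \<delta> n) * real ((r - 1) choose (k - 1)) * (real n / real r) ^ (k - 1))))
     \<and>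
     \<comment> \<open>(ii)\<close>
     (\<exists>c :: real. c > 0 \<and> (\<exists>\<epsilon>\<^sub>0 :: real. \<epsilon>\<^sub>0 > 0 \<and> (\<forall>\<epsilon> :: real. 0 < \<epsilon> \<and> \<epsilon> < \<epsilon>\<^sub>0 \<longrightarrow>
        (\<exists>K :: real. \<exists>\<delta> :: nat \<Rightarrow> real. \<delta> \<longlonglongrightarrow> 0 \<and>
          (\<forall>\<^sub>F n in sequentially. \<forall>G \<in> free_blue_red_graphs n F. g k G = ex_col k n F \<longrightarrow>
            (\<exists>(A :: nat \<Rightarrow> nat set) B.
               (\<Union>i<r. A i) = verts G \<and> disjoint_family_on A {..<r} \<and>
               B \<subseteq> verts G \<and> real (card B) \<le> real r * K * (real (sigma F) - 1) \<and>
               (\<forall>i<r. \<bar>real (card (A i)) - real n / real r\<bar> \<le> \<delta> n * (real n / real r)) \<and>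
               (\<forall>e \<in> edges (red_part G). e \<subseteq> B) \<and>
               (\<forall>v \<in> B.
                  (\<forall>i<r. real (card (nbrs G v \<inter> A i)) \<ge> \<epsilon> * real n) \<and>
                  (\<exists>i\<^sub>0<r. \<forall>i<r. i \<noteq> i\<^sub>0 \<longrightarrow> real (card (nbrs G v \<inter> A i)) \<ge> c * real n)) \<and>
               (\<forall>i<r. \<forall>v \<in> A i - B.
                  real (card (nbrs G v \<inter> A i)) \<le> \<epsilon> * real n \<and>
                  (\<forall>j<r. j \<noteq> i \<longrightarrow>
                     real (card (A j - nbrs G v)) \<le> \<epsilon> * (2 * real r ^ k + 1) * real n))))))))
     \<and>
     \<comment> \<open>(iii)\<close>
     (\<exists>\<delta> :: nat \<Rightarrow> real. \<delta> \<longlonglongrightarrow> 0 \<and>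
        (\<forall>\<^sub>F n in sequentially. \<forall>H \<in> berge_free_hypergraphs k n F.
          card (edges H) = ex_berge k n F \<longrightarrow>
          (\<forall>u \<in> verts H.
             real (card {h \<in> edges H. u \<in> h})
             \<ge> (1 + \<delta> n) * real ((r - 1) choose (k - 1)) * (real n / real r) ^ (k - 1))))"
proof -
  interpret berge_problem k r F
    by unfold_locales (use assms in auto)
  have "2 * real r ^ k + 1 > 0" by (simp add: add_nonneg_pos)
  \<comment> \<open>This threshold for \<epsilon> ensures that a vertex outside the exceptional set
    misses at most half of the \<open>cc * n\<close> neighbours that the other end of a red edge has
    in a part.\<close>
  then have "cc / (2 * (2 * real r ^ k + 1)) > 0" using cc_pos by simp
  then show ?thesis
    by (intro conjI vertex_degrees_col vertex_degrees_berge exI[of _ cc] cc_pos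
        exI[of _ "cc / (2 * (2 * real r ^ k + 1))"] allI impI structure_col[unfolded structured_def]) auto
qed

end
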